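(* The discrete spectrum of the operator $T=T_1+T_2$ coincides with the set $\mathcal{D}_0(T)$, i.e. $\sigma_{disc}(T_1+T_2)=\mathcal{D}_0(T)$.
   Context: Let $a<b$, $c<d$ be real numbers, $\mu_1,\mu_2$ the Lebesgue measures on $[a,b]$ and $[c,d]$, and let $n,m$ be positive integers. $L_2$ spaces are complex, and $E$ denotes the identity operator on $L_2([a,b]\times[c,d])$. Let $\{\varphi_k\}_{k=1}^n$ be an orthonormal system in $L_2[a,b]$, $\{h_k\}_{k=1}^n$ essentially bounded real measurable functions on $[c,d]$, $\{\psi_j\}_{j=1}^m$ an orthonormal system in $L_2[c,d]$, and $\{p_j\}_{j=1}^m$ essentially bounded real measurable functions on $[a,b]$. Define the bounded self-adjoint operators on $L_2([a,b]\times[c,d])$ $$T_1f(x,y)=\int_a^b\sum_{k=1}^n\varphi_k(x)\overline{\varphi_k(s)}h_k(y)f(s,y)\,d\mu_1(s),\qquad T_2f(x,y)=\int_c^d\sum_{j=1}^m p_j(x)\psi_j(y)\overline{\psi_j(t)}f(x,t)\,d\mu_2(t).$$ Define the projectors $P_kf(x,y)=\int_a^b\varphi_k(x)\overline{\varphi_k(s)}f(s,y)\,d\mu_1(s)$, $k=1,\dots,n$. For $\tau\in\mathbb{C}\setminus\{0\}$ with $\tau^{-1}\in\rho(T_1)\cap\rho(T_2)$ (where $\rho$ denotes the resolvent set), put $$S_1(\tau)f(x,y)=\sum_{k=1}^n\frac{h_k(y)}{1-\tau h_k(y)}(P_kf)(x,y),\qquad W_1(\tau)=(E-\tau T_2)^{-1}S_1(\tau)T_2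 .$$ $W_1(\tau)$ is a compact (in fact finite rank) operator; let $\Delta_1(\tau)$ be the Fredholm determinant of $E-\tau^2W_1(\tau)$. Put $$\mathcal{D}(T)=\{\tau\in\mathbb{C}\setminus\{0\}:\ \tau^{-1}\in\rho(T_1)\cap\rho(T_2),\ \Delta_1(\tau)=0\},\qquad \mathcal{D}_0(T)=\{1/\tau:\ \tau\in\mathcal{D}(T)\}.$$ For a self-adjoint operator, $\sigma_{disc}$ denotes the discrete spectrum: the set of isolated points of the spectrum that are eigenvalues of finite multiplicity. *)

theory Defs
  imports "HOL-Analysis.Analysis" "Jordan_Normal_Form.Determinant"
begin

text \<open>The elements of \<open>L\<^sub>2(M)\<close> are represented by square-integrable measurable functions, and
  operators on \<open>L\<^sub>2(M)\<close> by maps on functions. Equality in \<open>L\<^sub>2(M)\<close> is equality almost everywhere, so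
  every identity between elements of \<open>L\<^sub>2(M)\<close> below is stated with \<open>AE\<close>.\<close>

definition L2 :: "'a measure \<Rightarrow> ('a \<Rightarrow> complex) set" where
  "L2 M = {f \<in> borel_measurable M. integrable M (\<lambda>x. (cmod (f x))\<^sup>2)}"

definition L2_inner :: "'a measure \<Rightarrow> ('a \<Rightarrow> complex) \<Rightarrow> ('a \<Rightarrow> complex) \<Rightarrow> complex" where
  "L2_inner M f g = (LINT x|M. f x * cnj (g x))"

definition L2_norm :: "'a measure \<Rightarrow> ('a \<Rightarrow> complex) \<Rightarrow> real" where
  "L2_norm M f = sqrt (LINT x|M. (cmod (f x))\<^sup>2)"

definition L2_orthonormal :: "'a measure \<Rightarrow> nat \<Rightarrow> (nat \<Rightarrow> 'a \<Rightarrow> complex) \<Rightarrow> bool" where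
  "L2_orthonormal M n \<phi> \<longleftrightarrow> (\<forall>k\<in>{1..n}. \<phi> k \<in> L2 M) \<and>
     (\<forall>k\<in>{1..n}. \<forall>l\<in>{1..n}. L2_inner M (\<phi> k) (\<phi> l) = (if k = l then 1 else 0))"

definition ess_bounded :: "'a measure \<Rightarrow> ('a \<Rightarrow> real) \<Rightarrow> bool" where
  "ess_bounded M h \<longleftrightarrow> h \<in> borel_measurable M \<and> (\<exists>C. AE x in M. \<bar>h x\<bar> \<le> C)"

text \<open>Linearity and boundedness together force \<open>A\<close> to respect equality almost everywhere.\<close>

definition bounded_op :: "'a measure \<Rightarrow> (('a \<Rightarrow> complex) \<Rightarrow> ('a \<Rightarrow> complex)) \<Rightarrow> bool" where
  "bounded_op M A \<longleftrightarrow>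
     (\<forall>f\<in>L2 M. A f \<in> L2 M) \<and>
     (\<forall>f\<in>L2 M. \<forall>g\<in>L2 M. AE x in M. A (\<lambda>z. f z + g z) x = A f x + A g x) \<and>
     (\<forall>\<alpha>. \<forall>f\<in>L2 M. AE x in M. A (\<lambda>z. \<alpha> * f z) x = \<alpha> * A f x) \<and>
     (\<exists>C. \<forall>f\<in>L2 M. L2_norm M (A f) \<le> C * L2_norm M f)"

definition is_inverse_op ::
  "'a measure \<Rightarrow> (('a \<Rightarrow> complex) \<Rightarrow> ('a \<Rightarrow> complex)) \<Rightarrow> (('a \<Rightarrow> complex) \<Rightarrow> ('a \<Rightarrow> complex)) \<Rightarrow> bool" where
  "is_inverse_op M A R \<longleftrightarrow> bounded_op M R \<and>
     (\<forall>f\<in>L2 M. (AE x in M. R (A f) x = f x) \<and> (AE x in M. A (R f) x = f x))"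

text \<open>For a bounded operator \<open>A\<close> the inverse, if it exists, is unique up to equality almost
  everywhere.\<close>

definition inverse_op ::
  "'a measure \<Rightarrow> (('a \<Rightarrow> complex) \<Rightarrow> ('a \<Rightarrow> complex)) \<Rightarrow> (('a \<Rightarrow> complex) \<Rightarrow> ('a \<Rightarrow> complex))" where
  "inverse_op M A = (SOME R. is_inverse_op M A R)"

definition resolvent_set ::
  "'a measure \<Rightarrow> (('a \<Rightarrow> complex) \<Rightarrow> ('a \<Rightarrow> complex)) \<Rightarrow> complex set" where
  "resolvent_set M A = {l. \<exists>R. is_inverse_op M (\<lambda>f z. l * f z - A f z) R}"

definition spectrum ::
  "'a measure \<Rightarrow> (('a \<Rightarrow> complex) \<Rightarrow> ('a \<Rightarrow> complex)) \<Rightarrow> complex set" where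
  "spectrum M A = - resolvent_set M A"

definition eigenspace ::
  "'a measure \<Rightarrow> (('a \<Rightarrow> complex) \<Rightarrow> ('a \<Rightarrow> complex)) \<Rightarrow> complex \<Rightarrow> ('a \<Rightarrow> complex) set" where
  "eigenspace M A l = {f \<in> L2 M. AE x in M. A f x = l * f x}"

definition is_eigenvalue ::
  "'a measure \<Rightarrow> (('a \<Rightarrow> complex) \<Rightarrow> ('a \<Rightarrow> complex)) \<Rightarrow> complex \<Rightarrow> bool" where
  "is_eigenvalue M A l \<longleftrightarrow> (\<exists>f\<in>eigenspace M A l. \<not> (AE x in M. f x = 0))"

definition finite_multiplicity ::
  "'a measure \<Rightarrow> (('a \<Rightarrow> complex) \<Rightarrow> ('a \<Rightarrow> complex)) \<Rightarrow> complex \<Rightarrow> bool" where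
  "finite_multiplicity M A l \<longleftrightarrow>
     (\<exists>B. finite B \<and> B \<subseteq> eigenspace M A l \<and>
        (\<forall>f\<in>eigenspace M A l. \<exists>\<alpha>. AE x in M. f x = (\<Sum>g\<in>B. \<alpha> g * g x)))"

definition discrete_spectrum ::
  "'a measure \<Rightarrow> (('a \<Rightarrow> complex) \<Rightarrow> ('a \<Rightarrow> complex)) \<Rightarrow> complex set" where
  "discrete_spectrum M A =
     {l. l isolated_in (spectrum M A) \<and> is_eigenvalue M A l \<and> finite_multiplicity M A l}"

text \<open>\<open>K = \<Sum>\<^sub>i \<langle>\<cdot>, u\<^sub>i\<rangle> v\<^sub>i\<close> with \<open>i < r\<close>, i.e. \<open>K\<close> is the integral operator with degenerate kernel
  \<open>\<Sum>\<^sub>i v\<^sub>i(x) cnj (u\<^sub>i(s))\<close>. Such a representation exists iff \<open>K\<close> is bounded of finite rank.\<close>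

definition finite_rank_rep ::
  "'a measure \<Rightarrow> (('a \<Rightarrow> complex) \<Rightarrow> ('a \<Rightarrow> complex)) \<Rightarrow> nat \<Rightarrow>
   (nat \<Rightarrow> 'a \<Rightarrow> complex) \<Rightarrow> (nat \<Rightarrow> 'a \<Rightarrow> complex) \<Rightarrow> bool" where
  "finite_rank_rep M K r u v \<longleftrightarrow>
     (\<forall>i<r. u i \<in> L2 M \<and> v i \<in> L2 M) \<and>
     (\<forall>f\<in>L2 M. AE x in M. K f x = (\<Sum>i<r. L2_inner M f (u i) * v i x))"

text \<open>The Fredholm determinant of \<open>E - K\<close> for \<open>K\<close> of finite rank: for a degenerate kernel as above
  it is \<open>det (\<delta>\<^sub>i\<^sub>j - \<langle>v\<^sub>j, u\<^sub>i\<rangle>)\<close>, with \<open>i, j < r\<close>. This value is the same for all representations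
  of \<open>K\<close>, so the choice made by \<open>SOME\<close> is immaterial.\<close>

definition fredholm_det :: "'a measure \<Rightarrow> (('a \<Rightarrow> complex) \<Rightarrow> ('a \<Rightarrow> complex)) \<Rightarrow> complex" where
  "fredholm_det M K =
     (case (SOME (r, u, v). finite_rank_rep M K r u v) of (r, u, v) \<Rightarrow>
        Determinant.det (Matrix.mat r r
          (\<lambda>(i, j). (if i = j then 1 else 0) - L2_inner M (v j) (u i))))"

definition T1_op :: "real measure \<Rightarrow> nat \<Rightarrow> (nat \<Rightarrow> real \<Rightarrow> complex) \<Rightarrow> (nat \<Rightarrow> real \<Rightarrow> real) \<Rightarrow>
    (real \<times> real \<Rightarrow> complex) \<Rightarrow> (real \<times> real \<Rightarrow> complex)" where
  "T1_op M1 n \<phi> h f = (\<lambda>(x, y).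
     LINT s|M1. (\<Sum>k=1..n. \<phi> k x * cnj (\<phi> k s) * complex_of_real (h k y)) * f (s, y))"

definition T2_op :: "real measure \<Rightarrow> nat \<Rightarrow> (nat \<Rightarrow> real \<Rightarrow> complex) \<Rightarrow> (nat \<Rightarrow> real \<Rightarrow> real) \<Rightarrow>
    (real \<times> real \<Rightarrow> complex) \<Rightarrow> (real \<times> real \<Rightarrow> complex)" where
  "T2_op M2 m \<psi> p f = (\<lambda>(x, y).
     LINT t|M2. (\<Sum>j=1..m. complex_of_real (p j x) * \<psi> j y * cnj (\<psi> j t)) * f (x, t))"

definition P_op :: "real measure \<Rightarrow> (real \<Rightarrow> complex) \<Rightarrow>
    (real \<times> real \<Rightarrow> complex) \<Rightarrow> (real \<times> real \<Rightarrow> complex)" where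
  "P_op M1 \<phi>k f = (\<lambda>(x, y). LINT s|M1. \<phi>k x * cnj (\<phi>k s) * f (s, y))"

definition S1_op :: "real measure \<Rightarrow> nat \<Rightarrow> (nat \<Rightarrow> real \<Rightarrow> complex) \<Rightarrow> (nat \<Rightarrow> real \<Rightarrow> real) \<Rightarrow>
    complex \<Rightarrow> (real \<times> real \<Rightarrow> complex) \<Rightarrow> (real \<times> real \<Rightarrow> complex)" where
  "S1_op M1 n \<phi> h \<tau> f = (\<lambda>(x, y).
     \<Sum>k=1..n. complex_of_real (h k y) / (1 - \<tau> * complex_of_real (h k y)) * P_op M1 (\<phi> k) f (x, y))"

definition W1_op :: "real measure \<Rightarrow> real measure \<Rightarrow> nat \<Rightarrow> nat \<Rightarrow>
    (nat \<Rightarrow> real \<Rightarrow> complex) \<Rightarrow> (nat \<Rightarrow> real \<Rightarrow> real) \<Rightarrow>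
    (nat \<Rightarrow> real \<Rightarrow> complex) \<Rightarrow> (nat \<Rightarrow> real \<Rightarrow> real) \<Rightarrow>
    complex \<Rightarrow> (real \<times> real \<Rightarrow> complex) \<Rightarrow> (real \<times> real \<Rightarrow> complex)" where
  "W1_op M1 M2 n m \<phi> h \<psi> p \<tau> f =
     inverse_op (M1 \<Otimes>\<^sub>M M2) (\<lambda>g z. g z - \<tau> * T2_op M2 m \<psi> p g z)
       (S1_op M1 n \<phi> h \<tau> (T2_op M2 m \<psi> p f))"

definition Delta1 :: "real measure \<Rightarrow> real measure \<Rightarrow> nat \<Rightarrow> nat \<Rightarrow>
    (nat \<Rightarrow> real \<Rightarrow> complex) \<Rightarrow> (nat \<Rightarrow> real \<Rightarrow> real) \<Rightarrow>
    (nat \<Rightarrow> real \<Rightarrow> complex) \<Rightarrow> (nat \<Rightarrow> real \<Rightarrow> real) \<Rightarrow> complex \<Rightarrow> complex" where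
  "Delta1 M1 M2 n m \<phi> h \<psi> p \<tau> =
     fredholm_det (M1 \<Otimes>\<^sub>M M2) (\<lambda>f z. \<tau>\<^sup>2 * W1_op M1 M2 n m \<phi> h \<psi> p \<tau> f z)"

definition D_set :: "real measure \<Rightarrow> real measure \<Rightarrow> nat \<Rightarrow> nat \<Rightarrow>
    (nat \<Rightarrow> real \<Rightarrow> complex) \<Rightarrow> (nat \<Rightarrow> real \<Rightarrow> real) \<Rightarrow>
    (nat \<Rightarrow> real \<Rightarrow> complex) \<Rightarrow> (nat \<Rightarrow> real \<Rightarrow> real) \<Rightarrow> complex set" where
  "D_set M1 M2 n m \<phi> h \<psi> p =
     {\<tau>. \<tau> \<noteq> 0 \<and>
        inverse \<tau> \<in> resolvent_set (M1 \<Otimes>\<^sub>M M2) (T1_op M1 n \<phi> h) \<inter>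
                    resolvent_set (M1 \<Otimes>\<^sub>M M2) (T2_op M2 m \<psi> p) \<and>
        Delta1 M1 M2 n m \<phi> h \<psi> p \<tau> = 0}"

definition D0_set :: "real measure \<Rightarrow> real measure \<Rightarrow> nat \<Rightarrow> nat \<Rightarrow>
    (nat \<Rightarrow> real \<Rightarrow> complex) \<Rightarrow> (nat \<Rightarrow> real \<Rightarrow> real) \<Rightarrow>
    (nat \<Rightarrow> real \<Rightarrow> complex) \<Rightarrow> (nat \<Rightarrow> real \<Rightarrow> real) \<Rightarrow> complex set" where
  "D0_set M1 M2 n m \<phi> h \<psi> p = {1 / \<tau> | \<tau>. \<tau> \<in> D_set M1 M2 n m \<phi> h \<psi> p}"

end

theory Submission
  imports Defs
begin

text \<open>
  Put \<open>\<tau> = 1/\<lambda>\<close>, \<open>A\<^sub>i = E - \<tau> T\<^sub>i\<close> and \<open>K = \<tau>\<^sup>2 W\<^sub>1(\<tau>)\<close>. If \<open>\<lambda> \<noteq> 0\<close> lies in both resolvent sets, then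
  \<open>A\<^sub>1 S\<^sub>1(\<tau>) = T\<^sub>1\<close>, and therefore
  \<open>E - \<tau> (T\<^sub>1 + T\<^sub>2) = A\<^sub>1 A\<^sub>2 - \<tau>\<^sup>2 T\<^sub>1 T\<^sub>2 = A\<^sub>1 A\<^sub>2 (E - K)\<close>,
  where \<open>K\<close> has finite rank because \<open>S\<^sub>1(\<tau>) T\<^sub>2\<close> has a degenerate kernel
  (\<open>W1_finite_rank_perturbation\<close>). The Fredholm alternative for \<open>E - K\<close> is linear algebra: the
  determinant \<open>\<Delta>\<^sub>1(\<tau>)\<close> is nonzero iff \<open>T\<^sub>1 + T\<^sub>2 - \<lambda>\<close> has a bounded inverse, and when it is zero, \<open>\<lambda>\<close> is
  an eigenvalue with an eigenspace of finite dimension.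

  Hence every point of \<open>\<D>\<^sub>0(T)\<close> is an eigenvalue of finite multiplicity, and near such a point the
  spectrum consists of eigenvalues. That it is isolated follows from the symmetry of
  \<open>T\<^sub>1 + T\<^sub>2\<close>: adding the finite-rank operator \<open>G = \<Sum>\<^sub>b \<langle>\<cdot>, b\<rangle> b\<close>, where \<open>b\<close> runs through a spanning set of
  the eigenspace, makes \<open>E - \<tau> (T\<^sub>1 + T\<^sub>2)\<close> injective, hence bounded below, while eigenvectors for
  other eigenvalues are orthogonal to the eigenspace and annihilated by \<open>G\<close>
  (\<open>eigenvalue_isolated_from_eigenvalues\<close>).

  Conversely, a point \<open>\<lambda>\<close> of the discrete spectrum is in \<open>\<D>\<^sub>0(T)\<close> as soon as \<open>\<lambda> \<noteq> 0\<close> and \<open>\<lambda>\<close> is in both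
  resolvent sets. On tensors \<open>u \<otimes> g\<close> with \<open>g\<close> orthogonal to all \<open>\<psi>\<^sub>j\<close> the operator \<open>T\<^sub>2\<close> vanishes, and
  since Lebesgue measure has no atoms, \<open>g\<close> can in addition be supported in any given set of positive
  measure and be orthogonal to any finite set. If \<open>u\<close> is orthogonal to all \<open>\<phi>\<^sub>k\<close>, such tensors give
  \<open>0\<close> an infinite multiplicity (\<open>zero_not_discrete\<close>). If \<open>u = \<phi>\<^sub>k\<close>, then \<open>T\<^sub>1 + T\<^sub>2\<close> acts on \<open>g\<close> as
  multiplication by \<open>h\<^sub>k\<close>. A nonzero \<open>\<lambda>\<close> in the spectrum of \<open>T\<^sub>1\<close> belongs to the essential range of some
  \<open>h\<^sub>k\<close>; either \<open>h\<^sub>k = \<lambda>\<close> on a set of positive measure, and the multiplicity is infinite, or \<open>\<lambda>\<close> is a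
  limit of other points of the essential range, and these are points of the spectrum
  (\<open>discrete_not_ess_range\<close>). Exchanging the coordinates gives the same for \<open>T\<^sub>2\<close>.
\<close>

section \<open>Square-integrable functions\<close>

lemma L2_measurable: "f \<in> L2 M \<Longrightarrow> f \<in> borel_measurable M"
  by (simp add: L2_def)

lemma L2_square_integrable: "f \<in> L2 M \<Longrightarrow> integrable M (\<lambda>x. (cmod (f x))\<^sup>2)"
  by (simp add: L2_def)

lemma L2_dominated:
  assumes f: "f \<in> borel_measurable M" and g: "integrable M g"
    and le: "AE x in M. (cmod (f x))\<^sup>2 \<le> g x"
  shows "f \<in> L2 M"
proof -
  have "integrable M (\<lambda>x. (cmod (f x))\<^sup>2)"
    by (rule Bochner_Integration.integrable_bound[OF g]) (use f le in auto)
  with f show ?thesis by (simp add: L2_def)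
qed

lemma L2_AE_cong:
  assumes "f \<in> L2 M" and "g \<in> borel_measurable M" and "AE x in M. g x = f x"
  shows "g \<in> L2 M"
  by (rule L2_dominated[OF assms(2) L2_square_integrable[OF assms(1)]]) (use assms(3) in auto)

lemma L2_add:
  assumes "f \<in> L2 M" and "g \<in> L2 M"
  shows "(\<lambda>x. f x + g x) \<in> L2 M"
proof (rule L2_dominated)
  show "(\<lambda>x. f x + g x) \<in> borel_measurable M"
    using assms[THEN L2_measurable] by simp
  show "integrable M (\<lambda>x. 2 * (cmod (f x))\<^sup>2 + 2 * (cmod (g x))\<^sup>2)"
    using assms[THEN L2_square_integrable] by simp
  have "(cmod (f x + g x))\<^sup>2 \<le> 2 * (cmod (f x))\<^sup>2 + 2 * (cmod (g x))\<^sup>2" for x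
  proof -
    have "(cmod (f x + g x))\<^sup>2 \<le> (cmod (f x) + cmod (g x))\<^sup>2"
      by (intro power_mono norm_triangle_ineq) auto
    also have "\<dots> \<le> 2 * (cmod (f x))\<^sup>2 + 2 * (cmod (g x))\<^sup>2"
      using sum_squares_bound[of "cmod (f x)" "cmod (g x)"] by (simp add: power2_sum)
    finally show ?thesis .
  qed
  then show "AE x in M. (cmod (f x + g x))\<^sup>2 \<le> 2 * (cmod (f x))\<^sup>2 + 2 * (cmod (g x))\<^sup>2"
    by simp
qed

lemma L2_bounded_mult:
  assumes f: "f \<in> L2 M" and q: "q \<in> borel_measurable M" and C: "AE x in M. cmod (q x) \<le> C"
  shows "(\<lambda>x. q x * f x) \<in> L2 M"
proof (rule L2_dominated)
  show "(\<lambda>x. q x * f x) \<in> borel_measurable M"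
    using L2_measurable[OF f] q by simp
  show "integrable M (\<lambda>x. C\<^sup>2 * (cmod (f x))\<^sup>2)"
    using L2_square_integrable[OF f] by simp
  show "AE x in M. (cmod (q x * f x))\<^sup>2 \<le> C\<^sup>2 * (cmod (f x))\<^sup>2"
    using C by eventually_elim
      (auto simp: norm_mult power_mult_distrib intro!: mult_right_mono power_mono)
qed

lemma L2_cmult: "f \<in> L2 M \<Longrightarrow> (\<lambda>x. c * f x) \<in> L2 M"
  by (rule L2_bounded_mult[where C = "cmod c"]) auto

lemma L2_diff: "f \<in> L2 M \<Longrightarrow> g \<in> L2 M \<Longrightarrow> (\<lambda>x. f x - g x) \<in> L2 M"
  using L2_add[of f M "\<lambda>x. (-1) * g x"] L2_cmult[of g M "-1"] by simp

lemma L2_zero: "(\<lambda>x. 0) \<in> L2 M"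
  by (simp add: L2_def)

lemma L2_sum: "(\<And>i. i \<in> I \<Longrightarrow> f i \<in> L2 M) \<Longrightarrow> (\<lambda>x. \<Sum>i\<in>I. f i x) \<in> L2 M"
  by (induction I rule: infinite_finite_induct) (auto simp: L2_zero intro: L2_add)

lemma borel_measurable_cnj [measurable]:
  "f \<in> borel_measurable M \<Longrightarrow> (\<lambda>x. cnj (f x)) \<in> borel_measurable M"
  using borel_measurable_continuous_on[OF continuous_on_cnj[OF continuous_on_id], of f M]
  by (simp add: id_def)

lemma L2_cnj: "f \<in> L2 M \<Longrightarrow> (\<lambda>x. cnj (f x)) \<in> L2 M"
  by (simp add: L2_def borel_measurable_cnj)

lemma L2_mult_integrable:
  assumes f: "f \<in> L2 M" and g: "g \<in> L2 M"
  shows "integrable M (\<lambda>x. f x * g x)"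
proof (rule Bochner_Integration.integrable_bound)
  show "integrable M (\<lambda>x. (cmod (f x))\<^sup>2 + (cmod (g x))\<^sup>2)"
    using L2_square_integrable[OF f] L2_square_integrable[OF g] by simp
  show "(\<lambda>x. f x * g x) \<in> borel_measurable M"
    using L2_measurable[OF f] L2_measurable[OF g] by simp
  have "norm (f x * g x) \<le> norm ((cmod (f x))\<^sup>2 + (cmod (g x))\<^sup>2)" for x
  proof -
    have "0 \<le> cmod (f x) * cmod (g x)" by simp
    with sum_squares_bound[of "cmod (f x)" "cmod (g x)"] show ?thesis
      unfolding norm_mult real_norm_def by linarith
  qed
  then show "AE x in M. norm (f x * g x) \<le> norm ((cmod (f x))\<^sup>2 + (cmod (g x))\<^sup>2)"
    by simp
qed

lemma L2_inner_integrable: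
  "f \<in> L2 M \<Longrightarrow> g \<in> L2 M \<Longrightarrow> integrable M (\<lambda>x. f x * cnj (g x))"
  by (rule L2_mult_integrable[OF _ L2_cnj])

lemma L2_inner_add_left:
  "f \<in> L2 M \<Longrightarrow> g \<in> L2 M \<Longrightarrow> k \<in> L2 M \<Longrightarrow>
    L2_inner M (\<lambda>x. f x + g x) k = L2_inner M f k + L2_inner M g k"
  by (simp add: L2_inner_def distrib_right L2_inner_integrable)

lemma L2_inner_diff_left:
  "f \<in> L2 M \<Longrightarrow> g \<in> L2 M \<Longrightarrow> k \<in> L2 M \<Longrightarrow>
    L2_inner M (\<lambda>x. f x - g x) k = L2_inner M f k - L2_inner M g k"
  by (simp add: L2_inner_def left_diff_distrib L2_inner_integrable)

lemma L2_inner_cmult_left: "L2_inner M (\<lambda>x. c * f x) k = c * L2_inner M f k"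
  by (simp add: L2_inner_def mult.assoc)

lemma L2_inner_sum_left:
  assumes "\<And>i. i \<in> I \<Longrightarrow> f i \<in> L2 M" and "k \<in> L2 M"
  shows "L2_inner M (\<lambda>x. \<Sum>i\<in>I. f i x) k = (\<Sum>i\<in>I. L2_inner M (f i) k)"
  using assms by (simp add: L2_inner_def sum_distrib_right L2_inner_integrable)

lemma L2_inner_cnj: "L2_inner M f g = cnj (L2_inner M g f)"
  by (simp add: L2_inner_def Bochner_Integration.integral_cnj[symmetric] mult.commute
      del: Bochner_Integration.integral_cnj)

lemma L2_inner_diff_right:
  "f \<in> L2 M \<Longrightarrow> g \<in> L2 M \<Longrightarrow> k \<in> L2 M \<Longrightarrow>
    L2_inner M k (\<lambda>x. f x - g x) = L2_inner M k f - L2_inner M k g"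
  by (subst (1 2 3) L2_inner_cnj) (simp add: L2_inner_diff_left)

lemma L2_inner_add_right:
  "f \<in> L2 M \<Longrightarrow> g \<in> L2 M \<Longrightarrow> k \<in> L2 M \<Longrightarrow>
    L2_inner M k (\<lambda>x. f x + g x) = L2_inner M k f + L2_inner M k g"
  by (subst (1 2 3) L2_inner_cnj) (simp add: L2_inner_add_left)

lemma L2_inner_cmult_right: "L2_inner M k (\<lambda>x. c * f x) = cnj c * L2_inner M k f"
  by (subst (1 2) L2_inner_cnj) (simp add: L2_inner_cmult_left)

lemma L2_inner_sum_right:
  assumes "\<And>i. i \<in> I \<Longrightarrow> f i \<in> L2 M" and "k \<in> L2 M"
  shows "L2_inner M k (\<lambda>x. \<Sum>i\<in>I. f i x) = (\<Sum>i\<in>I. L2_inner M k (f i))"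
  by (subst (1 2) L2_inner_cnj) (simp add: L2_inner_sum_left assms)

lemma L2_inner_cong:
  assumes "AE x in M. f x = f' x" and "AE x in M. g x = g' x"
    and "f \<in> L2 M" "f' \<in> L2 M" "g \<in> L2 M" "g' \<in> L2 M"
  shows "L2_inner M f g = L2_inner M f' g'"
  unfolding L2_inner_def
  by (rule integral_cong_AE)
    (use assms in \<open>auto simp: L2_inner_integrable[THEN borel_measurable_integrable]\<close>)

lemma L2_norm_nonneg: "0 \<le> L2_norm M f"
  by (simp add: L2_norm_def)

lemma L2_norm_square: "(L2_norm M f)\<^sup>2 = (LINT x|M. (cmod (f x))\<^sup>2)"
  by (simp add: L2_norm_def)

lemma L2_inner_self: "L2_inner M f f = complex_of_real ((L2_norm M f)\<^sup>2)"
  unfolding L2_norm_square L2_inner_def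
  by (simp add: complex_norm_square[symmetric] del: of_real_power)

lemma L2_norm_cong:
  assumes "AE x in M. f x = g x" "f \<in> L2 M" "g \<in> L2 M"
  shows "L2_norm M f = L2_norm M g"
  unfolding L2_norm_def
  by (intro arg_cong[of _ _ sqrt] integral_cong_AE)
    (use assms in \<open>auto simp: L2_def\<close>)

lemma L2_norm_cmult: "L2_norm M (\<lambda>x. c * f x) = cmod c * L2_norm M f"
  by (simp add: L2_norm_def norm_mult power_mult_distrib real_sqrt_mult)

lemma L2_norm_eq_0_iff:
  assumes "f \<in> L2 M"
  shows "L2_norm M f = 0 \<longleftrightarrow> (AE x in M. f x = 0)"
  using integral_nonneg_eq_0_iff_AE[OF L2_square_integrable[OF assms]]
  by (simp add: L2_norm_def)

lemma L2_inner_zero_AE: "AE x in M. f x = 0 \<Longrightarrow> L2_inner M f g = 0"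
  unfolding L2_inner_def by (rule integral_eq_zero_AE) auto

lemma L2_Cauchy_Schwarz:
  assumes f: "f \<in> L2 M" and g: "g \<in> L2 M"
  shows "cmod (L2_inner M f g) \<le> L2_norm M f * L2_norm M g"
proof (cases "L2_norm M g = 0")
  case True
  then have "L2_inner M g f = 0"
    using L2_norm_eq_0_iff[OF g] by (simp add: L2_inner_zero_AE)
  then have "L2_inner M f g = 0"
    by (subst L2_inner_cnj) simp
  then show ?thesis
    by (simp add: L2_norm_nonneg)
next
  case False
  \<comment> \<open>The vector \<open>?k\<close> below is \<open>f\<close> minus its projection onto \<open>g\<close>; its norm is nonnegative.\<close>
  define b where "b = (L2_norm M g)\<^sup>2"
  define z where "z = L2_inner M f g"
  have b: "b > 0" using False by (simp add: b_def)
  let ?k = "\<lambda>x. f x - (z / b) * g x"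
  have gc: "(\<lambda>x. (z / b) * g x) \<in> L2 M"
    by (rule L2_cmult[OF g])
  have "complex_of_real ((L2_norm M ?k)\<^sup>2) = L2_inner M ?k ?k"
    by (simp add: L2_inner_self)
  also have "\<dots> = L2_inner M f f - cnj (z / b) * z - (z / b) * (cnj z - cnj (z / b) * b)"
    using L2_inner_self[of M g] L2_inner_cnj[of M g f]
    by (simp only: L2_inner_diff_left L2_inner_diff_right L2_diff f g gc L2_inner_cmult_left
        L2_inner_cmult_right z_def[symmetric] b_def[symmetric])
  also have "\<dots> = complex_of_real ((L2_norm M f)\<^sup>2) - z * cnj z / b"
    using b by (simp add: L2_inner_self field_simps)
  also have "\<dots> = complex_of_real ((L2_norm M f)\<^sup>2 - (cmod z)\<^sup>2 / b)"
    by (simp add: complex_norm_square[symmetric] del: of_real_power)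
  finally have "(L2_norm M ?k)\<^sup>2 = (L2_norm M f)\<^sup>2 - (cmod z)\<^sup>2 / b"
    using of_real_eq_iff by blast
  then have "(cmod z)\<^sup>2 / b \<le> (L2_norm M f)\<^sup>2"
    using zero_le_power2[of "L2_norm M ?k"] by linarith
  then have "(cmod z)\<^sup>2 \<le> (L2_norm M f * L2_norm M g)\<^sup>2"
    using b by (simp add: b_def field_simps power_mult_distrib)
  then show ?thesis
    unfolding z_def by (rule power2_le_imp_le) (simp add: L2_norm_nonneg)
qed

lemma L2_norm_triangle:
  assumes f: "f \<in> L2 M" and g: "g \<in> L2 M"
  shows "L2_norm M (\<lambda>x. f x + g x) \<le> L2_norm M f + L2_norm M g"
proof (rule power2_le_imp_le)
  have "complex_of_real ((L2_norm M (\<lambda>x. f x + g x))\<^sup>2)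
      = complex_of_real ((L2_norm M f)\<^sup>2) + (L2_inner M f g + cnj (L2_inner M f g)) + complex_of_real ((L2_norm M g)\<^sup>2)"
    using L2_inner_cnj[of M g f]
    by (simp only: L2_inner_self[symmetric])
      (simp add: L2_inner_add_left L2_inner_add_right L2_add f g)
  also have "L2_inner M f g + cnj (L2_inner M f g) = complex_of_real (2 * Re (L2_inner M f g))"
    by (rule complex_add_cnj)
  finally have "(L2_norm M (\<lambda>x. f x + g x))\<^sup>2 = (L2_norm M f)\<^sup>2 + 2 * Re (L2_inner M f g) + (L2_norm M g)\<^sup>2"
    unfolding of_real_add[symmetric] of_real_eq_iff .
  also have "\<dots> \<le> (L2_norm M f)\<^sup>2 + 2 * (L2_norm M f * L2_norm M g) + (L2_norm M g)\<^sup>2"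
    using L2_Cauchy_Schwarz[OF f g] complex_Re_le_cmod[of "L2_inner M f g"] by linarith
  also have "\<dots> = (L2_norm M f + L2_norm M g)\<^sup>2"
    by (simp add: power2_eq_square algebra_simps)
  finally show "(L2_norm M (\<lambda>x. f x + g x))\<^sup>2 \<le> (L2_norm M f + L2_norm M g)\<^sup>2" .
qed (simp add: L2_norm_nonneg)

section \<open>Bounded operators up to null sets\<close>

lemma bounded_op_L2: "bounded_op M A \<Longrightarrow> f \<in> L2 M \<Longrightarrow> A f \<in> L2 M"
  by (simp add: bounded_op_def)

lemma bounded_op_add:
  "bounded_op M A \<Longrightarrow> f \<in> L2 M \<Longrightarrow> g \<in> L2 M \<Longrightarrow> AE x in M. A (\<lambda>z. f z + g z) x = A f x + A g x"
  by (simp add: bounded_op_def)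

lemma bounded_op_cmult:
  "bounded_op M A \<Longrightarrow> f \<in> L2 M \<Longrightarrow> AE x in M. A (\<lambda>z. c * f z) x = c * A f x"
  by (simp add: bounded_op_def)

lemma bounded_op_bound:
  assumes "bounded_op M A"
  obtains C where "C \<ge> 0" "\<And>f. f \<in> L2 M \<Longrightarrow> L2_norm M (A f) \<le> C * L2_norm M f"
proof -
  obtain C where C: "\<And>f. f \<in> L2 M \<Longrightarrow> L2_norm M (A f) \<le> C * L2_norm M f"
    using assms unfolding bounded_op_def by blast
  have "L2_norm M (A f) \<le> \<bar>C\<bar> * L2_norm M f" if "f \<in> L2 M" for f
    using C[OF that] mult_right_mono[OF abs_ge_self[of C] L2_norm_nonneg[of M f]] by linarith
  then show ?thesis using that[of "\<bar>C\<bar>"] by auto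
qed

lemma bounded_opI:
  assumes "\<And>f. f \<in> L2 M \<Longrightarrow> A f \<in> L2 M"
    and "\<And>f g. f \<in> L2 M \<Longrightarrow> g \<in> L2 M \<Longrightarrow> AE x in M. A (\<lambda>z. f z + g z) x = A f x + A g x"
    and "\<And>c f. f \<in> L2 M \<Longrightarrow> AE x in M. A (\<lambda>z. c * f z) x = c * A f x"
    and "\<And>f. f \<in> L2 M \<Longrightarrow> L2_norm M (A f) \<le> C * L2_norm M f"
  shows "bounded_op M A"
  unfolding bounded_op_def using assms by blast

lemma bounded_op_diff:
  assumes A: "bounded_op M A" and f: "f \<in> L2 M" and g: "g \<in> L2 M"
  shows "AE x in M. A (\<lambda>z. f z - g z) x = A f x - A g x"
  using bounded_op_add[OF A f L2_cmult[OF g, of "-1"]] bounded_op_cmult[OF A g, of "-1"]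
  by eventually_elim simp

text \<open>The difference \<open>f - g\<close> has norm \<open>0\<close>, hence so has its image. This is what allows identities that
  hold only almost everywhere to be inserted under an operator.\<close>

lemma bounded_op_cong:
  assumes A: "bounded_op M A" and f: "f \<in> L2 M" and g: "g \<in> L2 M" and eq: "AE x in M. f x = g x"
  shows "AE x in M. A f x = A g x"
proof -
  obtain C where C: "\<And>f. f \<in> L2 M \<Longrightarrow> L2_norm M (A f) \<le> C * L2_norm M f"
    using bounded_op_bound[OF A] by blast
  have d: "(\<lambda>z. f z - g z) \<in> L2 M" by (rule L2_diff[OF f g])
  have "L2_norm M (\<lambda>z. f z - g z) = 0"
    unfolding L2_norm_eq_0_iff[OF d] using eq by eventually_elim simp
  then have "L2_norm M (A (\<lambda>z. f z - g z)) = 0"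
    using C[OF d] L2_norm_nonneg[of M "A (\<lambda>z. f z - g z)"] by simp
  then have "AE x in M. A (\<lambda>z. f z - g z) x = 0"
    using L2_norm_eq_0_iff[OF bounded_op_L2[OF A d]] by simp
  with bounded_op_diff[OF A f g] show ?thesis by eventually_elim simp
qed

lemma bounded_op_zero:
  assumes A: "bounded_op M A" and f: "f \<in> L2 M" and eq: "AE x in M. f x = 0"
  shows "AE x in M. A f x = 0"
proof -
  have "AE x in M. A f x = A (\<lambda>z. 0 * f z) x"
    by (rule bounded_op_cong[OF A f L2_cmult[OF f]]) (use eq in simp)
  with bounded_op_cmult[OF A f, of 0] show ?thesis by eventually_elim simp
qed

lemma bounded_op_lincomb:
  assumes A: "bounded_op M A" and f: "\<And>i. i \<in> I \<Longrightarrow> f i \<in> L2 M"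
  shows "AE x in M. A (\<lambda>z. \<Sum>i\<in>I. c i * f i z) x = (\<Sum>i\<in>I. c i * A (f i) x)"
  using f
proof (induction I rule: infinite_finite_induct)
  case (insert a I)
  have "AE x in M. A (\<lambda>z. c a * f a z + (\<Sum>i\<in>I. c i * f i z)) x
      = A (\<lambda>z. c a * f a z) x + A (\<lambda>z. \<Sum>i\<in>I. c i * f i z) x"
    using insert by (intro bounded_op_add[OF A] L2_sum L2_cmult) auto
  moreover have "AE x in M. A (\<lambda>z. c a * f a z) x = c a * A (f a) x"
    using insert by (intro bounded_op_cmult[OF A]) auto
  moreover have "AE x in M. A (\<lambda>z. \<Sum>i\<in>I. c i * f i z) x = (\<Sum>i\<in>I. c i * A (f i) x)"
    using insert by auto
  ultimately show ?case
    using insert by (auto elim!: eventually_elim2)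
qed (use bounded_op_zero[OF A L2_zero] in auto)

lemma bounded_op_cong_op:
  assumes A: "bounded_op M A" and B: "\<And>f. f \<in> L2 M \<Longrightarrow> B f \<in> borel_measurable M"
    and eq: "\<And>f. f \<in> L2 M \<Longrightarrow> AE x in M. B f x = A f x"
  shows "bounded_op M B"
proof -
  obtain C where C: "\<And>f. f \<in> L2 M \<Longrightarrow> L2_norm M (A f) \<le> C * L2_norm M f"
    using bounded_op_bound[OF A] by blast
  have L2: "B f \<in> L2 M" if "f \<in> L2 M" for f
    by (rule L2_AE_cong[OF bounded_op_L2[OF A that] B[OF that] eq[OF that]])
  show ?thesis
  proof (rule bounded_opI[where C = C])
    fix f g assume f: "f \<in> L2 M" and g: "g \<in> L2 M"
    show "AE x in M. B (\<lambda>z. f z + g z) x = B f x + B g x"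
      using eq[OF f] eq[OF g] eq[OF L2_add[OF f g]] bounded_op_add[OF A f g]
      by eventually_elim simp
  next
    fix c f assume f: "f \<in> L2 M"
    show "AE x in M. B (\<lambda>z. c * f z) x = c * B f x"
      using eq[OF f] eq[OF L2_cmult[OF f, of c]] bounded_op_cmult[OF A f, of c]
      by eventually_elim simp
  next
    fix f assume f: "f \<in> L2 M"
    show "L2_norm M (B f) \<le> C * L2_norm M f"
      using C[OF f] L2_norm_cong[OF eq[OF f] L2[OF f] bounded_op_L2[OF A f]] by simp
  qed (rule L2)
qed

lemma bounded_op_id: "bounded_op M (\<lambda>f. f)"
  by (rule bounded_opI[where C = 1]) auto

lemma bounded_op_comp:
  assumes A: "bounded_op M A" and B: "bounded_op M B"
  shows "bounded_op M (\<lambda>f. A (B f))"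
proof -
  obtain C where C: "C \<ge> 0" "\<And>f. f \<in> L2 M \<Longrightarrow> L2_norm M (A f) \<le> C * L2_norm M f"
    using bounded_op_bound[OF A] by blast
  obtain D where D: "D \<ge> 0" "\<And>f. f \<in> L2 M \<Longrightarrow> L2_norm M (B f) \<le> D * L2_norm M f"
    using bounded_op_bound[OF B] by blast
  note L2 = bounded_op_L2[OF A] bounded_op_L2[OF B]
  show ?thesis
  proof (rule bounded_opI[where C = "C * D"])
    fix f g assume f: "f \<in> L2 M" and g: "g \<in> L2 M"
    show "AE x in M. A (B (\<lambda>z. f z + g z)) x = A (B f) x + A (B g) x"
      using bounded_op_cong[OF A L2(2)[OF L2_add[OF f g]] L2_add[OF L2(2)[OF f] L2(2)[OF g]] bounded_op_add[OF B f g]]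
        bounded_op_add[OF A L2(2)[OF f] L2(2)[OF g]]
      by eventually_elim simp
  next
    fix c f assume f: "f \<in> L2 M"
    show "AE x in M. A (B (\<lambda>z. c * f z)) x = c * A (B f) x"
      using bounded_op_cong[OF A L2(2)[OF L2_cmult[OF f]] L2_cmult[OF L2(2)[OF f]] bounded_op_cmult[OF B f, of c]]
        bounded_op_cmult[OF A L2(2)[OF f], of c]
      by eventually_elim simp
  next
    fix f assume f: "f \<in> L2 M"
    show "L2_norm M (A (B f)) \<le> C * D * L2_norm M f"
      using C(2)[OF L2(2)[OF f]] mult_left_mono[OF D(2)[OF f] C(1)] by (simp add: mult.assoc)
  qed (simp add: L2)
qed

lemma bounded_op_scaled:
  assumes A: "bounded_op M A"
  shows "bounded_op M (\<lambda>f z. c * A f z)"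
proof -
  obtain C where C: "C \<ge> 0" "\<And>f. f \<in> L2 M \<Longrightarrow> L2_norm M (A f) \<le> C * L2_norm M f"
    using bounded_op_bound[OF A] by blast
  show ?thesis
  proof (rule bounded_opI[where C = "cmod c * C"])
    fix f g assume f: "f \<in> L2 M" and g: "g \<in> L2 M"
    show "AE x in M. c * A (\<lambda>z. f z + g z) x = c * A f x + c * A g x"
      using bounded_op_add[OF A f g] by eventually_elim (simp add: algebra_simps)
  next
    fix d f assume f: "f \<in> L2 M"
    show "AE x in M. c * A (\<lambda>z. d * f z) x = d * (c * A f x)"
      using bounded_op_cmult[OF A f, of d] by eventually_elim simp
  next
    fix f assume f: "f \<in> L2 M"
    show "L2_norm M (\<lambda>x. c * A f x) \<le> cmod c * C * L2_norm M f"
      using mult_left_mono[OF C(2)[OF f], of "cmod c"] by (simp add: L2_norm_cmult mult.assoc)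
  qed (intro L2_cmult bounded_op_L2[OF A])
qed

lemma bounded_op_plus:
  assumes A: "bounded_op M A" and B: "bounded_op M B"
  shows "bounded_op M (\<lambda>f z. A f z + B f z)"
proof -
  obtain C where C: "C \<ge> 0" "\<And>f. f \<in> L2 M \<Longrightarrow> L2_norm M (A f) \<le> C * L2_norm M f"
    using bounded_op_bound[OF A] by blast
  obtain D where D: "D \<ge> 0" "\<And>f. f \<in> L2 M \<Longrightarrow> L2_norm M (B f) \<le> D * L2_norm M f"
    using bounded_op_bound[OF B] by blast
  show ?thesis
  proof (rule bounded_opI[where C = "C + D"])
    fix f g assume f: "f \<in> L2 M" and g: "g \<in> L2 M"
    show "AE x in M. A (\<lambda>z. f z + g z) x + B (\<lambda>z. f z + g z) x = A f x + B f x + (A g x + B g x)"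
      using bounded_op_add[OF A f g] bounded_op_add[OF B f g] by eventually_elim simp
  next
    fix c f assume f: "f \<in> L2 M"
    show "AE x in M. A (\<lambda>z. c * f z) x + B (\<lambda>z. c * f z) x = c * (A f x + B f x)"
      using bounded_op_cmult[OF A f, of c] bounded_op_cmult[OF B f, of c]
      by eventually_elim (simp add: algebra_simps)
  next
    fix f assume f: "f \<in> L2 M"
    show "L2_norm M (\<lambda>x. A f x + B f x) \<le> (C + D) * L2_norm M f"
      using L2_norm_triangle[OF bounded_op_L2[OF A f] bounded_op_L2[OF B f]] C(2)[OF f] D(2)[OF f]
      by (simp add: algebra_simps)
  qed (intro L2_add bounded_op_L2[OF A] bounded_op_L2[OF B])
qed

lemma bounded_op_minus:
  assumes A: "bounded_op M A" and B: "bounded_op M B"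
  shows "bounded_op M (\<lambda>f z. A f z - B f z)"
  using bounded_op_plus[OF A bounded_op_scaled[OF B, of "-1"]] by simp

lemma bounded_op_sum:
  "(\<And>i. i \<in> I \<Longrightarrow> bounded_op M (A i)) \<Longrightarrow> bounded_op M (\<lambda>f z. \<Sum>i\<in>I. A i f z)"
proof (induction I rule: infinite_finite_induct)
  case (insert a I)
  then show ?case using bounded_op_plus[of M "A a" "\<lambda>f z. \<Sum>i\<in>I. A i f z"] by simp
qed (use bounded_op_scaled[OF bounded_op_id, of M 0] in simp_all)

section \<open>Inverses and resolvent sets\<close>

lemma is_inverse_opD:
  assumes "is_inverse_op M A R"
  shows "bounded_op M R" and "f \<in> L2 M \<Longrightarrow> AE x in M. R (A f) x = f x"
    and "f \<in> L2 M \<Longrightarrow> AE x in M. A (R f) x = f x"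
  using assms by (auto simp: is_inverse_op_def)

lemma is_inverse_op_kernel:
  assumes R: "is_inverse_op M A R" and A: "bounded_op M A" and f: "f \<in> L2 M"
    and 0: "AE x in M. A f x = 0"
  shows "AE x in M. f x = 0"
  using bounded_op_zero[OF is_inverse_opD(1)[OF R] bounded_op_L2[OF A f] 0] is_inverse_opD(2)[OF R f]
  by eventually_elim simp

lemma is_inverse_op_bounded_below:
  assumes R: "is_inverse_op M A R" and A: "bounded_op M A"
  obtains C where "C \<ge> 0" "\<And>f. f \<in> L2 M \<Longrightarrow> L2_norm M f \<le> C * L2_norm M (A f)"
proof -
  obtain C where C: "C \<ge> 0" "\<And>f. f \<in> L2 M \<Longrightarrow> L2_norm M (R f) \<le> C * L2_norm M f"
    using bounded_op_bound[OF is_inverse_opD(1)[OF R]] by blast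
  have "L2_norm M f \<le> C * L2_norm M (A f)" if f: "f \<in> L2 M" for f
    using C(2)[OF bounded_op_L2[OF A f]]
      L2_norm_cong[OF is_inverse_opD(2)[OF R f] bounded_op_L2[OF is_inverse_opD(1)[OF R] bounded_op_L2[OF A f]] f]
    by simp
  with C(1) that show ?thesis by blast
qed

lemma is_inverse_op_comp:
  assumes A: "bounded_op M A" and B: "bounded_op M B"
    and R: "is_inverse_op M A R" and S: "is_inverse_op M B S"
  shows "is_inverse_op M (\<lambda>f. A (B f)) (\<lambda>f. S (R f))"
  unfolding is_inverse_op_def
proof (intro conjI ballI)
  note bR = is_inverse_opD(1)[OF R] and bS = is_inverse_opD(1)[OF S]
  note L2 = bounded_op_L2[OF A] bounded_op_L2[OF B] bounded_op_L2[OF bR] bounded_op_L2[OF bS]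
  show "bounded_op M (\<lambda>f. S (R f))"
    by (rule bounded_op_comp[OF bS bR])
  fix f assume f: "f \<in> L2 M"
  show "AE x in M. S (R (A (B f))) x = f x"
    using bounded_op_cong[OF bS L2(3)[OF L2(1)[OF L2(2)[OF f]]] L2(2)[OF f] is_inverse_opD(2)[OF R L2(2)[OF f]]]
      is_inverse_opD(2)[OF S f]
    by eventually_elim simp
  show "AE x in M. A (B (S (R f))) x = f x"
    using bounded_op_cong[OF A L2(2)[OF L2(4)[OF L2(3)[OF f]]] L2(3)[OF f] is_inverse_opD(3)[OF S L2(3)[OF f]]]
      is_inverse_opD(3)[OF R f]
    by eventually_elim simp
qed

lemma is_inverse_op_cong:
  assumes R: "is_inverse_op M A R" and A: "bounded_op M A" and B: "bounded_op M B"
    and eq: "\<And>f. f \<in> L2 M \<Longrightarrow> AE x in M. B f x = A f x"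
  shows "is_inverse_op M B R"
  unfolding is_inverse_op_def
proof (intro conjI ballI)
  show bR: "bounded_op M R" by (rule is_inverse_opD(1)[OF R])
  fix f assume f: "f \<in> L2 M"
  show "AE x in M. R (B f) x = f x"
    using bounded_op_cong[OF bR bounded_op_L2[OF B f] bounded_op_L2[OF A f] eq[OF f]] is_inverse_opD(2)[OF R f]
    by eventually_elim simp
  show "AE x in M. B (R f) x = f x"
    using eq[OF bounded_op_L2[OF bR f]] is_inverse_opD(3)[OF R f]
    by eventually_elim simp
qed

lemma is_inverse_op_scaled:
  assumes R: "is_inverse_op M A R" and A: "bounded_op M A" and c: "c \<noteq> 0"
  shows "is_inverse_op M (\<lambda>f z. c * A f z) (\<lambda>f z. inverse c * R f z)"
  unfolding is_inverse_op_def
proof (intro conjI ballI)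
  note bR = is_inverse_opD(1)[OF R]
  show "bounded_op M (\<lambda>f z. inverse c * R f z)"
    by (rule bounded_op_scaled[OF bR])
  fix f assume f: "f \<in> L2 M"
  show "AE x in M. inverse c * R (\<lambda>z. c * A f z) x = f x"
    using bounded_op_cmult[OF bR bounded_op_L2[OF A f], of c] is_inverse_opD(2)[OF R f]
    by eventually_elim (use c in simp)
  show "AE x in M. c * A (\<lambda>z. inverse c * R f z) x = f x"
    using bounded_op_cmult[OF A bounded_op_L2[OF bR f], of "inverse c"] is_inverse_opD(3)[OF R f]
    by eventually_elim (use c in simp)
qed

lemma bounded_op_id_minus:
  "bounded_op M A \<Longrightarrow> bounded_op M (\<lambda>f z. f z - c * A f z)"
  using bounded_op_minus[OF bounded_op_id bounded_op_scaled, of M A c] by simp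

lemma bounded_op_shift:
  "bounded_op M A \<Longrightarrow> bounded_op M (\<lambda>f z. c * f z - A f z)"
  using bounded_op_minus[OF bounded_op_scaled[OF bounded_op_id], of M A c] by simp

text \<open>The resolvent set speaks of \<open>1/\<tau> - A\<close>, the determinant of \<open>E - \<tau> A\<close>; the two differ by the factor
  \<open>\<tau>\<close>.\<close>

lemma inverse_in_resolvent_set_iff:
  assumes A: "bounded_op M A" and \<tau>: "\<tau> \<noteq> 0"
  shows "inverse \<tau> \<in> resolvent_set M A \<longleftrightarrow> (\<exists>R. is_inverse_op M (\<lambda>f z. f z - \<tau> * A f z) R)"
proof
  assume "inverse \<tau> \<in> resolvent_set M A"
  then obtain R where R: "is_inverse_op M (\<lambda>f z. inverse \<tau> * f z - A f z) R"
    by (auto simp: resolvent_set_def)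
  have "(\<lambda>f z. f z - \<tau> * A f z) = (\<lambda>f z. \<tau> * (inverse \<tau> * f z - A f z))"
    using \<tau> by (auto simp: fun_eq_iff algebra_simps)
  then show "\<exists>R. is_inverse_op M (\<lambda>f z. f z - \<tau> * A f z) R"
    using is_inverse_op_scaled[OF R bounded_op_shift[OF A] \<tau>] by auto
next
  assume "\<exists>R. is_inverse_op M (\<lambda>f z. f z - \<tau> * A f z) R"
  then obtain R where R: "is_inverse_op M (\<lambda>f z. f z - \<tau> * A f z) R" by blast
  have "(\<lambda>f z. inverse \<tau> * f z - A f z) = (\<lambda>f z. inverse \<tau> * (f z - \<tau> * A f z))"
    using \<tau> by (auto simp: fun_eq_iff algebra_simps)
  then show "inverse \<tau> \<in> resolvent_set M A"
    using is_inverse_op_scaled[OF R bounded_op_id_minus[OF A], of "inverse \<tau>"] \<tau>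
    unfolding resolvent_set_def by auto
qed

text \<open>A bounded inverse gives \<open>\<parallel>f\<parallel> \<le> C \<parallel>l f - A f\<parallel>\<close> for some \<open>C\<close>, which fails once
  \<open>\<epsilon> < 1/C\<close>.\<close>

lemma approximate_eigenvalue_not_resolvent:
  assumes A: "bounded_op M A"
    and ex: "\<And>\<epsilon>. \<epsilon> > 0 \<Longrightarrow> \<exists>f\<in>L2 M. L2_norm M f > 0 \<and> L2_norm M (\<lambda>z. l * f z - A f z) \<le> \<epsilon> * L2_norm M f"
  shows "l \<notin> resolvent_set M A"
proof
  assume "l \<in> resolvent_set M A"
  then obtain R where R: "is_inverse_op M (\<lambda>f z. l * f z - A f z) R"
    by (auto simp: resolvent_set_def)
  then obtain C where C: "C \<ge> 0" "\<And>f. f \<in> L2 M \<Longrightarrow> L2_norm M f \<le> C * L2_norm M (\<lambda>z. l * f z - A f z)"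
    using is_inverse_op_bounded_below[OF R bounded_op_shift[OF A]] by blast
  obtain f where f: "f \<in> L2 M" "L2_norm M f > 0"
    and le: "L2_norm M (\<lambda>z. l * f z - A f z) \<le> (1 / (C + 1)) * L2_norm M f"
    using ex[of "1 / (C + 1)"] C(1) by auto
  have "L2_norm M f \<le> C * ((1 / (C + 1)) * L2_norm M f)"
    using C(2)[OF f(1)] mult_left_mono[OF le C(1)] by linarith
  then show False
    using f(2) C(1) by (simp add: field_simps)
qed

section \<open>Linear systems and determinants\<close>

lemma det_eq_0_imp_kernel:
  fixes G :: "nat \<Rightarrow> nat \<Rightarrow> complex"
  assumes "Determinant.det (Matrix.mat r r (\<lambda>(i, j). G i j)) = 0"
  shows "\<exists>c. (\<exists>i<r. c i \<noteq> 0) \<and> (\<forall>i<r. (\<Sum>j<r. G i j * c j) = 0)"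
proof -
  let ?A = "Matrix.mat r r (\<lambda>(i, j). G i j)"
  have A: "?A \<in> carrier_mat r r" by simp
  then obtain v where v: "v \<in> carrier_vec r" "v \<noteq> 0\<^sub>v r" "?A *\<^sub>v v = 0\<^sub>v r"
    using assms det_0_iff_vec_prod_zero[OF A] by auto
  have "\<exists>i<r. vec_index v i \<noteq> 0"
    using v(1,2) by (metis eq_vecI carrier_vecD index_zero_vec(1) index_zero_vec(2))
  moreover have "(\<Sum>j<r. G i j * vec_index v j) = 0" if i: "i < r" for i
  proof -
    have "vec_index (?A *\<^sub>v v) i = 0" using v(3) i by simp
    then show ?thesis
      using i v(1) by (simp add: mult_mat_vec_def scalar_prod_def lessThan_atLeast0)
  qed
  ultimately show ?thesis by blast
qed

lemma det_neq_0_imp_inverse: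
  fixes G :: "nat \<Rightarrow> nat \<Rightarrow> complex"
  assumes "Determinant.det (Matrix.mat r r (\<lambda>(i, j). G i j)) \<noteq> 0"
  shows "\<exists>B. \<forall>i<r. \<forall>k<r. (\<Sum>j<r. B i j * G j k) = (if i = k then 1 else 0) \<and>
     (\<Sum>j<r. G i j * B j k) = (if i = k then 1 else 0)"
proof -
  let ?A = "Matrix.mat r r (\<lambda>(i, j). G i j)"
  let ?d = "Determinant.det ?A"
  have A: "?A \<in> carrier_mat r r" by simp
  note adj = adj_mat[OF A]
  define B where "B i j = adj_mat ?A $$ (i, j) / ?d" for i j
  have "(\<Sum>j<r. B i j * G j k) = (if i = k then 1 else 0)" if i: "i < r" and k: "k < r" for i k
  proof -
    have "(adj_mat ?A * ?A) $$ (i, k) = (?d \<cdot>\<^sub>m 1\<^sub>m r) $$ (i, k)" using adj(3) by simp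
    then have "(\<Sum>j<r. adj_mat ?A $$ (i, j) * G j k) = ?d * (if i = k then 1 else 0)"
      using i k adj(1) by (simp add: scalar_prod_def lessThan_atLeast0)
    then show ?thesis using assms
      by (simp add: B_def sum_divide_distrib[symmetric] split: if_splits)
  qed
  moreover have "(\<Sum>j<r. G i j * B j k) = (if i = k then 1 else 0)" if i: "i < r" and k: "k < r" for i k
  proof -
    have "(?A * adj_mat ?A) $$ (i, k) = (?d \<cdot>\<^sub>m 1\<^sub>m r) $$ (i, k)" using adj(2) by simp
    then have "(\<Sum>j<r. G i j * adj_mat ?A $$ (j, k)) = ?d * (if i = k then 1 else 0)"
      using i k adj(1) by (simp add: scalar_prod_def lessThan_atLeast0)
    then show ?thesis using assms
      by (simp add: B_def sum_divide_distrib[symmetric] split: if_splits)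
  qed
  ultimately show ?thesis by blast
qed

text \<open>Appending a zero row turns the coefficients into a singular square matrix.\<close>

lemma underdetermined_system:
  fixes G :: "nat \<Rightarrow> nat \<Rightarrow> complex"
  shows "\<exists>c. (\<exists>i<Suc r. c i \<noteq> 0) \<and> (\<forall>i<r. (\<Sum>j<Suc r. G i j * c j) = 0)"
proof -
  define H where "H i j = (if i < r then G i j else 0)" for i j
  let ?A = "Matrix.mat (Suc r) (Suc r) (\<lambda>(i, j). H i j)"
  have A: "?A \<in> carrier_mat (Suc r) (Suc r)" by simp
  have "Determinant.det ?A = 0"
    unfolding laplace_expansion_row[OF A, of r, simplified] by (simp add: H_def)
  then obtain c where "\<exists>i<Suc r. c i \<noteq> 0" "\<forall>i<Suc r. (\<Sum>j<Suc r. H i j * c j) = 0"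
    using det_eq_0_imp_kernel by blast
  moreover have "(\<Sum>j<Suc r. H i j * c j) = (\<Sum>j<Suc r. G i j * c j)" if "i < r" for i
    using that by (simp add: H_def)
  ultimately show ?thesis
    by (metis less_SucI)
qed

section \<open>The Fredholm alternative in finite rank\<close>

lemma finite_rank_repD:
  assumes "finite_rank_rep M K r u v"
  shows "i < r \<Longrightarrow> u i \<in> L2 M" and "i < r \<Longrightarrow> v i \<in> L2 M"
    and "f \<in> L2 M \<Longrightarrow> AE x in M. K f x = (\<Sum>i<r. L2_inner M f (u i) * v i x)"
  using assms by (auto simp: finite_rank_rep_def)

lemma finite_rank_rep_exI:
  assumes "finite I" and "\<And>i. i \<in> I \<Longrightarrow> u i \<in> L2 M" and "\<And>i. i \<in> I \<Longrightarrow> v i \<in> L2 M"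
    and eq: "\<And>f. f \<in> L2 M \<Longrightarrow> AE x in M. K f x = (\<Sum>i\<in>I. L2_inner M f (u i) * v i x)"
  shows "\<exists>r u v. finite_rank_rep M K r u v"
proof -
  obtain e where e: "bij_betw e {..<card I} I"
    using ex_bij_betw_nat_finite[OF assms(1)] by (auto simp: lessThan_atLeast0)
  have "e i \<in> I" if "i < card I" for i using e that by (auto simp: bij_betw_def)
  then have "finite_rank_rep M K (card I) (u \<circ> e) (v \<circ> e)"
    using assms(2-4) unfolding finite_rank_rep_def
    by (auto simp: sum.reindex_bij_betw[OF e, of "\<lambda>i. L2_inner M _ (u i) * v i _"])
  then show ?thesis by blast
qed

lemma finite_rank_rep_plus:
  assumes K: "finite_rank_rep M K r u v" and K': "finite_rank_rep M K' r' u' v'"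
  shows "\<exists>r u v. finite_rank_rep M (\<lambda>f z. K f z + K' f z) r u v"
proof (rule finite_rank_rep_exI[where I = "{..<r} <+> {..<r'}" and u = "case_sum u u'" and v = "case_sum v v'"])
  fix f assume f: "f \<in> L2 M"
  show "AE x in M. K f x + K' f x =
     (\<Sum>i\<in>{..<r} <+> {..<r'}. L2_inner M f (case_sum u u' i) * case_sum v v' i x)"
    using finite_rank_repD(3)[OF K f] finite_rank_repD(3)[OF K' f]
    by eventually_elim (simp add: sum.Plus)
qed (auto simp: finite_rank_repD[OF K] finite_rank_repD[OF K'])

text \<open>A bounded operator applied after \<open>K = \<Sum>\<^sub>i \<langle>\<cdot>, u\<^sub>i\<rangle> v\<^sub>i\<close> only moves the vectors \<open>v\<^sub>i\<close>.\<close>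

lemma finite_rank_rep_comp:
  assumes K: "finite_rank_rep M K r u v" and A: "bounded_op M A"
    and L2: "\<And>f. f \<in> L2 M \<Longrightarrow> K f \<in> L2 M"
  shows "finite_rank_rep M (\<lambda>f. A (K f)) r u (\<lambda>i. A (v i))"
  unfolding finite_rank_rep_def
proof (intro conjI allI impI ballI)
  fix f assume f: "f \<in> L2 M"
  have S: "(\<lambda>z. \<Sum>i<r. L2_inner M f (u i) * v i z) \<in> L2 M"
    by (intro L2_sum L2_cmult finite_rank_repD(2)[OF K]) simp
  show "AE x in M. A (K f) x = (\<Sum>i<r. L2_inner M f (u i) * A (v i) x)"
    using bounded_op_cong[OF A L2[OF f] S finite_rank_repD(3)[OF K f]]
      bounded_op_lincomb[OF A, of "{..<r}" v "\<lambda>i. L2_inner M f (u i)"] finite_rank_repD(2)[OF K]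
    by (auto elim: eventually_elim2)
qed (auto simp: finite_rank_repD[OF K] bounded_op_L2[OF A])

text \<open>The value of the Fredholm determinant that belongs to one given representation. For every
  representation this value decides between a kernel and an inverse, in particular for the one that the
  choice operator in \<open>fredholm_det\<close> selects.\<close>

definition gram_det :: "'a measure \<Rightarrow> nat \<Rightarrow> (nat \<Rightarrow> 'a \<Rightarrow> complex) \<Rightarrow> (nat \<Rightarrow> 'a \<Rightarrow> complex) \<Rightarrow> complex" where
  "gram_det M r u v = Determinant.det (Matrix.mat r r
          (\<lambda>(i, j). (if i = j then 1 else 0) - L2_inner M (v j) (u i)))"

lemma fredholm_det_eq:
  assumes "\<exists>r u v. finite_rank_rep M K r u v"
  obtains r u v where "finite_rank_rep M K r u v" "fredholm_det M K = gram_det M r u v"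
proof -
  define t where "t = (SOME (r, u, v). finite_rank_rep M K r u v)"
  obtain r u v where ruv: "t = (r, u, v)" by (cases t)
  have "case t of (r, u, v) \<Rightarrow> finite_rank_rep M K r u v"
    unfolding t_def by (rule someI_ex) (use assms in auto)
  then have "finite_rank_rep M K r u v" by (simp add: ruv)
  moreover have "fredholm_det M K = gram_det M r u v"
    unfolding fredholm_det_def t_def[symmetric] ruv gram_det_def by simp
  ultimately show ?thesis using that by blast
qed

text \<open>For \<open>f = \<Sum>\<^sub>j c\<^sub>j v\<^sub>j\<close> and \<open>G\<^sub>i\<^sub>j = \<langle>v\<^sub>j, u\<^sub>i\<rangle>\<close> the equation \<open>f = K f\<close> follows from \<open>(I - G) c = 0\<close>. Then
  \<open>c\<^sub>i = \<langle>f, u\<^sub>i\<rangle>\<close>, so \<open>c \<noteq> 0\<close> forces \<open>f \<noteq> 0\<close>.\<close>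

lemma gram_det_eq_0_imp_fixed_vector:
  assumes K: "finite_rank_rep M K r u v" and d: "gram_det M r u v = 0"
  shows "\<exists>f\<in>L2 M. (AE x in M. f x = K f x) \<and> \<not> (AE x in M. f x = 0)"
proof -
  obtain c where c: "\<exists>i<r. c i \<noteq> 0"
    and sys: "\<And>i. i < r \<Longrightarrow> (\<Sum>j<r. ((if i = j then 1 else 0) - L2_inner M (v j) (u i)) * c j) = 0"
    using det_eq_0_imp_kernel[OF d[unfolded gram_det_def]] by blast
  define f where "f = (\<lambda>x. \<Sum>j<r. c j * v j x)"
  have fL: "f \<in> L2 M"
    unfolding f_def by (intro L2_sum L2_cmult finite_rank_repD(2)[OF K]) simp
  have cf: "L2_inner M f (u i) = c i" if i: "i < r" for i
  proof -
    have "L2_inner M f (u i) = (\<Sum>j<r. L2_inner M (v j) (u i) * c j)"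
      unfolding f_def using i
      by (subst L2_inner_sum_left)
        (simp_all add: L2_inner_cmult_left L2_cmult finite_rank_repD[OF K], simp add: mult.commute)
    also have "\<dots> = c i"
      using sys[OF i] i by (simp add: left_diff_distrib sum_subtractf if_distrib[of "\<lambda>x. x * _"] cong: if_cong)
    finally show ?thesis .
  qed
  have "AE x in M. f x = K f x"
    using finite_rank_repD(3)[OF K fL] by eventually_elim (simp add: f_def cf[unfolded f_def])
  moreover have "\<not> (AE x in M. f x = 0)"
    using c cf L2_inner_zero_AE by fastforce
  ultimately show ?thesis using fL by blast
qed

lemma bounded_op_inner:
  assumes u: "u \<in> L2 M" and v: "v \<in> L2 M"
  shows "bounded_op M (\<lambda>f x. L2_inner M f u * v x)"
proof (rule bounded_opI[where C = "L2_norm M u * L2_norm M v"])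
  fix f assume f: "f \<in> L2 M"
  show "L2_norm M (\<lambda>x. L2_inner M f u * v x) \<le> L2_norm M u * L2_norm M v * L2_norm M f"
    using mult_right_mono[OF L2_Cauchy_Schwarz[OF f u] L2_norm_nonneg[of M v]]
    unfolding L2_norm_cmult by (simp add: ac_simps)
qed (auto simp: L2_inner_add_left L2_inner_cmult_left u distrib_right mult.assoc intro: L2_cmult v)

lemma bounded_op_finite_rank:
  assumes "\<And>i. i \<in> I \<Longrightarrow> u i \<in> L2 M" and "\<And>i. i \<in> I \<Longrightarrow> v i \<in> L2 M"
  shows "bounded_op M (\<lambda>f x. \<Sum>i\<in>I. L2_inner M f (u i) * v i x)"
  by (intro bounded_op_sum bounded_op_inner assms)

text \<open>If \<open>f - K f = g\<close>, the numbers \<open>a\<^sub>i = \<langle>f, u\<^sub>i\<rangle>\<close> solve \<open>(I - G) a = (\<langle>g, u\<^sub>j\<rangle>)\<^sub>j\<close> with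
  \<open>G\<^sub>i\<^sub>j = \<langle>v\<^sub>j, u\<^sub>i\<rangle>\<close>. With \<open>B = (I - G)\<^sup>-\<^sup>1\<close> this gives the explicit inverse
  \<open>g \<mapsto> g + \<Sum>\<^sub>i\<^sub>j B\<^sub>i\<^sub>j \<langle>g, u\<^sub>j\<rangle> v\<^sub>i\<close>.\<close>

lemma gram_det_neq_0_imp_inverse:
  assumes K: "finite_rank_rep M K r u v" and d: "gram_det M r u v \<noteq> 0" and bK: "bounded_op M K"
  shows "\<exists>R. is_inverse_op M (\<lambda>f z. f z - K f z) R"
proof -
  let ?\<delta> = "\<lambda>i j::nat. if i = j then 1 else (0::complex)"
  note uL = finite_rank_repD(1)[OF K] and vL = finite_rank_repD(2)[OF K]
  define G where "G i j = L2_inner M (v j) (u i)" for i j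
  obtain B where B: "\<And>i k. i < r \<Longrightarrow> k < r \<Longrightarrow> (\<Sum>j<r. B i j * (?\<delta> j k - G j k)) = ?\<delta> i k"
    and B': "\<And>i k. i < r \<Longrightarrow> k < r \<Longrightarrow> (\<Sum>j<r. (?\<delta> i j - G i j) * B j k) = ?\<delta> i k"
    using det_neq_0_imp_inverse[OF d[unfolded gram_det_def]] unfolding G_def by blast
  define w where "w j x = (\<Sum>i<r. B i j * v i x)" for j x
  have wL: "w j \<in> L2 M" for j
    unfolding w_def by (intro L2_sum L2_cmult vL) simp
  define S where "S f x = (\<Sum>j<r. L2_inner M f (u j) * w j x)" for f x
  have bS: "bounded_op M S"
    unfolding S_def[abs_def] by (rule bounded_op_finite_rank) (auto simp: uL wL)
  define R where "R f x = f x + S f x" for f x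
  have bR: "bounded_op M R"
    unfolding R_def[abs_def] by (rule bounded_op_plus[OF bounded_op_id bS])
  define k where "k f x = (\<Sum>i<r. L2_inner M f (u i) * v i x)" for f x
  have bk: "bounded_op M k"
    unfolding k_def[abs_def] by (rule bounded_op_finite_rank) (auto simp: uL vL)
  have Kk: "AE x in M. K f x = k f x" if "f \<in> L2 M" for f
    using finite_rank_repD(3)[OF K that] by (simp add: k_def)
  have S_alt: "S f x = (\<Sum>i<r. (\<Sum>j<r. B i j * L2_inner M f (u j)) * v i x)" for f x
    unfolding S_def w_def sum_distrib_left sum_distrib_right
    by (subst sum.swap) (simp add: ac_simps)
  have ku: "L2_inner M (k f) (u i) = (\<Sum>j<r. G i j * L2_inner M f (u j))" if i: "i < r" for i f
    unfolding k_def using i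
    by (subst L2_inner_sum_left) (simp_all add: L2_inner_cmult_left G_def L2_cmult uL vL, simp add: mult.commute)
  have Su: "L2_inner M (S f) (u i) = (\<Sum>j<r. G i j * (\<Sum>l<r. B j l * L2_inner M f (u l)))" if i: "i < r" for i f
    unfolding S_alt[abs_def] using i
    by (subst L2_inner_sum_left) (simp_all add: L2_inner_cmult_left G_def L2_cmult uL vL, simp add: mult.commute)
  have kL: "f \<in> L2 M \<Longrightarrow> k f \<in> L2 M" and SL: "f \<in> L2 M \<Longrightarrow> S f \<in> L2 M" for f
    by (auto intro: bounded_op_L2 bk bS)
  have RE: "R (\<lambda>z. f z - k f z) x = f x" if f: "f \<in> L2 M" for f x
  proof -
    let ?a = "\<lambda>j. L2_inner M f (u j)"
    have *: "(\<Sum>j<r. B i j * (?a j - (\<Sum>l<r. G j l * ?a l))) = ?a i" if i: "i < r" for i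
    proof -
      have "(\<Sum>j<r. B i j * (?a j - (\<Sum>l<r. G j l * ?a l))) = (\<Sum>j<r. B i j * (\<Sum>l<r. (?\<delta> j l - G j l) * ?a l))"
        by (intro sum.cong refl arg_cong2[of _ _ _ _ "(*)"])
          (simp add: left_diff_distrib sum_subtractf if_distrib[of "\<lambda>x. x * _"] cong: if_cong)
      also have "\<dots> = (\<Sum>l<r. (\<Sum>j<r. B i j * (?\<delta> j l - G j l)) * ?a l)"
        unfolding sum_distrib_left sum_distrib_right by (subst sum.swap) (simp add: ac_simps)
      also have "\<dots> = (\<Sum>l<r. ?\<delta> i l * ?a l)"
        by (intro sum.cong refl) (simp only: lessThan_iff B[OF i])
      also have "\<dots> = ?a i"
        using i by (simp add: if_distrib[of "\<lambda>x. x * _"] cong: if_cong)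
      finally show ?thesis .
    qed
    have "S (\<lambda>z. f z - k f z) x = (\<Sum>i<r. (\<Sum>j<r. B i j * (?a j - (\<Sum>l<r. G j l * ?a l))) * v i x)"
      unfolding S_alt
      by (intro sum.cong refl arg_cong2[of _ _ _ _ "(*)"])
        (simp add: L2_inner_diff_left f kL uL ku)
    also have "\<dots> = k f x"
      unfolding k_def by (intro sum.cong refl) (simp only: lessThan_iff *)
    finally show ?thesis by (simp add: R_def)
  qed
  have ER: "R f x - k (R f) x = f x" if f: "f \<in> L2 M" for f x
  proof -
    let ?a = "\<lambda>j. L2_inner M f (u j)"
    have *: "(\<Sum>l<r. B i l * ?a l) = ?a i + (\<Sum>j<r. G i j * (\<Sum>l<r. B j l * ?a l))" if i: "i < r" for i
    proof -
      have "(\<Sum>l<r. B i l * ?a l) - (\<Sum>j<r. G i j * (\<Sum>l<r. B j l * ?a l))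
         = (\<Sum>j<r. (?\<delta> i j - G i j) * (\<Sum>l<r. B j l * ?a l))"
        using i by (simp add: left_diff_distrib sum_subtractf if_distrib[of "\<lambda>x. x * _"] cong: if_cong)
      also have "\<dots> = (\<Sum>l<r. (\<Sum>j<r. (?\<delta> i j - G i j) * B j l) * ?a l)"
        unfolding sum_distrib_left sum_distrib_right by (subst sum.swap) (simp add: ac_simps)
      also have "\<dots> = (\<Sum>l<r. ?\<delta> i l * ?a l)"
        by (intro sum.cong refl) (simp only: lessThan_iff B'[OF i])
      also have "\<dots> = ?a i"
        using i by (simp add: if_distrib[of "\<lambda>x. x * _"] cong: if_cong)
      finally show ?thesis by (simp add: algebra_simps)
    qed
    have "k (R f) x = (\<Sum>i<r. (?a i + (\<Sum>j<r. G i j * (\<Sum>l<r. B j l * ?a l))) * v i x)"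
      unfolding k_def R_def[abs_def]
      by (intro sum.cong refl arg_cong2[of _ _ _ _ "(*)"])
        (simp add: L2_inner_add_left f SL uL Su)
    also have "\<dots> = S f x"
      unfolding S_alt by (intro sum.cong refl) (simp only: lessThan_iff *)
    finally show ?thesis by (simp add: R_def)
  qed
  have "is_inverse_op M (\<lambda>f z. f z - k f z) R"
    unfolding is_inverse_op_def using bR RE ER by auto
  then have "is_inverse_op M (\<lambda>f z. f z - K f z) R"
    by (rule is_inverse_op_cong[OF _ bounded_op_minus[OF bounded_op_id bk] bounded_op_minus[OF bounded_op_id bK]])
      (use Kk in auto)
  then show ?thesis by blast
qed

lemma injective_imp_inverse:
  assumes K: "finite_rank_rep M K r u v" and bK: "bounded_op M K"
    and inj: "\<And>f. f \<in> L2 M \<Longrightarrow> AE x in M. f x = K f x \<Longrightarrow> AE x in M. f x = 0"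
  shows "\<exists>R. is_inverse_op M (\<lambda>f z. f z - K f z) R"
  using gram_det_neq_0_imp_inverse[OF K _ bK] gram_det_eq_0_imp_fixed_vector[OF K] inj by blast

text \<open>A subspace of a finite-dimensional space is spanned by finitely many of its own elements. If some
  \<open>g\<close> in \<open>F\<close> has a nonzero coefficient at the last vector, subtracting multiples of \<open>g\<close> removes that
  vector from every other element of \<open>F\<close>, and induction applies to what is left.\<close>

lemma finite_spanning_subset:
  fixes v :: "nat \<Rightarrow> 'a \<Rightarrow> complex"
  assumes "\<And>f g c. f \<in> F \<Longrightarrow> g \<in> F \<Longrightarrow> (\<lambda>z. f z - c * g z) \<in> F"
    and "\<And>f. f \<in> F \<Longrightarrow> \<exists>c. AE x in M. f x = (\<Sum>i<r. c i * v i x)"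
  shows "\<exists>B. finite B \<and> B \<subseteq> F \<and> (\<forall>f\<in>F. \<exists>\<alpha>. AE x in M. f x = (\<Sum>g\<in>B. \<alpha> g * g x))"
  using assms
proof (induction r arbitrary: F)
  case 0
  then show ?case by (intro exI[of _ "{}"]) auto
next
  case (Suc r)
  define F' where "F' = {f \<in> F. \<exists>c. AE x in M. f x = (\<Sum>i<r. c i * v i x)}"
  have "\<exists>B. finite B \<and> B \<subseteq> F' \<and> (\<forall>f\<in>F'. \<exists>\<alpha>. AE x in M. f x = (\<Sum>g\<in>B. \<alpha> g * g x))"
  proof (rule Suc.IH)
    fix f g c assume "f \<in> F'" "g \<in> F'"
    then obtain a b where ab: "f \<in> F" "g \<in> F" "AE x in M. f x = (\<Sum>i<r. a i * v i x)"
      "AE x in M. g x = (\<Sum>i<r. b i * v i x)" by (auto simp: F'_def)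
    have "AE x in M. f x - c * g x = (\<Sum>i<r. (a i - c * b i) * v i x)"
      using ab(3,4) by eventually_elim (simp add: sum_subtractf sum_distrib_left algebra_simps)
    with Suc.prems(1)[OF ab(1,2), of c] show "(\<lambda>z. f z - c * g z) \<in> F'"
      unfolding F'_def mem_Collect_eq by (intro conjI exI[of _ "\<lambda>i. a i - c * b i"])
  qed (auto simp: F'_def)
  then obtain B where B: "finite B" "B \<subseteq> F'"
    and span: "\<And>f. f \<in> F' \<Longrightarrow> \<exists>\<alpha>. AE x in M. f x = (\<Sum>g\<in>B. \<alpha> g * g x)" by blast
  show ?case
  proof (cases "F \<subseteq> F'")
    case True
    moreover have "F' \<subseteq> F" by (auto simp: F'_def)
    ultimately show ?thesis using B span by (intro exI[of _ B]) blast
  next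
    case False
    then obtain g where g: "g \<in> F" "g \<notin> F'" by blast
    obtain b where b: "AE x in M. g x = (\<Sum>i<Suc r. b i * v i x)" using Suc.prems(2)[OF g(1)] by blast
    have b0: "b r \<noteq> 0"
    proof
      assume "b r = 0"
      then have "AE x in M. g x = (\<Sum>i<r. b i * v i x)" using b by simp
      with g show False by (auto simp: F'_def)
    qed
    have "\<exists>\<alpha>. AE x in M. f x = (\<Sum>k\<in>insert g B. \<alpha> k * k x)" if f: "f \<in> F" for f
    proof -
      obtain a where a: "AE x in M. f x = (\<Sum>i<Suc r. a i * v i x)" using Suc.prems(2)[OF f] by blast
      define c where "c = a r / b r"
      have "AE x in M. f x - c * g x = (\<Sum>i<r. (a i - c * b i) * v i x)"
        using a b by eventually_elim
          (use b0 in \<open>simp add: sum_subtractf sum_distrib_left algebra_simps c_def\<close>)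
      with Suc.prems(1)[OF f g(1), of c] have "(\<lambda>z. f z - c * g z) \<in> F'"
        unfolding F'_def mem_Collect_eq by (intro conjI exI[of _ "\<lambda>i. a i - c * b i"])
      then obtain \<alpha> where \<alpha>: "AE x in M. f x - c * g x = (\<Sum>k\<in>B. \<alpha> k * k x)"
        using span by blast
      have gB: "g \<notin> B" using B(2) g(2) by blast
      have "(\<Sum>k\<in>insert g B. (\<alpha>(g := c)) k * k x) = c * g x + (\<Sum>k\<in>B. \<alpha> k * k x)" for x
        using B(1) gB by (simp, intro sum.cong) auto
      with \<alpha> have "AE x in M. f x = (\<Sum>k\<in>insert g B. (\<alpha>(g := c)) k * k x)"
        by (auto simp: algebra_simps)
      then show ?thesis by blast
    qed
    moreover have "insert g B \<subseteq> F" using B(2) g(1) by (auto simp: F'_def)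
    ultimately show ?thesis using B(1) by (intro exI[of _ "insert g B"]) auto
  qed
qed

section \<open>Tensors and partial inner products\<close>

definition tensor :: "('a \<Rightarrow> complex) \<Rightarrow> ('b \<Rightarrow> complex) \<Rightarrow> 'a \<times> 'b \<Rightarrow> complex" where
  "tensor u q = (\<lambda>(x, y). u x * q y)"

text \<open>The inner product of the section \<open>f (\<cdot>, y)\<close> with \<open>u\<close>, as a function of \<open>y\<close>. As an operator in \<open>f\<close> it
  is adjoint to \<open>q \<mapsto> tensor u q\<close>, see \<open>inner_tensor\<close> below.\<close>

definition partial_inner :: "'a measure \<Rightarrow> ('a \<Rightarrow> complex) \<Rightarrow> ('a \<times> 'b \<Rightarrow> complex) \<Rightarrow> 'b \<Rightarrow> complex" where
  "partial_inner M1 u f y = (LINT s|M1. cnj (u s) * f (s, y))"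

lemma tensor_apply [simp]: "tensor u q (x, y) = u x * q y"
  by (simp add: tensor_def)

lemma partial_inner_tensor: "partial_inner M1 u (tensor v q) y = L2_inner M1 v u * q y"
  unfolding partial_inner_def L2_inner_def tensor_apply
    Bochner_Integration.integral_mult_left_zero[symmetric]
  by (rule Bochner_Integration.integral_cong) (simp_all add: ac_simps)

lemma partial_inner_cmult: "partial_inner M1 u (\<lambda>z. c * f z) y = c * partial_inner M1 u f y"
  unfolding partial_inner_def Bochner_Integration.integral_mult_right_zero[symmetric]
  by (rule Bochner_Integration.integral_cong) (simp_all add: ac_simps)

definition ess_bounded_mult :: "'b measure \<Rightarrow> ('b \<Rightarrow> complex) \<Rightarrow> bool" where
  "ess_bounded_mult M q \<longleftrightarrow> q \<in> borel_measurable M \<and> (\<exists>C. AE y in M. cmod (q y) \<le> C)"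

lemma ess_bounded_mult_L2: "ess_bounded_mult M q \<Longrightarrow> f \<in> L2 M \<Longrightarrow> (\<lambda>y. q y * f y) \<in> L2 M"
  by (auto simp: ess_bounded_mult_def intro: L2_bounded_mult)

lemma ess_bounded_mult_of_real:
  assumes "ess_bounded M h" shows "ess_bounded_mult M (\<lambda>y. complex_of_real (h y))"
proof -
  have [measurable]: "h \<in> borel_measurable M" using assms by (simp add: ess_bounded_def)
  show ?thesis using assms by (auto simp: ess_bounded_def ess_bounded_mult_def)
qed

locale finite_pair = M1: finite_measure M1 + M2: finite_measure M2
  for M1 :: "'a measure" and M2 :: "'b measure"

sublocale finite_pair \<subseteq> pair_sigma_finite M1 M2 ..

context finite_pair
begin

abbreviation M :: "('a \<times> 'b) measure" where "M \<equiv> M1 \<Otimes>\<^sub>M M2"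

text \<open>A null set of \<open>M2\<close> pulls back to a null strip of the product; membership in \<open>L2 M\<close> gives control of
  almost every section only, and this lemma carries such information back to the product.\<close>

lemma AE_snd:
  assumes "AE y in M2. P y"
  shows "AE z in M. P (snd z)"
proof -
  obtain N where N: "N \<in> null_sets M2" "{y \<in> space M2. \<not> P y} \<subseteq> N"
    using assms by (auto elim!: AE_E simp: null_sets_def)
  have "space M1 \<times> N \<in> null_sets M"
    using N(1) by (auto intro: M2.times_in_null_sets2)
  moreover have "{z \<in> space M. \<not> P (snd z)} \<subseteq> space M1 \<times> N"
    using N(2) by (auto simp: space_pair_measure)
  ultimately show ?thesis by (rule AE_I')
qed

lemma tensor_measurable:
  assumes [measurable]: "u \<in> borel_measurable M1" "q \<in> borel_measurable M2"
  shows "tensor u q \<in> borel_measurable M"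
  unfolding tensor_def by measurable

lemma tensor_L2_norm:
  assumes u: "u \<in> L2 M1" and q: "q \<in> L2 M2"
  shows "tensor u q \<in> L2 M" and "L2_norm M (tensor u q) = L2_norm M1 u * L2_norm M2 q"
proof -
  note [measurable] = L2_measurable[OF u] L2_measurable[OF q] tensor_measurable
  let ?F = "\<lambda>z. (cmod (tensor u q z))\<^sup>2"
  have F: "?F (x, y) = (cmod (u x))\<^sup>2 * (cmod (q y))\<^sup>2" for x y
    by (simp add: norm_mult power_mult_distrib)
  have int: "integrable M ?F"
  proof (rule Fubini_integrable)
    show "?F \<in> borel_measurable M" by measurable
    show "integrable M1 (\<lambda>x. LINT y|M2. norm (?F (x, y)))"
      unfolding F using L2_square_integrable[OF u] by (simp add: norm_mult)
    show "AE x in M1. integrable M2 (\<lambda>y. ?F (x, y))"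
      unfolding F using L2_square_integrable[OF q] by simp
  qed
  then show "tensor u q \<in> L2 M" by (simp add: L2_def)
  have "(LINT z|M. ?F z) = (LINT x|M1. LINT y|M2. ?F (x, y))"
    using integral_fst'[OF int] by simp
  also have "\<dots> = (L2_norm M1 u)\<^sup>2 * (L2_norm M2 q)\<^sup>2"
    unfolding F by (simp add: L2_norm_square)
  finally show "L2_norm M (tensor u q) = L2_norm M1 u * L2_norm M2 q"
    unfolding L2_norm_def by (simp add: real_sqrt_mult)
qed

lemmas tensor_L2 = tensor_L2_norm(1)

lemma section_L2:
  assumes f: "f \<in> L2 M"
  shows "AE y in M2. (\<lambda>s. f (s, y)) \<in> L2 M1"
proof -
  have "AE y in M2. integrable M1 (\<lambda>s. (cmod (f (s, y)))\<^sup>2)"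
    using AE_integrable_snd[of "\<lambda>s y. (cmod (f (s, y)))\<^sup>2"] L2_square_integrable[OF f]
    by (simp add: case_prod_unfold)
  then show ?thesis
    using AE_space
  proof eventually_elim
    case (elim y)
    have "(\<lambda>s. f (s, y)) \<in> borel_measurable M1"
      using measurable_compose[OF measurable_Pair2'[OF elim(2)] L2_measurable[OF f]] by simp
    with elim show ?case by (simp add: L2_def)
  qed
qed

lemma partial_inner_measurable:
  assumes [measurable]: "u \<in> borel_measurable M1" "f \<in> borel_measurable M"
  shows "partial_inner M1 u f \<in> borel_measurable M2"
  unfolding partial_inner_def[abs_def]
  by (rule M1.borel_measurable_lebesgue_integral) (simp add: borel_measurable_cnj)

lemma partial_inner_section: "partial_inner M1 u f y = L2_inner M1 (\<lambda>s. f (s, y)) u"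
  by (simp add: partial_inner_def L2_inner_def mult.commute)

lemma partial_inner_bound:
  assumes u: "u \<in> L2 M1" and f: "f \<in> L2 M"
  shows "AE y in M2. (cmod (partial_inner M1 u f y))\<^sup>2
    \<le> (L2_norm M1 u)\<^sup>2 * (LINT s|M1. (cmod (f (s, y)))\<^sup>2)"
  using section_L2[OF f]
proof eventually_elim
  case (elim y)
  have "(cmod (partial_inner M1 u f y))\<^sup>2 \<le> (L2_norm M1 (\<lambda>s. f (s, y)) * L2_norm M1 u)\<^sup>2"
    unfolding partial_inner_section using L2_Cauchy_Schwarz[OF elim u]
    by (rule power_mono) simp
  then show ?case
    by (simp add: power_mult_distrib L2_norm_square mult.commute)
qed

lemma partial_inner_L2_norm:
  assumes u: "u \<in> L2 M1" and f: "f \<in> L2 M"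
  shows "partial_inner M1 u f \<in> L2 M2"
    and "L2_norm M2 (partial_inner M1 u f) \<le> L2_norm M1 u * L2_norm M f"
proof -
  have int: "integrable M (\<lambda>(s, y). (cmod (f (s, y)))\<^sup>2)"
    using L2_square_integrable[OF f] by (simp add: case_prod_unfold)
  have int2: "integrable M2 (\<lambda>y. (L2_norm M1 u)\<^sup>2 * (LINT s|M1. (cmod (f (s, y)))\<^sup>2))"
    using integrable_snd[OF int] by simp
  show L2: "partial_inner M1 u f \<in> L2 M2"
    by (rule L2_dominated[OF partial_inner_measurable int2 partial_inner_bound[OF u f]])
      (intro L2_measurable u f)+
  have "(L2_norm M2 (partial_inner M1 u f))\<^sup>2
      \<le> (LINT y|M2. (L2_norm M1 u)\<^sup>2 * (LINT s|M1. (cmod (f (s, y)))\<^sup>2))"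
    unfolding L2_norm_square[of M2]
    by (rule integral_mono_AE[OF L2_square_integrable[OF L2] int2 partial_inner_bound[OF u f]])
  also have "\<dots> = (L2_norm M1 u)\<^sup>2 * (L2_norm M f)\<^sup>2"
    using integral_snd[OF int] by (simp add: L2_norm_square case_prod_unfold)
  also have "\<dots> = (L2_norm M1 u * L2_norm M f)\<^sup>2"
    by (simp add: power_mult_distrib)
  finally show "L2_norm M2 (partial_inner M1 u f) \<le> L2_norm M1 u * L2_norm M f"
    by (rule power2_le_imp_le) (simp add: L2_norm_nonneg)
qed

lemmas partial_inner_L2 = partial_inner_L2_norm(1)

lemma partial_inner_add:
  assumes u: "u \<in> L2 M1" and f: "f \<in> L2 M" and g: "g \<in> L2 M"
  shows "AE y in M2. partial_inner M1 u (\<lambda>z. f z + g z) y = partial_inner M1 u f y + partial_inner M1 u g y"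
  using section_L2[OF f] section_L2[OF g]
  by eventually_elim (simp add: partial_inner_section L2_inner_add_left u)

text \<open>Fubini, applied to the integrable function \<open>f (x, y) cnj (u x) cnj (q y)\<close>.\<close>

lemma inner_tensor:
  assumes u: "u \<in> L2 M1" and q: "q \<in> L2 M2" and f: "f \<in> L2 M"
  shows "L2_inner M f (tensor u q) = L2_inner M2 (partial_inner M1 u f) q"
proof -
  have int: "integrable M (\<lambda>(x, y). f (x, y) * cnj (u x * q y))"
    using L2_inner_integrable[OF f tensor_L2[OF u q]] by (simp add: tensor_def case_prod_unfold)
  have "L2_inner M f (tensor u q) = (LINT y|M2. LINT x|M1. f (x, y) * cnj (u x * q y))"
    using integral_snd[OF int] by (simp add: L2_inner_def tensor_def case_prod_unfold)
  also have "\<dots> = L2_inner M2 (partial_inner M1 u f) q"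
    unfolding L2_inner_def partial_inner_def Bochner_Integration.integral_mult_left_zero[symmetric]
    by (intro Bochner_Integration.integral_cong refl) (simp add: ac_simps)
  finally show ?thesis .
qed

lemma bounded_op_slice:
  assumes u: "u \<in> L2 M1" and v: "v \<in> L2 M1" and q: "ess_bounded_mult M2 q"
  shows "bounded_op M (\<lambda>f. tensor u (\<lambda>y. q y * partial_inner M1 v f y))"
proof -
  obtain C where C: "AE y in M2. cmod (q y) \<le> C" using q by (auto simp: ess_bounded_mult_def)
  have pL: "(\<lambda>y. q y * partial_inner M1 v f y) \<in> L2 M2" if "f \<in> L2 M" for f
    by (rule ess_bounded_mult_L2[OF q partial_inner_L2[OF v that]])
  show ?thesis
  proof (rule bounded_opI[where C = "L2_norm M1 u * (\<bar>C\<bar> * L2_norm M1 v)"])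
    fix f g assume f: "f \<in> L2 M" and g: "g \<in> L2 M"
    show "AE x in M. tensor u (\<lambda>y. q y * partial_inner M1 v (\<lambda>z. f z + g z) y) x =
      tensor u (\<lambda>y. q y * partial_inner M1 v f y) x + tensor u (\<lambda>y. q y * partial_inner M1 v g y) x"
      using AE_snd[OF partial_inner_add[OF v f g]]
      by eventually_elim (auto simp: algebra_simps)
  next
    fix c f assume f: "f \<in> L2 M"
    show "AE x in M. tensor u (\<lambda>y. q y * partial_inner M1 v (\<lambda>z. c * f z) y) x =
      c * tensor u (\<lambda>y. q y * partial_inner M1 v f y) x"
      by (auto simp: partial_inner_cmult algebra_simps)
  next
    fix f assume f: "f \<in> L2 M"
    let ?p = "partial_inner M1 v f"
    have "(L2_norm M2 (\<lambda>y. q y * ?p y))\<^sup>2 \<le> (LINT y|M2. C\<^sup>2 * (cmod (?p y))\<^sup>2)"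
      unfolding L2_norm_square
    proof (rule integral_mono_AE)
      show "integrable M2 (\<lambda>y. (cmod (q y * ?p y))\<^sup>2)"
        by (rule L2_square_integrable[OF pL[OF f]])
      show "integrable M2 (\<lambda>y. C\<^sup>2 * (cmod (?p y))\<^sup>2)"
        using L2_square_integrable[OF partial_inner_L2[OF v f]] by simp
      show "AE y in M2. (cmod (q y * ?p y))\<^sup>2 \<le> C\<^sup>2 * (cmod (?p y))\<^sup>2"
        using C by eventually_elim
          (auto simp: norm_mult power_mult_distrib intro!: mult_right_mono power_mono)
    qed
    also have "\<dots> = (\<bar>C\<bar> * L2_norm M2 ?p)\<^sup>2"
      by (simp add: L2_norm_square power_mult_distrib)
    finally have "L2_norm M2 (\<lambda>y. q y * ?p y) \<le> \<bar>C\<bar> * L2_norm M2 ?p"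
      by (rule power2_le_imp_le) (simp add: L2_norm_nonneg)
    also have "\<dots> \<le> \<bar>C\<bar> * (L2_norm M1 v * L2_norm M f)"
      by (intro mult_left_mono partial_inner_L2_norm(2) v f) simp
    finally show "L2_norm M (tensor u (\<lambda>y. q y * ?p y)) \<le> L2_norm M1 u * (\<bar>C\<bar> * L2_norm M1 v) * L2_norm M f"
      using mult_left_mono[OF _ L2_norm_nonneg[of M1 u]]
      by (simp add: tensor_L2_norm(2)[OF u pL[OF f]] mult.assoc)
  qed (intro tensor_L2 u pL)
qed

end

section \<open>Multipliers along an orthonormal system\<close>

text \<open>Multiplication of the \<open>k\<close>-th Fourier coefficient of \<open>f\<close> with respect to \<open>\<phi>\<close>, a function of \<open>y\<close>, by
  \<open>q\<^sub>k(y)\<close>, composed with the projection onto the span of the \<open>\<phi>\<^sub>k\<close>. The operator \<open>T\<^sub>1\<close> is the case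
  \<open>q\<^sub>k = h\<^sub>k\<close>, and \<open>S\<^sub>1(\<tau>)\<close> is the case \<open>q\<^sub>k = h\<^sub>k / (1 - \<tau> h\<^sub>k)\<close>.\<close>

definition fibre_op :: "'a measure \<Rightarrow> nat \<Rightarrow> (nat \<Rightarrow> 'a \<Rightarrow> complex) \<Rightarrow> (nat \<Rightarrow> 'b \<Rightarrow> complex) \<Rightarrow>
    ('a \<times> 'b \<Rightarrow> complex) \<Rightarrow> 'a \<times> 'b \<Rightarrow> complex" where
  "fibre_op M1 n \<phi> q f z = (\<Sum>k=1..n. tensor (\<phi> k) (\<lambda>y. q k y * partial_inner M1 (\<phi> k) f y) z)"

locale orthonormal_pair = finite_pair M1 M2 for M1 :: "'a measure" and M2 :: "'b measure" +
  fixes n :: nat and \<phi> :: "nat \<Rightarrow> 'a \<Rightarrow> complex"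
  assumes orthonormal: "L2_orthonormal M1 n \<phi>"
begin

lemma phi_L2: "k \<in> {1..n} \<Longrightarrow> \<phi> k \<in> L2 M1"
  using orthonormal by (auto simp: L2_orthonormal_def)

lemma phi_inner: "k \<in> {1..n} \<Longrightarrow> l \<in> {1..n} \<Longrightarrow> L2_inner M1 (\<phi> k) (\<phi> l) = (if k = l then 1 else 0)"
  using orthonormal by (simp add: L2_orthonormal_def)

abbreviation multiplier where "multiplier \<equiv> fibre_op M1 n \<phi>"

lemma bounded_op_multiplier:
  assumes "\<And>k. k \<in> {1..n} \<Longrightarrow> ess_bounded_mult M2 (q k)"
  shows "bounded_op M (multiplier q)"
  unfolding fibre_op_def[abs_def] by (intro bounded_op_sum bounded_op_slice phi_L2 assms)

lemma partial_inner_multiplier: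
  assumes l: "l \<in> {1..n}"
  shows "partial_inner M1 (\<phi> l) (multiplier q f) y = q l y * partial_inner M1 (\<phi> l) f y"
proof -
  have "partial_inner M1 (\<phi> l) (multiplier q f) y =
     L2_inner M1 (\<lambda>s. \<Sum>k=1..n. (q k y * partial_inner M1 (\<phi> k) f y) * \<phi> k s) (\<phi> l)"
    unfolding partial_inner_section fibre_op_def by (simp add: mult.commute)
  also have "\<dots> = (\<Sum>k=1..n. (q k y * partial_inner M1 (\<phi> k) f y) * L2_inner M1 (\<phi> k) (\<phi> l))"
    by (subst L2_inner_sum_left) (intro L2_cmult phi_L2 l refl | assumption | simp add: L2_inner_cmult_left)+
  also have "\<dots> = (\<Sum>k=1..n. if k = l then q l y * partial_inner M1 (\<phi> l) f y else 0)"
    using l by (intro sum.cong) (auto simp: phi_inner)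
  also have "\<dots> = q l y * partial_inner M1 (\<phi> l) f y"
    using l by simp
  finally show ?thesis .
qed

text \<open>By orthonormality \<open>q \<mapsto> multiplier q\<close> is multiplicative; operator identities between \<open>T\<^sub>1\<close> and
  \<open>S\<^sub>1(\<tau>)\<close> thereby reduce to identities between scalar functions of \<open>y\<close>.\<close>

lemma multiplier_comp: "multiplier q (multiplier q' f) = multiplier (\<lambda>k y. q k y * q' k y) f"
  by (auto simp: fibre_op_def fun_eq_iff partial_inner_multiplier mult.assoc intro!: sum.cong)

lemma multiplier_cong:
  assumes "\<And>k. k \<in> {1..n} \<Longrightarrow> AE y in M2. q k y = q' k y"
  shows "AE z in M. multiplier q f z = multiplier q' f z"
proof -
  have "AE y in M2. \<forall>k\<in>{1..n}. q k y = q' k y"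
    using assms by (simp add: AE_ball_countable)
  from AE_snd[OF this] show ?thesis
    by eventually_elim (auto simp: fibre_op_def intro!: sum.cong)
qed

lemma multiplier_symmetric:
  assumes q: "\<And>k. k \<in> {1..n} \<Longrightarrow> ess_bounded M2 (h k)"
    and f: "f \<in> L2 M" and g: "g \<in> L2 M"
  shows "L2_inner M (multiplier (\<lambda>k y. complex_of_real (h k y)) f) g
    = L2_inner M f (multiplier (\<lambda>k y. complex_of_real (h k y)) g)"
proof -
  let ?t = "\<lambda>f k. tensor (\<phi> k) (\<lambda>y. complex_of_real (h k y) * partial_inner M1 (\<phi> k) f y)"
  have hL: "(\<lambda>y. complex_of_real (h k y) * partial_inner M1 (\<phi> k) f y) \<in> L2 M2"
    if "k \<in> {1..n}" "f \<in> L2 M" for k f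
    using that by (intro ess_bounded_mult_L2 ess_bounded_mult_of_real q partial_inner_L2 phi_L2)
  have tL: "?t f k \<in> L2 M" if "k \<in> {1..n}" "f \<in> L2 M" for k f
    using that by (intro tensor_L2 phi_L2 hL)
  have "L2_inner M (?t f k) g = L2_inner M f (?t g k)" if k: "k \<in> {1..n}" for k
  proof -
    have "L2_inner M (?t f k) g = cnj (L2_inner M2 (partial_inner M1 (\<phi> k) g)
        (\<lambda>y. complex_of_real (h k y) * partial_inner M1 (\<phi> k) f y))"
      by (subst L2_inner_cnj) (simp only: inner_tensor[OF phi_L2[OF k] hL[OF k f] g])
    also have "\<dots> = L2_inner M2 (partial_inner M1 (\<phi> k) f)
        (\<lambda>y. complex_of_real (h k y) * partial_inner M1 (\<phi> k) g y)"
      by (subst L2_inner_cnj[symmetric]) (simp add: L2_inner_def ac_simps)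
    also have "\<dots> = L2_inner M f (?t g k)"
      by (simp only: inner_tensor[OF phi_L2[OF k] hL[OF k g] f])
    finally show ?thesis .
  qed
  then show ?thesis
    unfolding fibre_op_def[abs_def]
    by (simp only: L2_inner_sum_left[OF tL[OF _ f] g] L2_inner_sum_right[OF tL[OF _ g] f] cong: sum.cong)
qed

lemma multiplier_tensor:
  "multiplier q (tensor u g) = (\<lambda>z. \<Sum>k=1..n. L2_inner M1 u (\<phi> k) * tensor (\<phi> k) (\<lambda>y. q k y * g y) z)"
  by (auto simp: fibre_op_def fun_eq_iff partial_inner_tensor ac_simps intro!: sum.cong)

end

section \<open>The resolvent of a partial integral operator\<close>

text \<open>The essential range of a real function, as a set of complex numbers.\<close>

definition ess_range :: "'b measure \<Rightarrow> ('b \<Rightarrow> real) \<Rightarrow> complex set" where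
  "ess_range M h = {l. \<forall>\<epsilon>>0. \<not> (AE y in M. \<epsilon> \<le> cmod (l - complex_of_real (h y)))}"

locale partial_integral = orthonormal_pair M1 M2 n \<phi>
  for M1 M2 :: "real measure" and n :: nat and \<phi> :: "nat \<Rightarrow> real \<Rightarrow> complex" +
  fixes h :: "nat \<Rightarrow> real \<Rightarrow> real"
  assumes h_bounded: "k \<in> {1..n} \<Longrightarrow> ess_bounded M2 (h k)"
begin

abbreviation T where "T \<equiv> T1_op M1 n \<phi> h"
abbreviation hc where "hc \<equiv> \<lambda>k y. complex_of_real (h k y)"

lemma hc_bounded: "k \<in> {1..n} \<Longrightarrow> ess_bounded_mult M2 (hc k)"
  by (intro ess_bounded_mult_of_real h_bounded)

lemma hc_measurable: "k \<in> {1..n} \<Longrightarrow> hc k \<in> borel_measurable M2"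
  using hc_bounded by (simp add: ess_bounded_mult_def)

lemma P_op_eq: "P_op M1 u f = tensor u (partial_inner M1 u f)"
  by (auto simp: P_op_def partial_inner_def fun_eq_iff mult.assoc)

lemma S1_op_eq: "S1_op M1 n \<phi> h \<tau> f = multiplier (\<lambda>k y. hc k y / (1 - \<tau> * hc k y)) f"
  by (auto simp: S1_op_def fibre_op_def fun_eq_iff P_op_eq ac_simps intro!: sum.cong)

lemma T_measurable:
  assumes f: "f \<in> borel_measurable M"
  shows "T f \<in> borel_measurable M"
proof -
  let ?N = "M \<Otimes>\<^sub>M M1"
  have x: "(\<lambda>w. fst (fst w)) \<in> measurable ?N M1" and y: "(\<lambda>w. snd (fst w)) \<in> measurable ?N M2"
    by measurable
  have 1: "(\<lambda>w. \<phi> k (fst (fst w)) * cnj (\<phi> k (snd w)) * hc k (snd (fst w))) \<in> borel_measurable ?N"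
    if k: "k \<in> {1..n}" for k
    by (intro borel_measurable_times borel_measurable_cnj
        measurable_compose[OF x L2_measurable[OF phi_L2[OF k]]]
        measurable_compose[OF measurable_snd L2_measurable[OF phi_L2[OF k]]]
        measurable_compose[OF y hc_measurable[OF k]])
  have 2: "(\<lambda>w. f (snd w, snd (fst w))) \<in> borel_measurable ?N"
    by (rule measurable_compose[OF measurable_Pair[OF measurable_snd y] f])
  have "(\<lambda>w. (\<Sum>k=1..n. \<phi> k (fst (fst w)) * cnj (\<phi> k (snd w)) * hc k (snd (fst w)))
      * f (snd w, snd (fst w))) \<in> borel_measurable ?N"
    by (rule borel_measurable_times[OF borel_measurable_sum[OF 1] 2])
  then have "(\<lambda>z. LINT s|M1. (\<Sum>k=1..n. \<phi> k (fst z) * cnj (\<phi> k s) * hc k (snd z)) * f (s, snd z))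
      \<in> borel_measurable M"
    by (intro M1.borel_measurable_lebesgue_integral) (simp only: case_prod_unfold)
  then show ?thesis by (simp only: T1_op_def case_prod_unfold)
qed

text \<open>The sum over \<open>k\<close> leaves the integral wherever the section of \<open>f\<close> is square integrable. At other
  \<open>y\<close> the two sides may differ, since the integral of a non-integrable function is \<open>0\<close> by convention.\<close>

lemma T_eq_multiplier:
  assumes f: "f \<in> L2 M"
  shows "AE z in M. T f z = multiplier hc f z"
proof -
  have "AE z in M. (\<lambda>s. f (s, snd z)) \<in> L2 M1"
    by (rule AE_snd[OF section_L2[OF f]])
  then show ?thesis
  proof eventually_elim
    case (elim z)
    obtain x y where z: "z = (x, y)" by (cases z)
    have int: "integrable M1 (\<lambda>s. cnj (\<phi> k s) * f (s, y))" if "k \<in> {1..n}" for k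
      using L2_mult_integrable[OF L2_cnj[OF phi_L2[OF that]], of "\<lambda>s. f (s, y)"] elim by (simp add: z)
    have "T f z = (LINT s|M1. (\<Sum>k=1..n. (\<phi> k x * hc k y) * (cnj (\<phi> k s) * f (s, y))))"
      unfolding T1_op_def z prod.case sum_distrib_right
      by (intro Bochner_Integration.integral_cong sum.cong refl) (simp add: ac_simps)
    also have "\<dots> = (\<Sum>k=1..n. LINT s|M1. (\<phi> k x * hc k y) * (cnj (\<phi> k s) * f (s, y)))"
      using int by (intro Bochner_Integration.integral_sum) auto
    also have "\<dots> = multiplier hc f z"
      by (simp only: Bochner_Integration.integral_mult_right_zero fibre_op_def z tensor_apply
          partial_inner_def mult.assoc)
    finally show ?case .
  qed
qed

lemma bounded_op_T: "bounded_op M T"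
  by (rule bounded_op_cong_op[OF bounded_op_multiplier[of hc]])
    (auto intro: hc_bounded T_measurable L2_measurable T_eq_multiplier)

lemma T_symmetric:
  assumes f: "f \<in> L2 M" and g: "g \<in> L2 M"
  shows "L2_inner M (T f) g = L2_inner M f (T g)"
proof -
  have b: "bounded_op M (multiplier hc)" by (rule bounded_op_multiplier[OF hc_bounded])
  have "L2_inner M (T f) g = L2_inner M (multiplier hc f) g"
    by (rule L2_inner_cong[OF T_eq_multiplier[OF f] AE_I2[OF refl]])
      (intro f g bounded_op_L2[OF bounded_op_T] bounded_op_L2[OF b])+
  also have "\<dots> = L2_inner M f (multiplier hc g)"
    by (rule multiplier_symmetric[OF h_bounded f g])
  also have "\<dots> = L2_inner M f (T g)"
    by (rule L2_inner_cong[OF AE_I2[OF refl] T_eq_multiplier[OF g, THEN AE_symmetric]])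
      (intro f g bounded_op_L2[OF bounded_op_T] bounded_op_L2[OF b])+
  finally show ?thesis .
qed

lemma multiplier_lincomb:
  "multiplier q f z + c * multiplier q' f z = multiplier (\<lambda>k y. q k y + c * q' k y) f z"
proof (cases z)
  case (Pair x y)
  show ?thesis
    unfolding Pair fibre_op_def sum_distrib_left sum.distrib[symmetric]
    by (intro sum.cong refl) (simp add: algebra_simps)
qed

text \<open>A lower bound on \<open>\<bar>1 - \<tau> h\<^sub>k\<bar>\<close> is what makes \<open>S\<^sub>1(\<tau>)\<close> a bounded operator.\<close>

lemma gap_imp_ess_bounded:
  assumes \<epsilon>: "\<epsilon> > 0" and gap: "\<And>k. k \<in> {1..n} \<Longrightarrow> AE y in M2. \<epsilon> \<le> cmod (1 - \<tau> * hc k y)"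
    and k: "k \<in> {1..n}"
  shows "ess_bounded_mult M2 (\<lambda>y. hc k y / (1 - \<tau> * hc k y))"
proof -
  obtain C where C: "AE y in M2. \<bar>h k y\<bar> \<le> C" using h_bounded[OF k] by (auto simp: ess_bounded_def)
  have "AE y in M2. cmod (hc k y / (1 - \<tau> * hc k y)) \<le> C / \<epsilon>"
    using C gap[OF k]
  proof eventually_elim
    case (elim y)
    then show ?case unfolding norm_divide
      by (intro frac_le) (use \<epsilon> in auto)
  qed
  moreover have "(\<lambda>y. hc k y / (1 - \<tau> * hc k y)) \<in> borel_measurable M2"
    by (intro borel_measurable_divide borel_measurable_diff borel_measurable_times
        borel_measurable_const hc_measurable[OF k])
  ultimately show ?thesis by (auto simp: ess_bounded_mult_def)
qed

text \<open>With \<open>q = h / (1 - \<tau> h)\<close> one has \<open>q - \<tau> h q = h\<close>. On the level of operators this reads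
  \<open>S\<^sub>1 - \<tau> T\<^sub>1 S\<^sub>1 = T\<^sub>1 = S\<^sub>1 - \<tau> S\<^sub>1 T\<^sub>1\<close>, so that \<open>E + \<tau> S\<^sub>1\<close> inverts \<open>E - \<tau> T\<^sub>1\<close>.\<close>

lemma gap_imp_S1:
  assumes \<epsilon>: "\<epsilon> > 0" and gap: "\<And>k. k \<in> {1..n} \<Longrightarrow> AE y in M2. \<epsilon> \<le> cmod (1 - \<tau> * hc k y)"
  shows "bounded_op M (S1_op M1 n \<phi> h \<tau>)"
    and "f \<in> L2 M \<Longrightarrow> AE z in M. S1_op M1 n \<phi> h \<tau> f z - \<tau> * T (S1_op M1 n \<phi> h \<tau> f) z = T f z"
    and "is_inverse_op M (\<lambda>f z. f z - \<tau> * T f z) (\<lambda>f z. f z + \<tau> * S1_op M1 n \<phi> h \<tau> f z)"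
proof -
  define q where "q k y = hc k y / (1 - \<tau> * hc k y)" for k y
  have S: "S1_op M1 n \<phi> h \<tau> = multiplier q"
    by (rule ext) (simp only: S1_op_eq q_def[abs_def])
  have qb: "ess_bounded_mult M2 (q k)" if k: "k \<in> {1..n}" for k
    unfolding q_def[abs_def] by (rule gap_imp_ess_bounded[OF \<epsilon> gap k])
  have bq: "bounded_op M (multiplier q)" by (rule bounded_op_multiplier[OF qb])
  show bS: "bounded_op M (S1_op M1 n \<phi> h \<tau>)" unfolding S by (rule bq)
  have qL: "f \<in> L2 M \<Longrightarrow> multiplier q f \<in> L2 M" for f by (rule bounded_op_L2[OF bq])
  have key: "AE z in M. multiplier q f z + (-\<tau>) * multiplier (\<lambda>k y. hc k y * q k y) f z = multiplier hc f z"
    if "f \<in> L2 M" for f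
    unfolding multiplier_lincomb
  proof (rule multiplier_cong)
    fix k assume k: "k \<in> {1..n}"
    show "AE y in M2. q k y + - \<tau> * (hc k y * q k y) = hc k y"
      using gap[OF k]
    proof eventually_elim
      case (elim y)
      then have nz: "1 - \<tau> * hc k y \<noteq> 0" using \<epsilon> by auto
      have "q k y + - \<tau> * (hc k y * q k y) = (1 - \<tau> * hc k y) * q k y" by (simp add: algebra_simps)
      also have "\<dots> = hc k y" using nz by (simp add: q_def)
      finally show ?case .
    qed
  qed
  have TS: "AE z in M. multiplier q f z - \<tau> * T (multiplier q f) z = T f z" if f: "f \<in> L2 M" for f
    using key[OF f] T_eq_multiplier[OF f] T_eq_multiplier[OF qL[OF f]]
    by eventually_elim (simp add: multiplier_comp)
  then show "f \<in> L2 M \<Longrightarrow> AE z in M. S1_op M1 n \<phi> h \<tau> f z - \<tau> * T (S1_op M1 n \<phi> h \<tau> f) z = T f z"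
    unfolding S by blast
  have ST: "AE z in M. multiplier q f z - \<tau> * multiplier q (T f) z = T f z" if f: "f \<in> L2 M" for f
  proof -
    have bh: "bounded_op M (multiplier hc)" by (rule bounded_op_multiplier[OF hc_bounded])
    note TL = bounded_op_L2[OF bounded_op_T f] bounded_op_L2[OF bh f]
    have comm: "multiplier (\<lambda>k y. q k y * hc k y) f = multiplier (\<lambda>k y. hc k y * q k y) f"
      by (simp add: mult.commute)
    show ?thesis
      using key[OF f] T_eq_multiplier[OF f] bounded_op_cong[OF bq TL T_eq_multiplier[OF f]]
      by eventually_elim (simp add: multiplier_comp comm)
  qed
  show "is_inverse_op M (\<lambda>f z. f z - \<tau> * T f z) (\<lambda>f z. f z + \<tau> * S1_op M1 n \<phi> h \<tau> f z)"
    unfolding is_inverse_op_def S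
  proof (intro conjI ballI)
    show "bounded_op M (\<lambda>f z. f z + \<tau> * multiplier q f z)"
      by (intro bounded_op_plus[OF bounded_op_id] bounded_op_scaled bq)
    fix f assume f: "f \<in> L2 M"
    have TL: "T f \<in> L2 M" by (rule bounded_op_L2[OF bounded_op_T f])
    show "AE z in M. (f z - \<tau> * T f z) + \<tau> * multiplier q (\<lambda>z. f z - \<tau> * T f z) z = f z"
      using bounded_op_diff[OF bq f L2_cmult[OF TL, of \<tau>]] bounded_op_cmult[OF bq TL, of \<tau>] ST[OF f]
      by eventually_elim (simp add: algebra_simps)
    show "AE z in M. (f z + \<tau> * multiplier q f z) - \<tau> * T (\<lambda>z. f z + \<tau> * multiplier q f z) z = f z"
      using bounded_op_add[OF bounded_op_T f L2_cmult[OF qL[OF f], of \<tau>]]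
        bounded_op_cmult[OF bounded_op_T qL[OF f], of \<tau>] TS[OF f]
      by eventually_elim (simp add: algebra_simps)
  qed
qed

lemma T_tensor:
  assumes u: "u \<in> L2 M1" and g: "g \<in> L2 M2"
  shows "AE z in M. T (tensor u g) z = (\<Sum>k=1..n. L2_inner M1 u (\<phi> k) * tensor (\<phi> k) (\<lambda>y. hc k y * g y) z)"
  using T_eq_multiplier[OF tensor_L2[OF u g]] by (simp add: multiplier_tensor)

lemma T_tensor_phi:
  assumes k: "k \<in> {1..n}" and g: "g \<in> L2 M2"
  shows "AE z in M. T (tensor (\<phi> k) g) z = tensor (\<phi> k) (\<lambda>y. hc k y * g y) z"
  using T_tensor[OF phi_L2[OF k] g]
proof eventually_elim
  case (elim z)
  have "(\<Sum>l=1..n. L2_inner M1 (\<phi> k) (\<phi> l) * tensor (\<phi> l) (\<lambda>y. hc l y * g y) z)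
     = (\<Sum>l=1..n. if k = l then tensor (\<phi> k) (\<lambda>y. hc k y * g y) z else 0)"
    using k by (intro sum.cong) (auto simp: phi_inner)
  then show ?case using elim k by simp
qed

lemma T_tensor_orthogonal:
  assumes u: "u \<in> L2 M1" and g: "g \<in> L2 M2" and orth: "\<And>k. k \<in> {1..n} \<Longrightarrow> L2_inner M1 u (\<phi> k) = 0"
  shows "AE z in M. T (tensor u g) z = 0"
  using T_tensor[OF u g] orth by simp

lemma gap_open:
  assumes "\<And>k. k \<in> {1..n} \<Longrightarrow> l \<notin> ess_range M2 (h k)"
  obtains \<epsilon> where "\<epsilon> > 0" "\<And>k. k \<in> {1..n} \<Longrightarrow> AE y in M2. \<epsilon> \<le> cmod (l - hc k y)"
proof -
  have "\<forall>k\<in>{1..n}. \<exists>\<epsilon>>0. AE y in M2. \<epsilon> \<le> cmod (l - hc k y)"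
    using assms by (auto simp: ess_range_def)
  then obtain e where e: "\<And>k. k \<in> {1..n} \<Longrightarrow> e k > 0 \<and> (AE y in M2. e k \<le> cmod (l - hc k y))"
    by metis
  define \<epsilon> where "\<epsilon> = Min (insert 1 (e ` {1..n}))"
  have "\<epsilon> > 0" using e by (auto simp: \<epsilon>_def)
  moreover have "AE y in M2. \<epsilon> \<le> cmod (l - hc k y)" if k: "k \<in> {1..n}" for k
  proof -
    have "\<epsilon> \<le> e k" unfolding \<epsilon>_def by (rule Min_le) (use k in auto)
    then show ?thesis using e[OF k] by (auto elim: eventually_mono)
  qed
  ultimately show ?thesis using that by blast
qed

lemma not_ess_range_inverse:
  assumes "\<tau> \<noteq> 0" and "\<And>k. k \<in> {1..n} \<Longrightarrow> inverse \<tau> \<notin> ess_range M2 (h k)"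
  obtains \<epsilon> where "\<epsilon> > 0" "\<And>k. k \<in> {1..n} \<Longrightarrow> AE y in M2. \<epsilon> \<le> cmod (1 - \<tau> * hc k y)"
proof -
  obtain \<epsilon> where \<epsilon>: "\<epsilon> > 0" "\<And>k. k \<in> {1..n} \<Longrightarrow> AE y in M2. \<epsilon> \<le> cmod (inverse \<tau> - hc k y)"
    using gap_open assms(2) by blast
  have "AE y in M2. cmod \<tau> * \<epsilon> \<le> cmod (1 - \<tau> * hc k y)" if k: "k \<in> {1..n}" for k
    using \<epsilon>(2)[OF k]
  proof eventually_elim
    case (elim y)
    have "1 - \<tau> * hc k y = \<tau> * (inverse \<tau> - hc k y)" using assms(1) by (simp add: algebra_simps)
    then have "cmod (1 - \<tau> * hc k y) = cmod \<tau> * cmod (inverse \<tau> - hc k y)" by (simp add: norm_mult)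
    with mult_left_mono[OF elim, of "cmod \<tau>"] show ?case by simp
  qed
  moreover have "cmod \<tau> * \<epsilon> > 0" using assms(1) \<epsilon>(1) by simp
  ultimately show ?thesis using that by blast
qed

lemma not_ess_range_imp_resolvent:
  assumes "l \<noteq> 0" and "\<And>k. k \<in> {1..n} \<Longrightarrow> l \<notin> ess_range M2 (h k)"
  shows "l \<in> resolvent_set M T"
proof -
  obtain \<epsilon> where \<epsilon>: "\<epsilon> > 0" "\<And>k. k \<in> {1..n} \<Longrightarrow> AE y in M2. \<epsilon> \<le> cmod (1 - inverse l * hc k y)"
    using not_ess_range_inverse[of "inverse l"] assms by auto
  have "inverse (inverse l) \<in> resolvent_set M T"
    using inverse_in_resolvent_set_iff[OF bounded_op_T, of "inverse l"] gap_imp_S1(3)[OF \<epsilon>] assms(1)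
    by auto
  then show ?thesis by simp
qed

end

section \<open>Exchange of coordinates\<close>

text \<open>Conjugation with the unitary exchange of the two coordinates. It turns \<open>T\<^sub>2\<close> into an operator of the
  form \<open>T\<^sub>1\<close> for the exchanged measures, so every result about \<open>T\<^sub>1\<close> transfers to \<open>T\<^sub>2\<close>.\<close>

definition swap_op :: "(('a \<times> 'b \<Rightarrow> complex) \<Rightarrow> 'a \<times> 'b \<Rightarrow> complex) \<Rightarrow>
    ('b \<times> 'a \<Rightarrow> complex) \<Rightarrow> 'b \<times> 'a \<Rightarrow> complex" where
  "swap_op A f = (\<lambda>w. A (f \<circ> prod.swap) (prod.swap w))"

lemma comp_swap_swap [simp]: "f \<circ> prod.swap \<circ> prod.swap = f"
  by (simp add: fun_eq_iff)

lemma swap_op_swap: "swap_op A (f \<circ> prod.swap) = A f \<circ> prod.swap"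
  by (simp add: swap_op_def fun_eq_iff)

lemma swap_op_swap_op [simp]: "swap_op (swap_op A) = A"
  by (simp add: swap_op_def fun_eq_iff comp_def)

lemma swap_op_shift: "swap_op (\<lambda>f z. c * f z - A f z) = (\<lambda>f z. c * f z - swap_op A f z)"
  by (simp add: swap_op_def fun_eq_iff)

context finite_pair
begin

abbreviation M' :: "('b \<times> 'a) measure" where "M' \<equiv> M2 \<Otimes>\<^sub>M M1"

lemma AE_swap:
  assumes "AE z in M. P z"
  shows "AE w in M'. P (prod.swap w)"
proof -
  have "AE z in distr M' M (\<lambda>(x, y). (y, x)). P z"
    using assms by (subst (asm) distr_pair_swap)
  then have "AE w in M'. P ((\<lambda>(x, y). (y, x)) w)"
    by (rule AE_distrD[OF measurable_pair_swap'])
  then show ?thesis by (simp add: case_prod_unfold prod.swap_def)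
qed

lemma L2_swap:
  assumes f: "f \<in> L2 M"
  shows "f \<circ> prod.swap \<in> L2 M'" and "L2_norm M' (f \<circ> prod.swap) = L2_norm M f"
proof -
  have m: "(\<lambda>(x, y). f (y, x)) \<in> borel_measurable M'"
    using L2_measurable[OF f] by (rule measurable_pair_swap)
  have e: "(\<lambda>(x, y). f (y, x)) = f \<circ> prod.swap"
    by (auto simp: fun_eq_iff)
  have "integrable M' (\<lambda>(x, y). (cmod (f (y, x)))\<^sup>2)"
    using integrable_product_swap[OF L2_square_integrable[OF f]] .
  then have "integrable M' (\<lambda>w. (cmod ((f \<circ> prod.swap) w))\<^sup>2)"
    by (simp add: case_prod_unfold prod.swap_def)
  with m show "f \<circ> prod.swap \<in> L2 M'" by (simp add: L2_def e)
  have "(LINT (x, y)|M'. (cmod (f (y, x)))\<^sup>2) = (LINT z|M. (cmod (f z))\<^sup>2)"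
    by (rule integral_product_swap)
      (rule borel_measurable_integrable[OF L2_square_integrable[OF f]])
  then show "L2_norm M' (f \<circ> prod.swap) = L2_norm M f"
    by (simp add: L2_norm_def case_prod_unfold prod.swap_def)
qed

lemma L2_inner_swap:
  assumes "f \<in> L2 M" "g \<in> L2 M"
  shows "L2_inner M' (f \<circ> prod.swap) (g \<circ> prod.swap) = L2_inner M f g"
proof -
  have "(LINT (x, y)|M'. (f (y, x) * cnj (g (y, x)))) = (LINT z|M. f z * cnj (g z))"
    by (rule integral_product_swap)
      (rule borel_measurable_integrable[OF L2_inner_integrable[OF assms]])
  then show ?thesis by (simp add: L2_inner_def case_prod_unfold prod.swap_def)
qed

lemma L2_swap': "f \<in> L2 M' \<Longrightarrow> f \<circ> prod.swap \<in> L2 M"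
  and L2_norm_swap': "f \<in> L2 M' \<Longrightarrow> L2_norm M (f \<circ> prod.swap) = L2_norm M' f"
  and AE_swap': "AE w in M'. Q w \<Longrightarrow> AE z in M. Q (prod.swap z)"
proof -
  interpret W: finite_pair M2 M1 by unfold_locales
  show "f \<in> L2 M' \<Longrightarrow> f \<circ> prod.swap \<in> L2 M"
    and "f \<in> L2 M' \<Longrightarrow> L2_norm M (f \<circ> prod.swap) = L2_norm M' f"
    and "AE w in M'. Q w \<Longrightarrow> AE z in M. Q (prod.swap z)"
    by (rule W.L2_swap W.AE_swap; assumption)+
qed

lemma bounded_op_swap:
  assumes A: "bounded_op M A"
  shows "bounded_op M' (swap_op A)"
proof -
  obtain C where C: "\<And>f. f \<in> L2 M \<Longrightarrow> L2_norm M (A f) \<le> C * L2_norm M f"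
    using bounded_op_bound[OF A] by blast
  have e: "swap_op A f = A (f \<circ> prod.swap) \<circ> prod.swap" for f
    by (simp add: swap_op_def fun_eq_iff)
  show ?thesis
  proof (rule bounded_opI[where C = C])
    fix f g assume f: "f \<in> L2 M'" and g: "g \<in> L2 M'"
    show "AE w in M'. swap_op A (\<lambda>z. f z + g z) w = swap_op A f w + swap_op A g w"
      using AE_swap[OF bounded_op_add[OF A L2_swap'[OF f] L2_swap'[OF g]]]
      by (simp add: swap_op_def comp_def)
  next
    fix c f assume f: "f \<in> L2 M'"
    show "AE w in M'. swap_op A (\<lambda>z. c * f z) w = c * swap_op A f w"
      using AE_swap[OF bounded_op_cmult[OF A L2_swap'[OF f], of c]]
      by (simp add: swap_op_def comp_def)
  next
    fix f assume f: "f \<in> L2 M'"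
    show "L2_norm M' (swap_op A f) \<le> C * L2_norm M' f"
      using C[OF L2_swap'[OF f]] unfolding e
      by (simp only: L2_swap(2)[OF bounded_op_L2[OF A L2_swap'[OF f]]] L2_norm_swap'[OF f])
    show "swap_op A f \<in> L2 M'"
      unfolding e by (rule L2_swap(1)[OF bounded_op_L2[OF A L2_swap'[OF f]]])
  qed
qed

lemma is_inverse_op_swap:
  assumes "is_inverse_op M A R"
  shows "is_inverse_op M' (swap_op A) (swap_op R)"
  unfolding is_inverse_op_def
proof (intro conjI ballI)
  show "bounded_op M' (swap_op R)"
    by (rule bounded_op_swap[OF is_inverse_opD(1)[OF assms]])
  have e: "swap_op B f = B (f \<circ> prod.swap) \<circ> prod.swap" for f :: "'b \<times> 'a \<Rightarrow> complex" and B
    by (simp add: swap_op_def fun_eq_iff)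
  fix f assume f: "f \<in> L2 M'"
  note f' = L2_swap'[OF f]
  show "AE w in M'. swap_op R (swap_op A f) w = f w"
    using AE_swap[OF is_inverse_opD(2)[OF assms f']] by (simp add: e comp_def)
  show "AE w in M'. swap_op A (swap_op R f) w = f w"
    using AE_swap[OF is_inverse_opD(3)[OF assms f']] by (simp add: e comp_def)
qed

lemma resolvent_set_swap_subset: "resolvent_set M A \<subseteq> resolvent_set M' (swap_op A)"
  using is_inverse_op_swap unfolding resolvent_set_def
  by (fastforce simp: swap_op_shift[symmetric])

lemma resolvent_set_swap: "resolvent_set M' (swap_op A) = resolvent_set M A"
proof -
  interpret W: finite_pair M2 M1 by unfold_locales
  show ?thesis
    using resolvent_set_swap_subset[of A] W.resolvent_set_swap_subset[of "swap_op A"] by auto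
qed

lemma eigenspace_swap:
  assumes "f \<in> eigenspace M A l"
  shows "f \<circ> prod.swap \<in> eigenspace M' (swap_op A) l"
  using assms L2_swap(1)[of f] AE_swap[of "\<lambda>z. A f z = l * f z"]
  by (simp add: eigenspace_def swap_op_swap)

lemma eigenspace_swap':
  assumes "f \<in> eigenspace M' (swap_op A) l"
  shows "f \<circ> prod.swap \<in> eigenspace M A l"
proof -
  interpret W: finite_pair M2 M1 by unfold_locales
  show ?thesis using W.eigenspace_swap[OF assms] by simp
qed

text \<open>Unitary equivalence. Composition with the exchange is injective, so a spanning set \<open>B\<close> of an
  eigenspace is mapped to a spanning set with the same coefficients.\<close>

lemma discrete_spectrum_swap:
  assumes l: "l \<in> discrete_spectrum M A"
  shows "l \<in> discrete_spectrum M' (swap_op A)"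
proof -
  obtain f where f: "f \<in> eigenspace M A l" and f0: "\<not> (AE z in M. f z = 0)"
    using l by (auto simp: discrete_spectrum_def is_eigenvalue_def)
  have "\<not> (AE w in M'. (f \<circ> prod.swap) w = 0)"
    using AE_swap'[of "\<lambda>w. (f \<circ> prod.swap) w = 0"] f0 by auto
  then have ev: "is_eigenvalue M' (swap_op A) l"
    using eigenspace_swap[OF f] unfolding is_eigenvalue_def by blast
  obtain B where B: "finite B" "B \<subseteq> eigenspace M A l"
    and span: "\<And>f. f \<in> eigenspace M A l \<Longrightarrow> \<exists>\<alpha>. AE x in M. f x = (\<Sum>g\<in>B. \<alpha> g * g x)"
    using l by (auto simp: discrete_spectrum_def finite_multiplicity_def)
  let ?s = "\<lambda>g. g \<circ> prod.swap"
  have inj: "inj_on ?s B"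
    by (rule inj_on_inverseI[where g = ?s]) simp
  have "\<exists>\<alpha>. AE w in M'. k w = (\<Sum>g\<in>?s ` B. \<alpha> g * g w)" if k: "k \<in> eigenspace M' (swap_op A) l" for k
  proof -
    obtain \<alpha> where \<alpha>: "AE z in M. (k \<circ> prod.swap) z = (\<Sum>g\<in>B. \<alpha> g * g z)"
      using span[OF eigenspace_swap'[OF k]] by blast
    have "(\<Sum>g\<in>?s ` B. \<alpha> (g \<circ> prod.swap) * g w) = (\<Sum>g\<in>B. \<alpha> g * g (prod.swap w))" for w
      unfolding sum.reindex[OF inj]
      by (intro sum.cong refl) (simp only: o_apply comp_swap_swap)
    with AE_swap[OF \<alpha>] have "AE w in M'. k w = (\<Sum>g\<in>?s ` B. \<alpha> (g \<circ> prod.swap) * g w)"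
      by simp
    then show ?thesis
      by (intro exI[of _ "\<lambda>g. \<alpha> (g \<circ> prod.swap)"])
  qed
  moreover have "?s ` B \<subseteq> eigenspace M' (swap_op A) l"
    using B(2) eigenspace_swap by blast
  ultimately have "finite_multiplicity M' (swap_op A) l"
    unfolding finite_multiplicity_def using B(1) by (intro exI[of _ "?s ` B"]) auto
  moreover have "spectrum M' (swap_op A) = spectrum M A"
    by (simp add: spectrum_def resolvent_set_swap)
  ultimately show ?thesis
    using l ev by (simp add: discrete_spectrum_def)
qed

end

lemma T2_op_eq_swap_op: "T2_op M2 m \<psi> p = swap_op (T1_op M2 m \<psi> p)"
  by (auto simp: T2_op_def T1_op_def swap_op_def fun_eq_iff ac_simps
      intro!: Bochner_Integration.integral_cong sum.cong arg_cong2[of _ _ _ _ "(*)"])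

section \<open>Nonatomic measures and the essential range\<close>

definition nonatomic :: "'a measure \<Rightarrow> bool" where
  "nonatomic M \<longleftrightarrow> (\<forall>A\<in>sets M. measure M A > 0 \<longrightarrow>
     (\<exists>B\<in>sets M. B \<subseteq> A \<and> 0 < measure M B \<and> measure M B < measure M A))"

context finite_measure
begin

lemma measure_pos_of_not_AE:
  assumes A: "A \<in> sets M" and not_null: "\<not> (AE y in M. y \<notin> A)"
  shows "measure M A > 0"
proof -
  have "emeasure M A \<noteq> 0"
    using A not_null by (auto simp: AE_iff_null_sets[symmetric] null_sets_def)
  then show ?thesis
    by (simp add: emeasure_eq_measure zero_less_measure_iff)
qed

lemma nonatomic_disjoint_pieces:
  assumes na: "nonatomic M" and A: "A \<in> sets M" "measure M A > 0"
  shows "\<exists>F. (\<forall>i<N. F i \<in> sets M \<and> F i \<subseteq> A \<and> measure M (F i) > 0) \<and> disjoint_family_on F {..<N::nat}"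
  using A
proof (induction N arbitrary: A)
  case 0
  then show ?case by (simp add: disjoint_family_on_def)
next
  case (Suc N)
  obtain B where B: "B \<in> sets M" "B \<subseteq> A" "0 < measure M B" "measure M B < measure M A"
    using na Suc.prems by (auto simp: nonatomic_def)
  have "measure M (A - B) > 0"
    using finite_measure_Diff[OF Suc.prems(1) B(1,2)] B(4) by simp
  then obtain F where F: "\<forall>i<N. F i \<in> sets M \<and> F i \<subseteq> A - B \<and> measure M (F i) > 0"
      "disjoint_family_on F {..<N}"
    using Suc.IH[of "A - B"] Suc.prems(1) B(1) by blast
  have "disjoint_family_on (F(N := B)) {..<Suc N}"
    unfolding disjoint_family_on_def
  proof (intro ballI impI)
    fix i j assume ij: "i \<in> {..<Suc N}" "j \<in> {..<Suc N}" "i \<noteq> j"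
    consider "i = N" "j < N" | "j = N" "i < N" | "i < N" "j < N" using ij by force
    then show "(F(N := B)) i \<inter> (F(N := B)) j = {}"
    proof cases
      case 3
      with F(2) ij(3) show ?thesis by (simp add: disjoint_family_on_def)
    qed (use F(1) in fastforce)+
  qed
  moreover have "\<forall>i<Suc N. (F(N := B)) i \<in> sets M \<and> (F(N := B)) i \<subseteq> A \<and> measure M ((F(N := B)) i) > 0"
    using F(1) B by (auto simp: less_Suc_eq)
  ultimately show ?case by blast
qed

text \<open>Finitely many orthogonality conditions on functions supported in a set of positive measure can
  always be met: if \<open>W\<close> has \<open>r\<close> elements, cut \<open>A\<close> into \<open>r + 1\<close> disjoint pieces of positive measure and
  take a combination of their indicators, which leaves \<open>r\<close> equations for \<open>r + 1\<close> coefficients.\<close>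

lemma nonatomic_orthogonal_function:
  assumes na: "nonatomic M" and A: "A \<in> sets M" "measure M A > 0"
    and W: "finite W" "W \<subseteq> L2 M"
  shows "\<exists>g\<in>L2 M. (\<forall>y. y \<notin> A \<longrightarrow> g y = 0) \<and> (\<forall>w\<in>W. L2_inner M g w = 0) \<and> \<not> (AE y in M. g y = 0)"
proof -
  define r where "r = card W"
  obtain w where w: "bij_betw w {..<r} W"
    using ex_bij_betw_nat_finite[OF W(1)] by (auto simp: r_def lessThan_atLeast0)
  obtain F where F: "\<And>i. i < Suc r \<Longrightarrow> F i \<in> sets M \<and> F i \<subseteq> A \<and> measure M (F i) > 0"
    and disj: "disjoint_family_on F {..<Suc r}"
    using nonatomic_disjoint_pieces[OF na A, of "Suc r"] by blast
  define G where "G i j = L2_inner M (indicator (F j)) (w i)" for i j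
  obtain c where c: "\<exists>i<Suc r. c i \<noteq> 0" and sys: "\<And>i. i < r \<Longrightarrow> (\<Sum>j<Suc r. G i j * c j) = 0"
    using underdetermined_system[of r G] by blast
  have iL: "indicator (F j) \<in> L2 M" if "j < Suc r" for j
  proof -
    have [measurable]: "F j \<in> sets M" using F[OF that] by simp
    have "(\<lambda>x. (cmod (indicator (F j) x))\<^sup>2) = (\<lambda>x. indicator (F j) x :: real)"
      by (auto simp: fun_eq_iff indicator_def)
    then show ?thesis
      using integrable_real_indicator[of "F j" M] by (simp add: L2_def less_top[symmetric])
  qed
  define g where "g = (\<lambda>y. \<Sum>j<Suc r. c j * indicator (F j) y)"
  have gL: "g \<in> L2 M" unfolding g_def by (intro L2_sum L2_cmult iL) simp
  moreover have "\<forall>y. y \<notin> A \<longrightarrow> g y = 0"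
  proof (intro allI impI)
    fix y assume "y \<notin> A"
    then have "y \<notin> F j" if "j < Suc r" for j using F[OF that] by blast
    then show "g y = 0" unfolding g_def by (intro sum.neutral) auto
  qed
  moreover have "L2_inner M g u = 0" if u: "u \<in> W" for u
  proof -
    obtain i where i: "i < r" "u = w i" using u w by (auto simp: bij_betw_def)
    have "L2_inner M g u = (\<Sum>j<Suc r. G i j * c j)"
      unfolding g_def G_def i(2) using i u W(2)
      by (subst L2_inner_sum_left) (auto intro!: L2_cmult iL sum.cong simp: L2_inner_cmult_left simp del: sum.lessThan_Suc)
    then show ?thesis using sys[OF i(1)] by simp
  qed
  moreover have "\<not> (AE y in M. g y = 0)"
  proof
    assume 0: "AE y in M. g y = 0"
    obtain i where i: "i < Suc r" "c i \<noteq> 0" using c by blast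
    have gi: "g y = c i" if y: "y \<in> F i" for y
    proof -
      have "y \<notin> F j" if "j < Suc r" "j \<noteq> i" for j
        using disj i(1) that y unfolding disjoint_family_on_def by blast
      then have "g y = (\<Sum>j<Suc r. if j = i then c i else 0)"
        unfolding g_def by (intro sum.cong) (auto simp: y)
      then show ?thesis using i(1) by simp
    qed
    have "AE y in M. y \<notin> F i" using 0 by eventually_elim (use gi i(2) in auto)
    then have "F i \<in> null_sets M"
      using F[OF i(1)] by (simp add: AE_iff_null_sets)
    then have "measure M (F i) = 0"
      by (simp add: measure_def null_setsD1)
    then show False using F[OF i(1)] by simp
  qed
  ultimately show ?thesis by blast
qed

end

text \<open>If \<open>h\<close> misses \<open>l\<close> almost everywhere then \<open>l\<close> cannot be an isolated point of the essential range.
  Otherwise a punctured disc around \<open>l\<close> would be covered by discs that \<open>h\<close> almost never enters; by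
  Lindelof countably many of them suffice, so \<open>h\<close> would almost never enter the disc.\<close>

lemma ess_range_accumulates:
  assumes l: "l \<in> ess_range M h" and null: "AE y in M. complex_of_real (h y) \<noteq> l" and \<delta>: "\<delta> > 0"
  shows "\<exists>\<mu>\<in>ess_range M h. \<mu> \<noteq> l \<and> cmod (\<mu> - l) < \<delta>"
proof (rule ccontr)
  assume "\<not> ?thesis"
  then have "\<exists>e>0. AE y in M. e \<le> cmod (\<mu> - complex_of_real (h y))" if "\<mu> \<noteq> l" "cmod (\<mu> - l) < \<delta>" for \<mu>
    using that by (auto simp: ess_range_def)
  then obtain e where e: "\<And>\<mu>. \<mu> \<noteq> l \<Longrightarrow> cmod (\<mu> - l) < \<delta> \<Longrightarrow>
      e \<mu> > 0 \<and> (AE y in M. e \<mu> \<le> cmod (\<mu> - complex_of_real (h y)))"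
    by metis
  define U where "U = {\<mu>. \<mu> \<noteq> l \<and> cmod (\<mu> - l) < \<delta>}"
  obtain V where V: "V \<subseteq> (\<lambda>\<mu>. ball \<mu> (e \<mu>)) ` U" "countable V" "\<Union>V = (\<Union>\<mu>\<in>U. ball \<mu> (e \<mu>))"
    using Lindelof[of "(\<lambda>\<mu>. ball \<mu> (e \<mu>)) ` U"] by (metis (no_types, lifting) imageE open_ball)
  have "AE y in M. complex_of_real (h y) \<notin> S" if S: "S \<in> V" for S
  proof -
    obtain \<mu> where \<mu>: "\<mu> \<in> U" "S = ball \<mu> (e \<mu>)" using V(1) S by blast
    then have "AE y in M. e \<mu> \<le> cmod (\<mu> - complex_of_real (h y))" using e by (auto simp: U_def)
    then show ?thesis unfolding \<mu>(2) by eventually_elim (auto simp: dist_norm)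
  qed
  then have "AE y in M. \<forall>S\<in>V. complex_of_real (h y) \<notin> S"
    using V(2) by (simp add: AE_ball_countable)
  with null have "AE y in M. \<delta> \<le> cmod (l - complex_of_real (h y))"
  proof eventually_elim
    case (elim y)
    have "complex_of_real (h y) \<notin> U"
    proof
      assume y: "complex_of_real (h y) \<in> U"
      then have "complex_of_real (h y) \<in> \<Union>V" using V(3) e by (force simp: U_def)
      with elim show False by blast
    qed
    with elim show ?case by (auto simp: U_def norm_minus_commute)
  qed
  with l \<delta> show False by (auto simp: ess_range_def)
qed

section \<open>Finite-rank perturbations of an invertible operator\<close>

text \<open>The factorisation \<open>L = A (E - K)\<close> with \<open>A\<close> boundedly invertible and \<open>K\<close> of finite rank. It transfers
  the Fredholm alternative from \<open>E - K\<close> to \<open>L\<close>: the determinant of \<open>E - K\<close> vanishes exactly when \<open>L\<close>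
  fails to be injective, and otherwise \<open>L\<close> has a bounded inverse.\<close>

locale finite_rank_perturbation =
  fixes M :: "'a measure" and L A R K :: "('a \<Rightarrow> complex) \<Rightarrow> 'a \<Rightarrow> complex"
  assumes A: "bounded_op M A" and R: "is_inverse_op M A R" and L: "bounded_op M L"
    and K: "bounded_op M K" and rank: "\<exists>r u v. finite_rank_rep M K r u v"
    and factor: "\<And>f. f \<in> L2 M \<Longrightarrow> AE x in M. L f x = A (\<lambda>z. f z - K f z) x"
begin

lemma bR: "bounded_op M R"
  by (rule is_inverse_opD(1)[OF R])

lemma kernel_iff:
  assumes f: "f \<in> L2 M"
  shows "(AE x in M. L f x = 0) \<longleftrightarrow> (AE x in M. f x = K f x)"
proof
  have d: "(\<lambda>z. f z - K f z) \<in> L2 M" by (rule L2_diff[OF f bounded_op_L2[OF K f]])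
  {
    assume "AE x in M. L f x = 0"
    with factor[OF f] have "AE x in M. A (\<lambda>z. f z - K f z) x = 0"
      by eventually_elim simp
    from is_inverse_op_kernel[OF R A d this] show "AE x in M. f x = K f x"
      by simp
  next
    assume "AE x in M. f x = K f x"
    then have "AE x in M. f x - K f x = 0" by simp
    from bounded_op_zero[OF A d this] factor[OF f] show "AE x in M. L f x = 0"
      by eventually_elim simp
  }
qed

lemma inverse_exI:
  assumes "\<exists>S. is_inverse_op M (\<lambda>f z. f z - K f z) S"
  shows "\<exists>S. is_inverse_op M L S"
proof -
  obtain S where S: "is_inverse_op M (\<lambda>f z. f z - K f z) S" using assms by blast
  have b: "bounded_op M (\<lambda>f z. f z - K f z)" by (rule bounded_op_minus[OF bounded_op_id K])
  have "is_inverse_op M (\<lambda>f. A (\<lambda>z. f z - K f z)) (\<lambda>f. S (R f))"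
    by (rule is_inverse_op_comp[OF A b R S])
  then have "is_inverse_op M L (\<lambda>f. S (R f))"
    by (rule is_inverse_op_cong[OF _ bounded_op_comp[OF A b] L factor])
  then show ?thesis by blast
qed

lemma fredholm_det_neq_0_imp_inverse:
  assumes "fredholm_det M K \<noteq> 0"
  shows "\<exists>S. is_inverse_op M L S"
proof -
  obtain r u v where "finite_rank_rep M K r u v" "fredholm_det M K = gram_det M r u v"
    using fredholm_det_eq[OF rank] by blast
  with assms show ?thesis
    by (intro inverse_exI gram_det_neq_0_imp_inverse[OF _ _ K]) auto
qed

lemma fredholm_det_eq_0_imp_kernel:
  assumes "fredholm_det M K = 0"
  shows "\<exists>f\<in>L2 M. (AE x in M. L f x = 0) \<and> \<not> (AE x in M. f x = 0)"
proof -
  obtain r u v where "finite_rank_rep M K r u v" "fredholm_det M K = gram_det M r u v"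
    using fredholm_det_eq[OF rank] by blast
  then obtain f where "f \<in> L2 M" "AE x in M. f x = K f x" "\<not> (AE x in M. f x = 0)"
    using gram_det_eq_0_imp_fixed_vector assms by metis
  then show ?thesis using kernel_iff by blast
qed

lemma injective_imp_bounded_below:
  assumes inj: "\<And>f. f \<in> L2 M \<Longrightarrow> AE x in M. L f x = 0 \<Longrightarrow> AE x in M. f x = 0"
  obtains C where "C \<ge> 0" "\<And>f. f \<in> L2 M \<Longrightarrow> L2_norm M f \<le> C * L2_norm M (L f)"
proof -
  obtain r u v where "finite_rank_rep M K r u v" using rank by blast
  then have "\<exists>S. is_inverse_op M (\<lambda>f z. f z - K f z) S"
    using K inj kernel_iff by (intro injective_imp_inverse) blast+
  then obtain S where "is_inverse_op M L S" using inverse_exI by blast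
  then show ?thesis using is_inverse_op_bounded_below[OF _ L] that by blast
qed

lemma kernel_finite_dimensional:
  defines "F \<equiv> {f \<in> L2 M. AE x in M. L f x = 0}"
  shows "\<exists>B. finite B \<and> B \<subseteq> F \<and> (\<forall>f\<in>F. \<exists>\<alpha>. AE x in M. f x = (\<Sum>g\<in>B. \<alpha> g * g x))"
proof -
  obtain r u v where ruv: "finite_rank_rep M K r u v" using rank by blast
  show ?thesis
  proof (rule finite_spanning_subset[where v = v and r = r])
    fix f g c assume f: "f \<in> F" and g: "g \<in> F"
    then have fL: "f \<in> L2 M" and gL: "g \<in> L2 M" by (auto simp: F_def)
    have "AE x in M. L (\<lambda>z. f z - c * g z) x = 0"
      using bounded_op_diff[OF L fL L2_cmult[OF gL, of c]] bounded_op_cmult[OF L gL, of c] f g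
      unfolding F_def by (auto elim: eventually_elim2)
    then show "(\<lambda>z. f z - c * g z) \<in> F"
      using L2_diff[OF fL L2_cmult[OF gL]] by (simp add: F_def)
  next
    fix f assume f: "f \<in> F"
    then have fL: "f \<in> L2 M" and "AE x in M. L f x = 0" by (auto simp: F_def)
    then have "AE x in M. f x = K f x" using kernel_iff[OF fL] by blast
    with finite_rank_repD(3)[OF ruv fL] have "AE x in M. f x = (\<Sum>i<r. L2_inner M f (u i) * v i x)"
      by (auto elim: eventually_elim2)
    then show "\<exists>c. AE x in M. f x = (\<Sum>i<r. c i * v i x)"
      by (rule exI[of _ "\<lambda>i. L2_inner M f (u i)"])
  qed
qed

text \<open>\<open>A (E - K) + G = A (E - (K - A\<^sup>-\<^sup>1 G))\<close>, and \<open>A\<^sup>-\<^sup>1 G\<close> again has finite rank.\<close>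

lemma plus_finite_rank:
  assumes G: "bounded_op M G" and rG: "finite_rank_rep M G r u v"
  shows "finite_rank_perturbation M (\<lambda>f z. L f z + G f z) A R (\<lambda>f z. K f z + (-1) * R (G f) z)"
proof
  note RG = bounded_op_comp[OF bR G]
  show "bounded_op M (\<lambda>f z. L f z + G f z)" by (rule bounded_op_plus[OF L G])
  show "bounded_op M (\<lambda>f z. K f z + (-1) * R (G f) z)"
    by (rule bounded_op_plus[OF K bounded_op_scaled[OF RG]])
  have "finite_rank_rep M (\<lambda>f z. (-1) * R (G f) z) r u (\<lambda>i z. (-1) * R (v i) z)"
    by (rule finite_rank_rep_comp[OF rG bounded_op_scaled[OF bR] bounded_op_L2[OF G]])
  with rank show "\<exists>r u v. finite_rank_rep M (\<lambda>f z. K f z + (-1) * R (G f) z) r u v"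
    using finite_rank_rep_plus by blast
  fix f assume f: "f \<in> L2 M"
  note GL = bounded_op_L2[OF G f]
  note d = L2_diff[OF f bounded_op_L2[OF K f]] and RL = bounded_op_L2[OF bR GL]
  have "(\<lambda>z. f z - (K f z + (-1) * R (G f) z)) = (\<lambda>z. (f z - K f z) + R (G f) z)"
    by (simp add: fun_eq_iff)
  then show "AE x in M. L f x + G f x = A (\<lambda>z. f z - (K f z + (-1) * R (G f) z)) x"
    using factor[OF f] bounded_op_add[OF A d RL] is_inverse_opD(3)[OF R GL]
    by (auto elim!: eventually_elim2 eventually_mono[OF eventually_conj])
qed (rule A R)+

end

section \<open>Isolation of the eigenvalues of a symmetric operator\<close>

definition symmetric_op :: "'a measure \<Rightarrow> (('a \<Rightarrow> complex) \<Rightarrow> 'a \<Rightarrow> complex) \<Rightarrow> bool" where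
  "symmetric_op M T \<longleftrightarrow> (\<forall>f\<in>L2 M. \<forall>g\<in>L2 M. L2_inner M (T f) g = L2_inner M f (T g))"

lemma eigenspace_L2: "f \<in> eigenspace M T l \<Longrightarrow> f \<in> L2 M"
  by (simp add: eigenspace_def)

lemma eigenspace_inner_left:
  assumes T: "bounded_op M T" and f: "f \<in> eigenspace M T l" and g: "g \<in> L2 M"
  shows "L2_inner M (T f) g = l * L2_inner M f g"
proof -
  have fL: "f \<in> L2 M" and e: "AE x in M. T f x = l * f x" using f by (auto simp: eigenspace_def)
  have "L2_inner M (T f) g = L2_inner M (\<lambda>z. l * f z) g"
    by (rule L2_inner_cong[OF e AE_I2[OF refl]]) (intro bounded_op_L2[OF T fL] L2_cmult fL g)+
  then show ?thesis by (simp add: L2_inner_cmult_left)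
qed

lemma eigenvalue_real:
  assumes T: "bounded_op M T" and sym: "symmetric_op M T" and l: "is_eigenvalue M T l"
  shows "cnj l = l"
proof -
  obtain f where f: "f \<in> eigenspace M T l" and f0: "\<not> (AE x in M. f x = 0)"
    using l by (auto simp: is_eigenvalue_def)
  note fL = eigenspace_L2[OF f]
  have "l * L2_inner M f f = L2_inner M f (T f)"
    using eigenspace_inner_left[OF T f fL] sym fL by (simp add: symmetric_op_def)
  also have "\<dots> = cnj l * L2_inner M f f"
    using eigenspace_inner_left[OF T f fL] L2_inner_cnj[of M f "T f"] L2_inner_cnj[of M f f] by simp
  finally have "l * L2_inner M f f = cnj l * L2_inner M f f" .
  moreover have "L2_inner M f f \<noteq> 0"
    using f0 L2_norm_eq_0_iff[OF fL] by (simp add: L2_inner_self)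
  ultimately show ?thesis by simp
qed

lemma eigenspaces_orthogonal:
  assumes T: "bounded_op M T" and sym: "symmetric_op M T" and l: "is_eigenvalue M T l"
    and f: "f \<in> eigenspace M T \<mu>" and g: "g \<in> eigenspace M T l" and ne: "\<mu> \<noteq> l"
  shows "L2_inner M f g = 0"
proof -
  note fL = eigenspace_L2[OF f] and gL = eigenspace_L2[OF g]
  have "\<mu> * L2_inner M f g = L2_inner M f (T g)"
    using eigenspace_inner_left[OF T f gL] sym fL gL by (simp add: symmetric_op_def)
  also have "\<dots> = l * L2_inner M f g"
    using eigenspace_inner_left[OF T g fL] L2_inner_cnj[of M f "T g"] L2_inner_cnj[of M g f]
      eigenvalue_real[OF T sym l] by simp
  finally show ?thesis using ne by simp
qed

lemma eigenspace_iff_kernel: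
  assumes "\<tau> \<noteq> 0"
  shows "eigenspace M T (inverse \<tau>) = {f \<in> L2 M. AE x in M. f x - \<tau> * T f x = 0}"
proof -
  have "T f x = inverse \<tau> * f x \<longleftrightarrow> f x - \<tau> * T f x = 0" for f x
    using assms by (auto simp: field_simps)
  then show ?thesis by (simp add: eigenspace_def)
qed

text \<open>Let \<open>N\<close> be the eigenspace at \<open>\<lambda> = 1/\<tau>\<close>, spanned by a finite set \<open>B\<close>, and put
  \<open>G = \<Sum>\<^sub>b \<langle>\<cdot>, b\<rangle> b\<close>. By symmetry the range of \<open>E - \<tau> T\<close> is orthogonal to \<open>N\<close>, which contains the range
  of \<open>G\<close>; hence \<open>E - \<tau> T + G\<close> is injective, and being a finite-rank perturbation of an invertible
  operator it is bounded below. Eigenvectors \<open>f\<close> at another eigenvalue \<open>\<mu>\<close> are orthogonal to \<open>N\<close>, so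
  \<open>G f = 0\<close> and \<open>\<parallel>f\<parallel> \<le> C \<bar>1 - \<tau> \<mu>\<bar> \<parallel>f\<parallel>\<close>, which keeps \<open>\<mu>\<close> away from \<open>\<lambda>\<close>.\<close>

lemma eigenvalue_isolated_from_eigenvalues:
  assumes T: "bounded_op M T" and sym: "symmetric_op M T" and \<tau>: "\<tau> \<noteq> 0"
    and l: "is_eigenvalue M T (inverse \<tau>)"
    and frp: "finite_rank_perturbation M (\<lambda>f z. f z - \<tau> * T f z) A R K"
  shows "\<exists>\<delta>>0. \<forall>\<mu>. is_eigenvalue M T \<mu> \<longrightarrow> cmod (\<mu> - inverse \<tau>) < \<delta> \<longrightarrow> \<mu> = inverse \<tau>"
proof -
  interpret finite_rank_perturbation M "\<lambda>f z. f z - \<tau> * T f z" A R K by (rule frp)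
  let ?N = "eigenspace M T (inverse \<tau>)"
  obtain B where B: "finite B" "B \<subseteq> ?N"
    and span: "\<And>f. f \<in> ?N \<Longrightarrow> \<exists>\<alpha>. AE x in M. f x = (\<Sum>g\<in>B. \<alpha> g * g x)"
    using kernel_finite_dimensional unfolding eigenspace_iff_kernel[OF \<tau>] by blast
  have BL: "b \<in> B \<Longrightarrow> b \<in> L2 M" for b using B(2) eigenspace_L2 by blast
  define G where "G f z = (\<Sum>b\<in>B. L2_inner M f b * b z)" for f z
  have bG: "bounded_op M G"
    unfolding G_def[abs_def] by (rule bounded_op_finite_rank) (auto intro: BL)
  obtain r u v where "finite_rank_rep M G r u v"
    using finite_rank_rep_exI[OF B(1), of "\<lambda>b. b" M "\<lambda>b. b" G] BL by (auto simp: G_def)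
  then interpret G: finite_rank_perturbation M "\<lambda>f z. f z - \<tau> * T f z + G f z" A R "\<lambda>f z. K f z + (-1) * R (G f) z"
    by (rule plus_finite_rank[OF bG])
  have perp: "L2_inner M (\<lambda>z. f z - \<tau> * T f z) g = 0" if f: "f \<in> L2 M" and g: "g \<in> ?N" for f g
  proof -
    note gL = eigenspace_L2[OF g]
    have "L2_inner M (T f) g = cnj (inverse \<tau> * L2_inner M g f)"
      using sym f gL eigenspace_inner_left[OF T g f] L2_inner_cnj[of M f "T g"]
      by (simp add: symmetric_op_def)
    also have "\<dots> = inverse \<tau> * L2_inner M f g"
      using eigenvalue_real[OF T sym l] L2_inner_cnj[of M f g] by simp
    finally show ?thesis
      using \<tau> f gL bounded_op_L2[OF T f] by (simp add: L2_inner_diff_left L2_cmult L2_inner_cmult_left)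
  qed
  have G_eigen: "G f \<in> L2 M \<and> L2_inner M k (G f) = 0"
    if "f \<in> L2 M" "k \<in> L2 M" "\<And>b. b \<in> B \<Longrightarrow> L2_inner M k b = 0" for f k
    using that bounded_op_L2[OF bG] unfolding G_def[abs_def]
    by (simp add: L2_inner_sum_right L2_cmult BL L2_inner_cmult_right)
  have "AE x in M. f x = 0"
    if f: "f \<in> L2 M" and 0: "AE x in M. f x - \<tau> * T f x + G f x = 0" for f
  proof -
    let ?L = "\<lambda>z. f z - \<tau> * T f z"
    have LL: "?L \<in> L2 M" by (rule bounded_op_L2[OF L f])
    have GL: "G f \<in> L2 M" by (rule bounded_op_L2[OF bG f])
    have "L2_inner M ?L (G f) = 0"
      using G_eigen[OF f LL] perp[OF f] B(2) by blast
    moreover have "L2_inner M (\<lambda>z. ?L z + G f z) (G f) = 0"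
      by (rule L2_inner_zero_AE[OF 0])
    ultimately have "L2_inner M (G f) (G f) = 0"
      by (simp add: L2_inner_add_left LL GL)
    then have G0: "AE x in M. G f x = 0"
      using L2_norm_eq_0_iff[OF GL] by (simp add: L2_inner_self)
    then have "AE x in M. f x - \<tau> * T f x = 0"
      using 0 by eventually_elim simp
    then have fN: "f \<in> ?N" using f by (simp add: eigenspace_iff_kernel[OF \<tau>])
    have conj_inner: "cnj (L2_inner M f b) = L2_inner M b f" for b
      by (rule L2_inner_cnj[symmetric])
    have "(\<Sum>b\<in>B. L2_inner M f b * L2_inner M b f) = L2_inner M (G f) f"
      unfolding G_def[abs_def] by (simp add: L2_inner_sum_left L2_cmult BL f L2_inner_cmult_left)
    also have "\<dots> = 0" by (rule L2_inner_zero_AE[OF G0])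
    finally have "complex_of_real (\<Sum>b\<in>B. (cmod (L2_inner M f b))\<^sup>2) = 0"
      unfolding of_real_sum complex_norm_square conj_inner .
    then have "(\<Sum>b\<in>B. (cmod (L2_inner M f b))\<^sup>2) = 0"
      by (simp only: of_real_eq_0_iff)
    then have fb: "\<And>b. b \<in> B \<Longrightarrow> L2_inner M f b = 0"
      using B(1) by (simp add: sum_nonneg_eq_0_iff)
    obtain \<alpha> where \<alpha>: "AE x in M. f x = (\<Sum>g\<in>B. \<alpha> g * g x)" using span[OF fN] by blast
    have "L2_inner M f f = L2_inner M f (\<lambda>x. \<Sum>g\<in>B. \<alpha> g * g x)"
      by (rule L2_inner_cong[OF AE_I2[OF refl] \<alpha>]) (intro f L2_sum L2_cmult BL | assumption)+
    also have "\<dots> = 0"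
      by (simp add: L2_inner_sum_right L2_cmult BL f L2_inner_cmult_right fb)
    finally show ?thesis
      using L2_norm_eq_0_iff[OF f] by (simp add: L2_inner_self)
  qed
  then obtain C where C: "C \<ge> 0"
    "\<And>f. f \<in> L2 M \<Longrightarrow> L2_norm M f \<le> C * L2_norm M (\<lambda>z. f z - \<tau> * T f z + G f z)"
    using G.injective_imp_bounded_below by blast
  \<comment> \<open>An eigenvector \<open>f\<close> at \<open>\<mu>\<close> satisfies \<open>\<parallel>f\<parallel> \<le> C \<bar>\<tau>\<bar> \<bar>\<mu> - 1/\<tau>\<bar> \<parallel>f\<parallel>\<close> unless \<open>\<mu> = 1/\<tau>\<close>; below this radius the
    factor is less than \<open>1\<close>.\<close>
  define \<delta> where "\<delta> = 1 / (C * cmod \<tau> + 1)"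
  have pos: "C * cmod \<tau> + 1 > 0" using C(1) by (simp add: add_nonneg_pos)
  then have "\<delta> > 0" by (simp add: \<delta>_def)
  moreover have "\<mu> = inverse \<tau>" if \<mu>: "is_eigenvalue M T \<mu>" and near: "cmod (\<mu> - inverse \<tau>) < \<delta>" for \<mu>
  proof (rule ccontr)
    assume ne: "\<mu> \<noteq> inverse \<tau>"
    obtain f where f: "f \<in> eigenspace M T \<mu>" and f0: "\<not> (AE x in M. f x = 0)"
      using \<mu> by (auto simp: is_eigenvalue_def)
    note fL = eigenspace_L2[OF f]
    have Gf: "G f z = 0" for z
      unfolding G_def using eigenspaces_orthogonal[OF T sym l f _ ne] B(2)
      by (intro sum.neutral) auto
    have e: "AE x in M. f x - \<tau> * T f x + G f x = (1 - \<tau> * \<mu>) * f x"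
    proof -
      have "AE x in M. T f x = \<mu> * f x" using f by (simp add: eigenspace_def)
      then show ?thesis by eventually_elim (simp add: Gf algebra_simps)
    qed
    have "L2_norm M f \<le> C * (cmod (1 - \<tau> * \<mu>) * L2_norm M f)"
      using C(2)[OF fL] L2_norm_cong[OF e bounded_op_L2[OF G.L fL] L2_cmult[OF fL]]
      by (simp add: L2_norm_cmult)
    moreover have nf: "L2_norm M f > 0"
      using f0 L2_norm_eq_0_iff[OF fL] L2_norm_nonneg[of M f] by linarith
    ultimately have "1 \<le> C * cmod (1 - \<tau> * \<mu>)"
      by (simp add: mult.assoc[symmetric])
    moreover have "cmod (1 - \<tau> * \<mu>) = cmod \<tau> * cmod (\<mu> - inverse \<tau>)"
    proof -
      have "1 - \<tau> * \<mu> = - (\<tau> * (\<mu> - inverse \<tau>))" using \<tau> by (simp add: algebra_simps)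
      then show ?thesis by (simp only: norm_minus_cancel norm_mult)
    qed
    ultimately have "1 \<le> C * cmod \<tau> * cmod (\<mu> - inverse \<tau>)" by (simp add: mult.assoc)
    also have "\<dots> \<le> C * cmod \<tau> * \<delta>"
      using near C(1) by (intro mult_left_mono) auto
    also have "\<dots> < 1" using pos by (simp add: \<delta>_def)
    finally show False by simp
  qed
  ultimately show ?thesis by blast
qed

section \<open>The sum of two partial integral operators\<close>

locale two_operators = partial_integral M1 M2 n \<phi> h + W: partial_integral M2 M1 m \<psi> p
  for M1 M2 :: "real measure" and n :: nat and \<phi> :: "nat \<Rightarrow> real \<Rightarrow> complex" and h :: "nat \<Rightarrow> real \<Rightarrow> real"
    and m :: nat and \<psi> :: "nat \<Rightarrow> real \<Rightarrow> complex" and p :: "nat \<Rightarrow> real \<Rightarrow> real" +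
  assumes nonatomic1: "nonatomic M1" and nonatomic2: "nonatomic M2"
    and space1: "measure M1 (space M1) > 0" and space2: "measure M2 (space M2) > 0"
begin

abbreviation T\<^sub>2 where "T\<^sub>2 \<equiv> T2_op M2 m \<psi> p"
abbreviation Tsum where "Tsum \<equiv> \<lambda>f z. T f z + T\<^sub>2 f z"

lemma bounded_op_T2: "bounded_op M T\<^sub>2"
  unfolding T2_op_eq_swap_op by (rule W.bounded_op_swap[OF W.bounded_op_T])

lemma bounded_op_Tsum: "bounded_op M Tsum"
  by (rule bounded_op_plus[OF bounded_op_T bounded_op_T2])

lemma symmetric_Tsum: "symmetric_op M Tsum"
  unfolding symmetric_op_def
proof (intro ballI)
  fix f g assume f: "f \<in> L2 M" and g: "g \<in> L2 M"
  note L = bounded_op_L2[OF bounded_op_T] bounded_op_L2[OF bounded_op_T2]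
  have e: "T\<^sub>2 k = W.T (k \<circ> prod.swap) \<circ> prod.swap" for k
    by (simp add: T2_op_eq_swap_op swap_op_def fun_eq_iff)
  note f' = L2_swap(1)[OF f] and g' = L2_swap(1)[OF g]
  note WL = bounded_op_L2[OF W.bounded_op_T]
  have "L2_inner M (T\<^sub>2 f) g = L2_inner M' (T\<^sub>2 f \<circ> prod.swap) (g \<circ> prod.swap)"
    by (rule L2_inner_swap[symmetric]) (rule L f g)+
  also have "\<dots> = L2_inner M' (W.T (f \<circ> prod.swap)) (g \<circ> prod.swap)"
    by (simp only: e comp_swap_swap)
  also have "\<dots> = L2_inner M' (f \<circ> prod.swap) (W.T (g \<circ> prod.swap))"
    by (rule W.T_symmetric[OF f' g'])
  also have "\<dots> = L2_inner M' (f \<circ> prod.swap) (T\<^sub>2 g \<circ> prod.swap)"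
    by (simp only: e comp_swap_swap)
  also have "\<dots> = L2_inner M f (T\<^sub>2 g)"
    by (rule L2_inner_swap) (rule L f g)+
  finally show "L2_inner M (Tsum f) g = L2_inner M f (Tsum g)"
    by (simp add: L2_inner_add_left L2_inner_add_right L f g T_symmetric)
qed

lemma T2_tensor_orthogonal:
  assumes u: "u \<in> L2 M1" and g: "g \<in> L2 M2" and orth: "\<And>j. j \<in> {1..m} \<Longrightarrow> L2_inner M2 g (\<psi> j) = 0"
  shows "AE z in M. T\<^sub>2 (tensor u g) z = 0"
proof -
  have e: "tensor u g \<circ> prod.swap = tensor g u"
    by (auto simp: fun_eq_iff)
  show ?thesis
    using AE_swap'[OF W.T_tensor_orthogonal[OF g u orth]]
    by (simp add: T2_op_eq_swap_op swap_op_def e)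
qed

text \<open>On the functions \<open>\<phi>\<^sub>k(x) g(y)\<close> with \<open>g\<close> orthogonal to all \<open>\<psi>\<^sub>j\<close> the operator \<open>T\<^sub>2\<close> vanishes, and
  \<open>T\<^sub>1 + T\<^sub>2\<close> is multiplication of \<open>g\<close> by \<open>h\<^sub>k\<close>. This subspace is where the essential range of \<open>h\<^sub>k\<close>
  becomes visible in the spectrum.\<close>

lemma Tsum_tensor_phi:
  assumes k: "k \<in> {1..n}" and g: "g \<in> L2 M2" and orth: "\<And>j. j \<in> {1..m} \<Longrightarrow> L2_inner M2 g (\<psi> j) = 0"
  shows "AE z in M. Tsum (tensor (\<phi> k) g) z = tensor (\<phi> k) (\<lambda>y. hc k y * g y) z"
proof -
  have "AE z in M. T\<^sub>2 (tensor (\<phi> k) g) z = 0"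
    by (rule T2_tensor_orthogonal[OF phi_L2[OF k] g orth])
  with T_tensor_phi[OF k g] show ?thesis by eventually_elim simp
qed

text \<open>The tensor \<open>\<phi>\<^sub>k \<otimes> g\<close> is an approximate eigenvector when \<open>g\<close> is supported where \<open>h\<^sub>k\<close> is close to
  \<open>l\<close>. The hypothesis on \<open>B\<close> holds for \<open>T\<^sub>1\<close> and for \<open>T\<^sub>1 + T\<^sub>2\<close> alike.\<close>

lemma ess_range_approximate_eigenvalue:
  assumes B: "bounded_op M B"
    and B_tensor: "\<And>g. g \<in> L2 M2 \<Longrightarrow> (\<And>j. j \<in> {1..m} \<Longrightarrow> L2_inner M2 g (\<psi> j) = 0) \<Longrightarrow>
      AE z in M. B (tensor (\<phi> k) g) z = tensor (\<phi> k) (\<lambda>y. hc k y * g y) z"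
    and k: "k \<in> {1..n}" and l: "l \<in> ess_range M2 (h k)"
  shows "l \<notin> resolvent_set M B"
proof (rule approximate_eigenvalue_not_resolvent[OF B])
  fix \<epsilon> :: real assume \<epsilon>: "\<epsilon> > 0"
  have [measurable]: "hc k \<in> borel_measurable M2" by (rule hc_measurable[OF k])
  define A where "A = {y \<in> space M2. cmod (l - hc k y) < \<epsilon>}"
  have A: "A \<in> sets M2" unfolding A_def by measurable
  have "\<not> (AE y in M2. y \<notin> A)"
  proof
    assume "AE y in M2. y \<notin> A"
    then have "AE y in M2. \<epsilon> \<le> cmod (l - hc k y)"
      using AE_space by eventually_elim (auto simp: A_def)
    then show False using l \<epsilon> by (auto simp: ess_range_def)
  qed
  then have mA: "measure M2 A > 0"
    by (rule M2.measure_pos_of_not_AE[OF A])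
  have "\<psi> ` {1..m} \<subseteq> L2 M2" using W.phi_L2 by blast
  then obtain g where g: "g \<in> L2 M2" and supp: "\<forall>y. y \<notin> A \<longrightarrow> g y = 0"
    and orth: "\<forall>w\<in>\<psi> ` {1..m}. L2_inner M2 g w = 0" and g0: "\<not> (AE y in M2. g y = 0)"
    using M2.nonatomic_orthogonal_function[OF nonatomic2 A mA, of "\<psi> ` {1..m}"] by blast
  let ?f = "tensor (\<phi> k) g"
  note fL = tensor_L2[OF phi_L2[OF k] g]
  have \<phi>1: "L2_norm M1 (\<phi> k) = 1"
    using phi_inner[OF k k] L2_norm_nonneg[of M1 "\<phi> k"]
    by (simp add: L2_inner_self) (metis of_real_eq_1_iff of_real_power power2_eq_1_iff not_one_le_zero neg_0_le_iff_le)
  have ng: "L2_norm M2 g > 0"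
    using g0 L2_norm_eq_0_iff[OF g] L2_norm_nonneg[of M2 g] by linarith
  let ?d = "\<lambda>y. (l - hc k y) * g y"
  have dle: "(cmod (?d y))\<^sup>2 \<le> \<epsilon>\<^sup>2 * (cmod (g y))\<^sup>2" for y
  proof (cases "y \<in> A")
    case True
    then have "cmod (l - hc k y) \<le> \<epsilon>" by (simp add: A_def)
    then show ?thesis by (auto simp: norm_mult power_mult_distrib intro!: mult_right_mono power_mono)
  qed (use supp in simp)
  have int: "integrable M2 (\<lambda>y. \<epsilon>\<^sup>2 * (cmod (g y))\<^sup>2)"
    using L2_square_integrable[OF g] by simp
  have dL: "?d \<in> L2 M2"
  proof (rule L2_dominated[OF _ int])
    show "?d \<in> borel_measurable M2" using L2_measurable[OF g] by measurable
  qed (use dle in simp)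
  have "(L2_norm M2 ?d)\<^sup>2 \<le> (LINT y|M2. \<epsilon>\<^sup>2 * (cmod (g y))\<^sup>2)"
    unfolding L2_norm_square
    by (rule integral_mono[OF L2_square_integrable[OF dL] int dle])
  also have "\<dots> = (\<epsilon> * L2_norm M2 g)\<^sup>2"
    by (simp add: L2_norm_square power_mult_distrib)
  finally have dn: "L2_norm M2 ?d \<le> \<epsilon> * L2_norm M2 g"
    by (rule power2_le_imp_le) (use \<epsilon> ng in simp)
  have "AE z in M. l * ?f z - B ?f z = tensor (\<phi> k) ?d z"
    using B_tensor[OF g] orth
    by (auto elim!: eventually_mono simp: tensor_def algebra_simps)
  then have "L2_norm M (\<lambda>z. l * ?f z - B ?f z) = L2_norm M (tensor (\<phi> k) ?d)"
    by (rule L2_norm_cong)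
      (rule L2_diff[OF L2_cmult[OF fL] bounded_op_L2[OF B fL]] tensor_L2[OF phi_L2[OF k] dL])+
  then show "\<exists>f\<in>L2 M. L2_norm M f > 0 \<and> L2_norm M (\<lambda>z. l * f z - B f z) \<le> \<epsilon> * L2_norm M f"
    using fL dn ng by (intro bexI[OF _ fL])
      (simp add: tensor_L2_norm(2)[OF phi_L2[OF k] g] tensor_L2_norm(2)[OF phi_L2[OF k] dL] \<phi>1)
qed

lemma resolvent_set_T: "l \<noteq> 0 \<Longrightarrow> l \<in> resolvent_set M T \<longleftrightarrow> (\<forall>k\<in>{1..n}. l \<notin> ess_range M2 (h k))"
  using not_ess_range_imp_resolvent ess_range_approximate_eigenvalue[OF bounded_op_T T_tensor_phi] by blast

lemma ess_range_subset_spectrum: "k \<in> {1..n} \<Longrightarrow> ess_range M2 (h k) \<subseteq> spectrum M Tsum"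
  using ess_range_approximate_eigenvalue[OF bounded_op_Tsum Tsum_tensor_phi]
  by (auto simp: spectrum_def)

text \<open>Given a finite set \<open>B\<close> spanning the eigenspace, choose \<open>g \<noteq> 0\<close> supported in \<open>A\<close>, orthogonal to the
  \<open>\<psi>\<^sub>j\<close> and to the partial inner products of all \<open>b \<in> B\<close> with \<open>u\<close>. Then \<open>u \<otimes> g\<close> is a nonzero
  eigenvector orthogonal to the span of \<open>B\<close>.\<close>

lemma infinite_multiplicity:
  assumes u: "u \<in> L2 M1" and u0: "\<not> (AE x in M1. u x = 0)"
    and A: "A \<in> sets M2" "measure M2 A > 0"
    and eig: "\<And>g. g \<in> L2 M2 \<Longrightarrow> (\<And>y. y \<notin> A \<Longrightarrow> g y = 0) \<Longrightarrow>
      (\<And>j. j \<in> {1..m} \<Longrightarrow> L2_inner M2 g (\<psi> j) = 0) \<Longrightarrow> AE z in M. Tsum (tensor u g) z = l * tensor u g z"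
  shows "\<not> finite_multiplicity M Tsum l"
proof
  assume "finite_multiplicity M Tsum l"
  then obtain B where B: "finite B" "B \<subseteq> eigenspace M Tsum l"
    and span: "\<And>f. f \<in> eigenspace M Tsum l \<Longrightarrow> \<exists>\<alpha>. AE x in M. f x = (\<Sum>g\<in>B. \<alpha> g * g x)"
    unfolding finite_multiplicity_def by blast
  have BL: "b \<in> B \<Longrightarrow> b \<in> L2 M" for b using B(2) eigenspace_L2 by blast
  let ?W = "\<psi> ` {1..m} \<union> partial_inner M1 u ` B"
  have "?W \<subseteq> L2 M2" using W.phi_L2 partial_inner_L2[OF u BL] by blast
  then obtain g where g: "g \<in> L2 M2" and supp: "\<forall>y. y \<notin> A \<longrightarrow> g y = 0"
    and orth: "\<forall>w\<in>?W. L2_inner M2 g w = 0" and g0: "\<not> (AE y in M2. g y = 0)"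
    using M2.nonatomic_orthogonal_function[OF nonatomic2 A, of ?W] B(1) by blast
  let ?f = "tensor u g"
  note fL = tensor_L2[OF u g]
  have "?f \<in> eigenspace M Tsum l"
    using fL eig[OF g] supp orth by (simp add: eigenspace_def)
  then obtain \<alpha> where \<alpha>: "AE z in M. ?f z = (\<Sum>b\<in>B. \<alpha> b * b z)" using span by blast
  have fb: "L2_inner M ?f b = 0" if "b \<in> B" for b
  proof -
    have "L2_inner M b ?f = L2_inner M2 (partial_inner M1 u b) g"
      by (rule inner_tensor[OF u g BL[OF that]])
    also have "\<dots> = 0" using orth that by (subst L2_inner_cnj) simp
    finally show ?thesis by (subst L2_inner_cnj) simp
  qed
  have "L2_inner M ?f ?f = L2_inner M ?f (\<lambda>z. \<Sum>b\<in>B. \<alpha> b * b z)"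
    by (rule L2_inner_cong[OF AE_I2[OF refl] \<alpha>]) (intro fL L2_sum L2_cmult BL | assumption)+
  also have "\<dots> = 0"
    by (simp add: L2_inner_sum_right L2_cmult BL fL L2_inner_cmult_right fb)
  finally have "L2_norm M1 u * L2_norm M2 g = 0"
    by (simp add: L2_inner_self tensor_L2_norm(2)[OF u g])
  then show False
    using u0 g0 L2_norm_eq_0_iff[OF u] L2_norm_eq_0_iff[OF g] by auto
qed

text \<open>\<open>T\<^sub>1\<close> and \<open>T\<^sub>2\<close> both vanish on \<open>u \<otimes> g\<close> when \<open>u\<close> is orthogonal to all \<open>\<phi>\<^sub>k\<close> and \<open>g\<close> to all \<open>\<psi>\<^sub>j\<close>.\<close>

lemma zero_not_discrete: "0 \<notin> discrete_spectrum M Tsum"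
proof -
  have "\<phi> ` {1..n} \<subseteq> L2 M1" using phi_L2 by blast
  then obtain u where u: "u \<in> L2 M1" "\<forall>w\<in>\<phi> ` {1..n}. L2_inner M1 u w = 0" "\<not> (AE x in M1. u x = 0)"
    using M1.nonatomic_orthogonal_function[OF nonatomic1 sets.top space1, of "\<phi> ` {1..n}"] by blast
  have "\<not> finite_multiplicity M Tsum 0"
  proof (rule infinite_multiplicity[OF u(1,3) sets.top space2])
    fix g assume g: "g \<in> L2 M2" and orth: "\<And>j. j \<in> {1..m} \<Longrightarrow> L2_inner M2 g (\<psi> j) = 0"
    have "AE z in M. T (tensor u g) z = 0"
      by (rule T_tensor_orthogonal[OF u(1) g]) (use u(2) in simp)
    moreover have "AE z in M. T\<^sub>2 (tensor u g) z = 0"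
      by (rule T2_tensor_orthogonal[OF u(1) g orth])
    ultimately show "AE z in M. Tsum (tensor u g) z = 0 * tensor u g z"
      by eventually_elim simp
  qed
  then show ?thesis by (simp add: discrete_spectrum_def)
qed

text \<open>There are two ways in which \<open>l\<close> can lie in the essential range of \<open>h\<^sub>k\<close>. If \<open>h\<^sub>k = l\<close> on a set of
  positive measure, \<open>l\<close> is an eigenvalue of infinite multiplicity; otherwise \<open>l\<close> is a limit of other
  points of the essential range, all of which belong to the spectrum. Either way \<open>l\<close> is not in the
  discrete spectrum.\<close>

lemma discrete_not_ess_range:
  assumes l: "l \<in> discrete_spectrum M Tsum" and k: "k \<in> {1..n}"
  shows "l \<notin> ess_range M2 (h k)"
proof
  assume ess: "l \<in> ess_range M2 (h k)"
  have [measurable]: "hc k \<in> borel_measurable M2" by (rule hc_measurable[OF k])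
  show False
  proof (cases "AE y in M2. hc k y \<noteq> l")
    case True
    obtain e where e: "e > 0" "\<And>\<mu>. \<mu> \<in> spectrum M Tsum \<Longrightarrow> dist l \<mu> < e \<Longrightarrow> \<mu> = l"
      using l by (auto simp: discrete_spectrum_def isolated_in_dist_Ex_iff)
    obtain \<mu> where "\<mu> \<in> ess_range M2 (h k)" "\<mu> \<noteq> l" "cmod (\<mu> - l) < e"
      using ess_range_accumulates[OF ess True e(1)] by blast
    with e(2)[of \<mu>] ess_range_subset_spectrum[OF k] show False
      by (auto simp: dist_norm norm_minus_commute)
  next
    case False
    define A where "A = {y \<in> space M2. hc k y = l}"
    have A: "A \<in> sets M2" unfolding A_def by measurable
    have "\<not> (AE y in M2. y \<notin> A)"
    proof
      assume "AE y in M2. y \<notin> A"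
      then have "AE y in M2. hc k y \<noteq> l"
        using AE_space by eventually_elim (auto simp: A_def)
      with False show False by blast
    qed
    then have mA: "measure M2 A > 0"
      by (rule M2.measure_pos_of_not_AE[OF A])
    have \<phi>0: "\<not> (AE x in M1. \<phi> k x = 0)"
    proof
      assume "AE x in M1. \<phi> k x = 0"
      then have "L2_inner M1 (\<phi> k) (\<phi> k) = 0" by (rule L2_inner_zero_AE)
      with phi_inner[OF k k] show False by simp
    qed
    have "\<not> finite_multiplicity M Tsum l"
    proof (rule infinite_multiplicity[OF phi_L2[OF k] \<phi>0 A mA])
      fix g assume g: "g \<in> L2 M2" and supp: "\<And>y. y \<notin> A \<Longrightarrow> g y = 0"
        and orth: "\<And>j. j \<in> {1..m} \<Longrightarrow> L2_inner M2 g (\<psi> j) = 0"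
      have "hc k y * g y = l * g y" for y
        using supp[of y] by (cases "y \<in> A") (auto simp: A_def)
      then have "tensor (\<phi> k) (\<lambda>y. hc k y * g y) = (\<lambda>z. l * tensor (\<phi> k) g z)"
        by (simp add: tensor_def fun_eq_iff)
      with Tsum_tensor_phi[OF k g orth] show "AE z in M. Tsum (tensor (\<phi> k) g) z = l * tensor (\<phi> k) g z"
        by simp
    qed
    with l show False by (simp add: discrete_spectrum_def)
  qed
qed

lemma swapped: "two_operators M2 M1 m \<psi> p n \<phi> h"
  by unfold_locales (rule nonatomic1 nonatomic2 space1 space2)+

lemma swap_Tsum: "swap_op Tsum = (\<lambda>f z. T1_op M2 m \<psi> p f z + T2_op M1 n \<phi> h f z)"
proof -
  have "swap_op (\<lambda>f z. T f z + T\<^sub>2 f z) = (\<lambda>f z. swap_op T f z + swap_op T\<^sub>2 f z)"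
    by (simp add: swap_op_def fun_eq_iff)
  then show ?thesis by (simp add: T2_op_eq_swap_op add.commute)
qed

lemma resolvent_set_T2: "l \<noteq> 0 \<Longrightarrow> l \<in> resolvent_set M T\<^sub>2 \<longleftrightarrow> (\<forall>j\<in>{1..m}. l \<notin> ess_range M1 (p j))"
proof -
  interpret S: two_operators M2 M1 m \<psi> p n \<phi> h by (rule swapped)
  show "l \<noteq> 0 \<Longrightarrow> l \<in> resolvent_set M T\<^sub>2 \<longleftrightarrow> (\<forall>j\<in>{1..m}. l \<notin> ess_range M1 (p j))"
    unfolding T2_op_eq_swap_op W.resolvent_set_swap by (rule S.resolvent_set_T)
qed

lemma discrete_imp_resolvent:
  assumes l: "l \<in> discrete_spectrum M Tsum"
  shows "l \<noteq> 0" and "l \<in> resolvent_set M T" and "l \<in> resolvent_set M T\<^sub>2"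
proof -
  interpret S: two_operators M2 M1 m \<psi> p n \<phi> h by (rule swapped)
  show l0: "l \<noteq> 0" using l zero_not_discrete by blast
  show "l \<in> resolvent_set M T"
    using resolvent_set_T[OF l0] discrete_not_ess_range[OF l] by blast
  have "l \<in> discrete_spectrum M' (\<lambda>f z. T1_op M2 m \<psi> p f z + T2_op M1 n \<phi> h f z)"
    using discrete_spectrum_swap[OF l] unfolding swap_Tsum .
  then show "l \<in> resolvent_set M T\<^sub>2"
    using resolvent_set_T2[OF l0] S.discrete_not_ess_range by blast
qed

text \<open>Openness is read off from the description of the resolvent sets by essential ranges: a distance
  \<open>\<epsilon>\<close> of \<open>l\<close> from the values of \<open>h\<^sub>k\<close> leaves the distance \<open>\<epsilon>/2\<close> for every \<open>\<mu>\<close> with \<open>\<bar>\<mu> - l\<bar> < \<epsilon>/2\<close>.\<close>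

lemma resolvent_sets_open:
  assumes "l \<noteq> 0" and "l \<in> resolvent_set M T" and "l \<in> resolvent_set M T\<^sub>2"
  shows "\<exists>\<epsilon>>0. \<forall>\<mu>. cmod (\<mu> - l) < \<epsilon> \<longrightarrow> \<mu> \<noteq> 0 \<and> \<mu> \<in> resolvent_set M T \<and> \<mu> \<in> resolvent_set M T\<^sub>2"
proof -
  obtain \<epsilon>1 where \<epsilon>1: "\<epsilon>1 > 0" "\<And>k. k \<in> {1..n} \<Longrightarrow> AE y in M2. \<epsilon>1 \<le> cmod (l - hc k y)"
    using gap_open assms(2) resolvent_set_T[OF assms(1)] by blast
  obtain \<epsilon>2 where \<epsilon>2: "\<epsilon>2 > 0" "\<And>j. j \<in> {1..m} \<Longrightarrow> AE x in M1. \<epsilon>2 \<le> cmod (l - complex_of_real (p j x))"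
    using W.gap_open assms(3) resolvent_set_T2[OF assms(1)] by blast
  define \<epsilon> where "\<epsilon> = min (cmod l) (min (\<epsilon>1 / 2) (\<epsilon>2 / 2))"
  have "\<epsilon> > 0" using assms(1) \<epsilon>1(1) \<epsilon>2(1) by (simp add: \<epsilon>_def)
  moreover have "\<mu> \<noteq> 0 \<and> \<mu> \<in> resolvent_set M T \<and> \<mu> \<in> resolvent_set M T\<^sub>2" if \<mu>: "cmod (\<mu> - l) < \<epsilon>" for \<mu>
  proof -
    have \<mu>0: "\<mu> \<noteq> 0" using \<mu> by (auto simp: \<epsilon>_def)
    have tri: "cmod (l - x) \<le> cmod (\<mu> - l) + cmod (\<mu> - x)" for x
      using norm_triangle_ineq[of "l - \<mu>" "\<mu> - x"] by (simp add: norm_minus_commute)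
    have "\<mu> \<notin> ess_range M2 (h k)" if k: "k \<in> {1..n}" for k
    proof -
      have "AE y in M2. \<epsilon>1 / 2 \<le> cmod (\<mu> - hc k y)"
        using \<epsilon>1(2)[OF k]
      proof eventually_elim
        case (elim y)
        have "cmod (\<mu> - l) < \<epsilon>1 / 2" using \<mu> by (simp add: \<epsilon>_def)
        with elim tri[of "hc k y"] show ?case by linarith
      qed
      then show ?thesis using \<epsilon>1(1) by (auto simp: ess_range_def intro!: exI[of _ "\<epsilon>1 / 2"])
    qed
    moreover have "\<mu> \<notin> ess_range M1 (p j)" if j: "j \<in> {1..m}" for j
    proof -
      have "AE x in M1. \<epsilon>2 / 2 \<le> cmod (\<mu> - complex_of_real (p j x))"
        using \<epsilon>2(2)[OF j]
      proof eventually_elim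
        case (elim x)
        have "cmod (\<mu> - l) < \<epsilon>2 / 2" using \<mu> by (simp add: \<epsilon>_def)
        with elim tri[of "complex_of_real (p j x)"] show ?case by linarith
      qed
      then show ?thesis using \<epsilon>2(1) by (auto simp: ess_range_def intro!: exI[of _ "\<epsilon>2 / 2"])
    qed
    ultimately show ?thesis using \<mu>0 resolvent_set_T[OF \<mu>0] resolvent_set_T2[OF \<mu>0] by blast
  qed
  ultimately show ?thesis by blast
qed

text \<open>The kernel of \<open>S\<^sub>1 T\<^sub>2\<close> separates: with \<open>q\<^sub>k = h\<^sub>k / (1 - \<tau> h\<^sub>k)\<close>,
  \<open>S\<^sub>1 T\<^sub>2 f = \<Sum>\<^sub>k\<^sub>j \<langle>f, (p\<^sub>j \<phi>\<^sub>k) \<otimes> \<psi>\<^sub>j\<rangle> \<phi>\<^sub>k \<otimes> (q\<^sub>k \<psi>\<^sub>j)\<close>.\<close>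

lemma S1_T2_finite_rank:
  assumes S: "bounded_op M (S1_op M1 n \<phi> h \<tau>)"
    and qb: "\<And>k. k \<in> {1..n} \<Longrightarrow> ess_bounded_mult M2 (\<lambda>y. hc k y / (1 - \<tau> * hc k y))"
  shows "\<exists>r u v. finite_rank_rep M (\<lambda>f. S1_op M1 n \<phi> h \<tau> (T\<^sub>2 f)) r u v"
proof -
  let ?q = "\<lambda>k y. hc k y / (1 - \<tau> * hc k y)"
  let ?I = "{1..n} \<times> {1..m}"
  let ?u = "\<lambda>(k, j). tensor (\<lambda>x. complex_of_real (p j x) * \<phi> k x) (\<psi> j)"
  let ?v = "\<lambda>(k, j). tensor (\<phi> k) (\<lambda>y. ?q k y * \<psi> j y)"
  have pL: "(\<lambda>x. complex_of_real (p j x) * \<phi> k x) \<in> L2 M1" if "k \<in> {1..n}" "j \<in> {1..m}" for k j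
    by (rule ess_bounded_mult_L2[OF W.hc_bounded[OF that(2)] phi_L2[OF that(1)]])
  have uL: "tensor (\<lambda>x. complex_of_real (p j x) * \<phi> k x) (\<psi> j) \<in> L2 M" if "k \<in> {1..n}" "j \<in> {1..m}" for k j
    by (rule tensor_L2[OF pL[OF that] W.phi_L2[OF that(2)]])
  show ?thesis
  proof (rule finite_rank_rep_exI[where I = ?I and u = ?u and v = ?v])
    fix f assume f: "f \<in> L2 M"
    note f' = L2_swap(1)[OF f]
    let ?F = "W.multiplier (\<lambda>j x. complex_of_real (p j x)) (f \<circ> prod.swap) \<circ> prod.swap"
    have TF: "AE z in M. T\<^sub>2 f z = ?F z"
      using AE_swap'[OF W.T_eq_multiplier[OF f']] by (simp add: T2_op_eq_swap_op swap_op_def)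
    have FL: "?F \<in> L2 M"
      by (rule L2_swap'[OF bounded_op_L2[OF W.bounded_op_multiplier[OF W.hc_bounded] f']])
    have c: "partial_inner M1 (\<phi> k) ?F y = (\<Sum>j=1..m. L2_inner M f (?u (k, j)) * \<psi> j y)"
      if k: "k \<in> {1..n}" for k y
    proof -
      let ?b = "\<lambda>j. partial_inner M2 (\<psi> j) (f \<circ> prod.swap)"
      have bL: "?b j \<in> L2 M1" if "j \<in> {1..m}" for j
        by (rule W.partial_inner_L2[OF W.phi_L2[OF that] f'])
      have pbL: "(\<lambda>x. complex_of_real (p j x) * ?b j x) \<in> L2 M1" if "j \<in> {1..m}" for j
        by (rule ess_bounded_mult_L2[OF W.hc_bounded[OF that] bL[OF that]])
      have "partial_inner M1 (\<phi> k) ?F y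
          = L2_inner M1 (\<lambda>x. \<Sum>j=1..m. \<psi> j y * (complex_of_real (p j x) * ?b j x)) (\<phi> k)"
        unfolding partial_inner_section by (simp add: fibre_op_def)
      also have "\<dots> = (\<Sum>j=1..m. \<psi> j y * L2_inner M1 (\<lambda>x. complex_of_real (p j x) * ?b j x) (\<phi> k))"
        by (subst L2_inner_sum_left) (intro L2_cmult pbL phi_L2 k refl | assumption | simp only: L2_inner_cmult_left)+
      also have "\<dots> = (\<Sum>j=1..m. L2_inner M f (?u (k, j)) * \<psi> j y)"
      proof (rule sum.cong[OF refl])
        fix j assume j: "j \<in> {1..m}"
        have "L2_inner M f (?u (k, j)) = L2_inner M' (f \<circ> prod.swap) (?u (k, j) \<circ> prod.swap)"
          using uL[OF k j] by (simp add: L2_inner_swap f)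
        also have "?u (k, j) \<circ> prod.swap = tensor (\<psi> j) (\<lambda>x. complex_of_real (p j x) * \<phi> k x)"
          by (auto simp: fun_eq_iff)
        also have "L2_inner M' (f \<circ> prod.swap) \<dots> = L2_inner M1 (?b j) (\<lambda>x. complex_of_real (p j x) * \<phi> k x)"
          by (rule W.inner_tensor[OF W.phi_L2[OF j] pL[OF k j] f'])
        also have "\<dots> = L2_inner M1 (\<lambda>x. complex_of_real (p j x) * ?b j x) (\<phi> k)"
          by (simp add: L2_inner_def ac_simps)
        finally show "\<psi> j y * L2_inner M1 (\<lambda>x. complex_of_real (p j x) * ?b j x) (\<phi> k)
            = L2_inner M f (?u (k, j)) * \<psi> j y" by simp
      qed
      finally show ?thesis .
    qed
    have S1_alt: "S1_op M1 n \<phi> h \<tau> g (x, y) = (\<Sum>k=1..n. \<phi> k x * (?q k y * partial_inner M1 (\<phi> k) g y))"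
      for g x y
      by (simp add: S1_op_eq fibre_op_def)
    have "AE z in M. S1_op M1 n \<phi> h \<tau> (T\<^sub>2 f) z = S1_op M1 n \<phi> h \<tau> ?F z"
      by (rule bounded_op_cong[OF S bounded_op_L2[OF bounded_op_T2 f] FL TF])
    moreover have "S1_op M1 n \<phi> h \<tau> ?F z = (\<Sum>i\<in>?I. L2_inner M f (?u i) * ?v i z)" for z
    proof (cases z)
      case (Pair x y)
      have "S1_op M1 n \<phi> h \<tau> ?F z = (\<Sum>k=1..n. \<phi> k x * (?q k y * (\<Sum>j=1..m. L2_inner M f (?u (k, j)) * \<psi> j y)))"
        unfolding S1_alt Pair by (intro sum.cong refl) (simp only: c)
      also have "\<dots> = (\<Sum>k=1..n. \<Sum>j=1..m. L2_inner M f (?u (k, j)) * ?v (k, j) z)"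
        unfolding sum_distrib_left by (intro sum.cong refl) (simp add: Pair)
      also have "\<dots> = (\<Sum>i\<in>?I. L2_inner M f (?u i) * ?v i z)"
        by (simp add: sum.cartesian_product case_prod_unfold)
      finally show ?thesis .
    qed
    ultimately show "AE z in M. S1_op M1 n \<phi> h \<tau> (T\<^sub>2 f) z = (\<Sum>i\<in>?I. L2_inner M f (?u i) * ?v i z)"
      by simp
  next
    fix i assume "i \<in> ?I"
    then obtain k j where i: "i = (k, j)" and k: "k \<in> {1..n}" and j: "j \<in> {1..m}" by blast
    show "?u i \<in> L2 M" unfolding i prod.case by (rule uL[OF k j])
    show "?v i \<in> L2 M"
      unfolding i prod.case by (rule tensor_L2[OF phi_L2[OF k] ess_bounded_mult_L2[OF qb[OF k] W.phi_L2[OF j]]])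
  qed simp
qed

text \<open>With \<open>A\<^sub>i = E - \<tau> T\<^sub>i\<close> and \<open>K = \<tau>\<^sup>2 W\<^sub>1(\<tau>)\<close> the relation \<open>A\<^sub>1 S\<^sub>1 = T\<^sub>1\<close> gives
  \<open>A\<^sub>1 A\<^sub>2 (E - K) = A\<^sub>1 A\<^sub>2 - \<tau>\<^sup>2 A\<^sub>1 S\<^sub>1 T\<^sub>2 = A\<^sub>1 A\<^sub>2 - \<tau>\<^sup>2 T\<^sub>1 T\<^sub>2 = E - \<tau> (T\<^sub>1 + T\<^sub>2)\<close>.\<close>

lemma W1_finite_rank_perturbation:
  assumes \<tau>: "\<tau> \<noteq> 0" and r1: "inverse \<tau> \<in> resolvent_set M T" and r2: "inverse \<tau> \<in> resolvent_set M T\<^sub>2"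
  shows "\<exists>A R. finite_rank_perturbation M (\<lambda>f z. f z - \<tau> * Tsum f z) A R
    (\<lambda>f z. \<tau>\<^sup>2 * W1_op M1 M2 n m \<phi> h \<psi> p \<tau> f z)"
proof -
  define A1 where "A1 = (\<lambda>f z. f z - \<tau> * T f z)"
  define A2 where "A2 = (\<lambda>f z. f z - \<tau> * T\<^sub>2 f z)"
  define R2 where "R2 = inverse_op M A2"
  define S where "S = S1_op M1 n \<phi> h \<tau>"
  define K where "K = (\<lambda>f z. \<tau>\<^sup>2 * R2 (S (T\<^sub>2 f)) z)"
  have \<tau>i: "inverse \<tau> \<noteq> 0" using \<tau> by simp
  obtain \<epsilon> where \<epsilon>: "\<epsilon> > 0" "\<And>k. k \<in> {1..n} \<Longrightarrow> AE y in M2. \<epsilon> \<le> cmod (1 - \<tau> * hc k y)"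
    using not_ess_range_inverse[OF \<tau>] r1 resolvent_set_T[OF \<tau>i] by blast
  have gap: "bounded_op M S" "is_inverse_op M A1 (\<lambda>f z. f z + \<tau> * S f z)"
    and S_eq: "\<And>f. f \<in> L2 M \<Longrightarrow> AE z in M. S f z - \<tau> * T (S f) z = T f z"
    unfolding S_def A1_def by (rule gap_imp_S1[OF \<epsilon>]; assumption)+
  have b1: "bounded_op M A1" unfolding A1_def by (rule bounded_op_id_minus[OF bounded_op_T])
  have b2: "bounded_op M A2" unfolding A2_def by (rule bounded_op_id_minus[OF bounded_op_T2])
  obtain R1 where R1: "is_inverse_op M A1 R1" using gap(2) by blast
  have "\<exists>R. is_inverse_op M A2 R"
    using inverse_in_resolvent_set_iff[OF bounded_op_T2 \<tau>] r2 by (simp add: A2_def)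
  then have R2: "is_inverse_op M A2 R2"
    unfolding R2_def inverse_op_def by (rule someI_ex)
  note bR2 = is_inverse_opD(1)[OF R2]
  have bST: "bounded_op M (\<lambda>f. S (T\<^sub>2 f))" by (rule bounded_op_comp[OF gap(1) bounded_op_T2])
  have bK: "bounded_op M K"
    unfolding K_def by (rule bounded_op_scaled[OF bounded_op_comp[OF bR2 bST]])
  obtain r u v where "finite_rank_rep M (\<lambda>f. S (T\<^sub>2 f)) r u v"
    using S1_T2_finite_rank[OF gap(1)[unfolded S_def] gap_imp_ess_bounded[OF \<epsilon>]] unfolding S_def by blast
  from finite_rank_rep_comp[OF this bounded_op_scaled[OF bR2, of "\<tau>\<^sup>2"] bounded_op_L2[OF bST]]
  have rank: "\<exists>r u v. finite_rank_rep M K r u v" unfolding K_def by blast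
  have factor: "AE z in M. f z - \<tau> * Tsum f z = A1 (A2 (\<lambda>z. f z - K f z)) z" if f: "f \<in> L2 M" for f
  proof -
    let ?g = "S (T\<^sub>2 f)"
    note T2L = bounded_op_L2[OF bounded_op_T2 f] and KL = bounded_op_L2[OF bK f]
      and gL = bounded_op_L2[OF bST f] and A2L = bounded_op_L2[OF b2 f]
    have RL: "R2 ?g \<in> L2 M" by (rule bounded_op_L2[OF bR2 gL])
    have cL: "(\<lambda>z. \<tau>\<^sup>2 * ?g z) \<in> L2 M" by (rule L2_cmult[OF gL])
    have k1: "AE z in M. A2 (\<lambda>z. f z - K f z) z = A2 f z - \<tau>\<^sup>2 * ?g z"
      using bounded_op_diff[OF b2 f KL] bounded_op_cmult[OF b2 RL, of "\<tau>\<^sup>2"] is_inverse_opD(3)[OF R2 gL]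
      by eventually_elim (simp add: K_def)
    have "AE z in M. A1 (A2 (\<lambda>z. f z - K f z)) z = A1 (\<lambda>z. A2 f z - \<tau>\<^sup>2 * ?g z) z"
      by (rule bounded_op_cong[OF b1 bounded_op_L2[OF b2 L2_diff[OF f KL]] L2_diff[OF A2L cL] k1])
    moreover have "AE z in M. A1 (\<lambda>z. A2 f z - \<tau>\<^sup>2 * ?g z) z = A1 (A2 f) z - A1 (\<lambda>z. \<tau>\<^sup>2 * ?g z) z"
      by (rule bounded_op_diff[OF b1 A2L cL])
    moreover have "AE z in M. A1 (\<lambda>z. \<tau>\<^sup>2 * ?g z) z = \<tau>\<^sup>2 * A1 ?g z"
      by (rule bounded_op_cmult[OF b1 gL])
    moreover have "AE z in M. A1 ?g z = T (T\<^sub>2 f) z"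
      using S_eq[OF T2L] by (simp add: A1_def)
    moreover have "AE z in M. T (A2 f) z = T f z - \<tau> * T (T\<^sub>2 f) z"
      using bounded_op_diff[OF bounded_op_T f L2_cmult[OF T2L, of \<tau>]]
        bounded_op_cmult[OF bounded_op_T T2L, of \<tau>]
      unfolding A2_def by eventually_elim simp
    ultimately show ?thesis
    proof eventually_elim
      case (elim z)
      have "A1 (A2 (\<lambda>z. f z - K f z)) z = A1 (A2 f) z - \<tau>\<^sup>2 * T (T\<^sub>2 f) z"
        using elim by simp
      also have "A1 (A2 f) z = f z - \<tau> * T\<^sub>2 f z - \<tau> * (T f z - \<tau> * T (T\<^sub>2 f) z)"
        using elim(5) by (simp add: A1_def) (simp add: A2_def)
      finally show ?case by (simp add: algebra_simps power2_eq_square)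
    qed
  qed
  have "(\<lambda>f z. \<tau>\<^sup>2 * W1_op M1 M2 n m \<phi> h \<psi> p \<tau> f z) = K"
    unfolding K_def R2_def A2_def S_def W1_op_def ..
  moreover have "finite_rank_perturbation M (\<lambda>f z. f z - \<tau> * Tsum f z) (\<lambda>f. A1 (A2 f)) (\<lambda>f. R2 (R1 f)) K"
    by (rule finite_rank_perturbation.intro)
      (rule bounded_op_comp[OF b1 b2] is_inverse_op_comp[OF b1 b2 R1 R2]
        bounded_op_id_minus[OF bounded_op_Tsum] bK rank factor; assumption?)+
  ultimately show ?thesis by (intro exI) simp
qed

lemma discrete_spectrum_eq: "discrete_spectrum M Tsum = D0_set M1 M2 n m \<phi> h \<psi> p"
proof (intro equalityI subsetI)
  fix l assume l: "l \<in> discrete_spectrum M Tsum"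
  note res = discrete_imp_resolvent[OF l]
  define \<tau> where "\<tau> = inverse l"
  have \<tau>: "\<tau> \<noteq> 0" "inverse \<tau> = l" using res(1) by (auto simp: \<tau>_def)
  obtain A R where "finite_rank_perturbation M (\<lambda>f z. f z - \<tau> * Tsum f z) A R
    (\<lambda>f z. \<tau>\<^sup>2 * W1_op M1 M2 n m \<phi> h \<psi> p \<tau> f z)"
    using W1_finite_rank_perturbation[OF \<tau>(1)] res(2,3) \<tau>(2) by auto
  then interpret finite_rank_perturbation M "\<lambda>f z. f z - \<tau> * Tsum f z" A R
    "\<lambda>f z. \<tau>\<^sup>2 * W1_op M1 M2 n m \<phi> h \<psi> p \<tau> f z" .
  have "l \<notin> resolvent_set M Tsum"
    using l by (auto simp: discrete_spectrum_def isolated_in_def spectrum_def)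
  then have "Delta1 M1 M2 n m \<phi> h \<psi> p \<tau> = 0"
    using fredholm_det_neq_0_imp_inverse inverse_in_resolvent_set_iff[OF bounded_op_Tsum \<tau>(1)] \<tau>(2)
    unfolding Delta1_def by blast
  then have "\<tau> \<in> D_set M1 M2 n m \<phi> h \<psi> p"
    using \<tau> res by (simp add: D_set_def)
  then show "l \<in> D0_set M1 M2 n m \<phi> h \<psi> p"
    using \<tau> unfolding D0_set_def by (auto simp: inverse_eq_divide)
next
  fix l assume "l \<in> D0_set M1 M2 n m \<phi> h \<psi> p"
  then obtain \<tau> where \<tau>: "\<tau> \<noteq> 0" and l: "l = inverse \<tau>"
    and r1: "inverse \<tau> \<in> resolvent_set M T" and r2: "inverse \<tau> \<in> resolvent_set M T\<^sub>2"
    and \<Delta>: "Delta1 M1 M2 n m \<phi> h \<psi> p \<tau> = 0"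
    by (auto simp: D0_set_def D_set_def inverse_eq_divide)
  obtain A R where frp: "finite_rank_perturbation M (\<lambda>f z. f z - \<tau> * Tsum f z) A R
    (\<lambda>f z. \<tau>\<^sup>2 * W1_op M1 M2 n m \<phi> h \<psi> p \<tau> f z)"
    using W1_finite_rank_perturbation[OF \<tau> r1 r2] by blast
  then interpret finite_rank_perturbation M "\<lambda>f z. f z - \<tau> * Tsum f z" A R
    "\<lambda>f z. \<tau>\<^sup>2 * W1_op M1 M2 n m \<phi> h \<psi> p \<tau> f z" .
  have eigenvalue_of_det: "is_eigenvalue M Tsum (inverse \<sigma>)"
    if "\<sigma> \<noteq> 0" "\<exists>f\<in>L2 M. (AE x in M. f x - \<sigma> * Tsum f x = 0) \<and> \<not> (AE x in M. f x = 0)" for \<sigma>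
    using that(2) unfolding is_eigenvalue_def eigenspace_iff_kernel[OF that(1)] by blast
  have ev: "is_eigenvalue M Tsum l"
    unfolding l using eigenvalue_of_det[OF \<tau>] fredholm_det_eq_0_imp_kernel \<Delta> unfolding Delta1_def by blast
  have fm: "finite_multiplicity M Tsum l"
    unfolding l finite_multiplicity_def eigenspace_iff_kernel[OF \<tau>] by (rule kernel_finite_dimensional)
  have sp: "l \<in> spectrum M Tsum"
  proof -
    have "\<not> (\<exists>S. is_inverse_op M (\<lambda>f z. f z - \<tau> * Tsum f z) S)"
      using is_inverse_op_kernel[OF _ L] fredholm_det_eq_0_imp_kernel \<Delta> unfolding Delta1_def by blast
    then show ?thesis
      using inverse_in_resolvent_set_iff[OF bounded_op_Tsum \<tau>] by (simp add: l spectrum_def)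
  qed
  obtain \<delta> where \<delta>: "\<delta> > 0" "\<And>\<mu>. is_eigenvalue M Tsum \<mu> \<Longrightarrow> cmod (\<mu> - l) < \<delta> \<Longrightarrow> \<mu> = l"
    using eigenvalue_isolated_from_eigenvalues[OF bounded_op_Tsum symmetric_Tsum \<tau> ev[unfolded l] frp]
    unfolding l by blast
  obtain \<epsilon> where \<epsilon>: "\<epsilon> > 0" "\<And>\<mu>. cmod (\<mu> - l) < \<epsilon> \<Longrightarrow>
      \<mu> \<noteq> 0 \<and> \<mu> \<in> resolvent_set M T \<and> \<mu> \<in> resolvent_set M T\<^sub>2"
    using resolvent_sets_open[of l] r1 r2 \<tau> unfolding l by auto
  have "\<mu> = l" if \<mu>: "\<mu> \<in> spectrum M Tsum" and near: "dist l \<mu> < min \<delta> \<epsilon>" for \<mu>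
  proof -
    have d: "cmod (\<mu> - l) < \<delta>" "cmod (\<mu> - l) < \<epsilon>"
      using near by (auto simp: dist_norm norm_minus_commute)
    define \<sigma> where "\<sigma> = inverse \<mu>"
    have \<sigma>: "\<sigma> \<noteq> 0" "inverse \<sigma> = \<mu>" using \<epsilon>(2)[OF d(2)] by (auto simp: \<sigma>_def)
    obtain A' R' where "finite_rank_perturbation M (\<lambda>f z. f z - \<sigma> * Tsum f z) A' R'
      (\<lambda>f z. \<sigma>\<^sup>2 * W1_op M1 M2 n m \<phi> h \<psi> p \<sigma> f z)"
      using W1_finite_rank_perturbation[OF \<sigma>(1)] \<epsilon>(2)[OF d(2)] \<sigma>(2) by auto
    then interpret \<sigma>: finite_rank_perturbation M "\<lambda>f z. f z - \<sigma> * Tsum f z" A' R'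
      "\<lambda>f z. \<sigma>\<^sup>2 * W1_op M1 M2 n m \<phi> h \<psi> p \<sigma> f z" .
    have "\<not> (\<exists>S. is_inverse_op M (\<lambda>f z. f z - \<sigma> * Tsum f z) S)"
      using inverse_in_resolvent_set_iff[OF bounded_op_Tsum \<sigma>(1)] \<mu> \<sigma>(2) by (simp add: spectrum_def)
    then have "is_eigenvalue M Tsum \<mu>"
      using \<sigma>.fredholm_det_neq_0_imp_inverse \<sigma>.fredholm_det_eq_0_imp_kernel eigenvalue_of_det[OF \<sigma>(1)]
      unfolding \<sigma>(2) by blast
    then show ?thesis using \<delta>(2) d(1) by blast
  qed
  then have "l isolated_in spectrum M Tsum"
    using sp \<delta>(1) \<epsilon>(1) unfolding isolated_in_dist_Ex_iff
    by (intro conjI exI[of _ "min \<delta> \<epsilon>"]) auto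
  with ev fm show "l \<in> discrete_spectrum M Tsum"
    by (simp add: discrete_spectrum_def)
qed

end

section \<open>Lebesgue measure on an interval\<close>

text \<open>The measure of \<open>A \<inter> {..t}\<close> is a Lipschitz function of \<open>t\<close> that runs from \<open>0\<close> to the measure of
  \<open>A\<close>, so some \<open>t\<close> halves \<open>A\<close>.\<close>

lemma nonatomic_lebesgue_on_interval: "nonatomic (lebesgue_on {a..b::real})"
  unfolding nonatomic_def
proof (intro ballI impI)
  let ?M = "lebesgue_on {a..b}"
  fix A assume A: "A \<in> sets ?M" and pos: "measure ?M A > 0"
  have AL: "A \<in> sets lebesgue" and Aab: "A \<subseteq> {a..b}"
    using A by (auto simp: sets_restrict_space_iff)
  have mM: "measure ?M B = measure lebesgue B" if "B \<subseteq> {a..b}" for B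
    using that by (simp add: measure_restrict_space)
  define F where "F t = measure lebesgue (A \<inter> {..t})" for t
  have lm: "B \<in> lmeasurable" if "B \<in> sets lebesgue" "B \<subseteq> {a..b}" for B
    using that by (intro bounded_set_imp_lmeasurable) (auto intro: bounded_subset[of "{a..b}"])
  have Ft: "A \<inter> {..t} \<in> lmeasurable" for t
    using AL Aab by (intro lm) auto
  have step: "F t \<le> F s + (t - s)" if "s \<le> t" for s t
  proof -
    have "F t \<le> measure lebesgue ((A \<inter> {..s}) \<union> {s..t})"
      unfolding F_def by (rule measure_mono_fmeasurable) (use Ft that in \<open>auto intro: fmeasurable.Un\<close>)
    also have "\<dots> \<le> F s + measure lebesgue {s..t}"
      unfolding F_def by (rule measure_Un_le) (use Ft in auto)
    finally show ?thesis using that by simp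
  qed
  have mono: "F s \<le> F t" if "s \<le> t" for s t
    unfolding F_def by (rule measure_mono_fmeasurable) (use Ft that in auto)
  have "1-lipschitz_on {a..b} F"
  proof (rule lipschitz_onI)
    fix s t
    show "dist (F s) (F t) \<le> 1 * dist s t"
      using step[of s t] step[of t s] mono[of s t] mono[of t s] by (cases "s \<le> t") (auto simp: dist_real_def)
  qed simp
  then have cont: "continuous_on {a..b} F" by (rule lipschitz_on_continuous_on)
  have ne: "a \<le> b"
  proof (rule ccontr)
    assume "\<not> a \<le> b"
    then have "A = {}" using Aab by auto
    with pos show False by simp
  qed
  have "F a \<le> measure lebesgue {a}"
    unfolding F_def by (rule measure_mono_fmeasurable) (use Aab Ft lmeasurable_cbox[of a a] in auto)
  then have Fa: "F a \<le> measure ?M A / 2" using pos by simp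
  have "A \<inter> {..b} = A" using Aab by auto
  then have Fb: "F b = measure ?M A" by (simp add: F_def mM[OF Aab])
  obtain t where t: "F t = measure ?M A / 2"
    using IVT'[of F a "measure ?M A / 2" b] Fa Fb pos ne cont by auto
  have "measure ?M (A \<inter> {..t}) = F t"
    unfolding F_def using Aab by (intro mM) auto
  with t pos show "\<exists>B\<in>sets ?M. B \<subseteq> A \<and> 0 < measure ?M B \<and> measure ?M B < measure ?M A"
    using AL Aab by (intro bexI[of _ "A \<inter> {..t}"]) (auto simp: sets_restrict_space_iff)
qed

theorem theorem5p5:
  fixes a b c d :: real
    and n m :: nat
    and \<phi> \<psi> :: "nat \<Rightarrow> real \<Rightarrow> complex"
    and h p :: "nat \<Rightarrow> real \<Rightarrow> real"
  assumes "a < b" and "c < d"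
    and "n \<ge> 1" and "m \<ge> 1"
    and "L2_orthonormal (lebesgue_on {a..b}) n \<phi>"
    and "\<forall>k\<in>{1..n}. ess_bounded (lebesgue_on {c..d}) (h k)"
    and "L2_orthonormal (lebesgue_on {c..d}) m \<psi>"
    and "\<forall>j\<in>{1..m}. ess_bounded (lebesgue_on {a..b}) (p j)"
  shows "discrete_spectrum (lebesgue_on {a..b} \<Otimes>\<^sub>M lebesgue_on {c..d})
           (\<lambda>f z. T1_op (lebesgue_on {a..b}) n \<phi> h f z + T2_op (lebesgue_on {c..d}) m \<psi> p f z)
         = D0_set (lebesgue_on {a..b}) (lebesgue_on {c..d}) n m \<phi> h \<psi> p"
proof -
  have fin: "finite_measure (lebesgue_on {s..t})" for s t :: real
    by (rule finite_measure_lebesgue_on) simp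
  have pos: "measure (lebesgue_on {s..t}) (space (lebesgue_on {s..t})) > 0" if "s < t" for s t :: real
    using that by (simp add: measure_restrict_space)
  have "two_operators (lebesgue_on {a..b}) (lebesgue_on {c..d}) n \<phi> h m \<psi> p"
    using assms
    by (intro two_operators.intro partial_integral.intro orthonormal_pair.intro finite_pair.intro
        orthonormal_pair_axioms.intro partial_integral_axioms.intro two_operators_axioms.intro
        fin pos nonatomic_lebesgue_on_interval) auto
  then show ?thesis by (rule two_operators.discrete_spectrum_eq)
qed

end
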